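(* Let $\Gamma$ be an amenable discrete group and $N$ a normal subgroup. If $\mathcal{Y}\subseteq\mathrm{Sub}(\Gamma/N)$ is a closed and conjugation-invariant set of subgroups of $\Gamma/N$, then $$J_{\Gamma,q_N^*(\mathcal{Y})}=Q_N^{-1}(J_{\Gamma/N,\mathcal{Y}})\quad\text{and}\quad Q_N\big(J_{\Gamma,q_N^*(\mathcal{Y})}\cap\mathbb{C}[\Gamma]\big)=J_{\Gamma/N,\mathcal{Y}}\cap\mathbb{C}[\Gamma/N].$$ Moreover, $q_N^*(\mathcal{Y})\in\mathcal{D}_\Gamma$ if and only if $\mathcal{Y}\in\mathcal{D}_{\Gamma/N}$. Consequently, if $\Gamma$ satisfies the Density Property, then so does $\Gamma/N$.
   Context: For an amenable discrete group $\Gamma$, $\mathrm{Sub}(\Gamma)$ is the set of subgroups of $\Gamma$ with the Chabauty topology (the subspace topology from $\{0,1\}^\Gamma$ with the product topology via $X\mapsto\mathbbm{1}_X$). For $X\in\mathrm{Sub}(\Gamma)$, $\lambda_{\Gamma/X}$ is the quasi-regular representation on $\ell^2(\Gamma/X)$, $\lambda_{\Gamma/X}(g)\delta_{hX}=\delta_{ghX}$, extended to $C^*_r(\Gamma)=C^*(\Gamma)$. For $\mathcal{X}\subseteq\mathrm{Sub}(\Gamma)$, $J_{\Gamma,\mathcal{X}}:=\bigcap_{X\in\mathcal{X}}\ker(\lambda_{\Gamma/X})\trianglelefteq C^*_r(\Gamma)$. $\mathcal{D}_\Gamma$ is the set of all closed, conjugation-invariant $\mathcal{X}\subseteq\mathrm{Sub}(\Gamma)$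 such that $J_{\Gamma,\mathcal{X}}\cap\mathbb{C}[\Gamma]$ is dense in $J_{\Gamma,\mathcal{X}}$. $\Gamma$ satisfies the Density Property if $\mathcal{D}_\Gamma$ contains all closed conjugation-invariant sets of subgroups. For a normal subgroup $N$, $q_N\colon\Gamma\to\Gamma/N$ is the quotient map, $Q_N\colon C^*_r(\Gamma)\to C^*_r(\Gamma/N)$ the induced $^*$-homomorphism, and $q_N^*\colon\mathrm{Sub}(\Gamma/N)\to\mathrm{Sub}(\Gamma)$, $Y\mapsto q_N^{-1}(Y)$; if $\mathcal{Y}$ is closed and conjugation-invariant, so is $q_N^*(\mathcal{Y})$. *)

theory Defs
  imports
    "HOL-Analysis.Analysis"
    "HOL-Algebra.Coset"
    "HOL-Algebra.Left_Coset"
begin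

section \<open>The Hilbert space of square-summable functions\<close>

text \<open>
  The Hilbert space \<open>\<ell>\<^sup>2(S)\<close> of a subset \<open>S\<close> of a type is treated as the closed subspace of
  \<open>\<ell>\<^sup>2\<close> of the whole type consisting of the functions vanishing off \<open>S\<close>, and \<open>B(\<ell>\<^sup>2(S))\<close> as the
  corner of those operators that vanish on the orthogonal complement of \<open>\<ell>\<^sup>2(S)\<close> and
  map into \<open>\<ell>\<^sup>2(S)\<close>; this embedding of *-algebras is isometric.
\<close>

typedef 'i ell2 = "{f :: 'i \<Rightarrow> complex. (\<lambda>i. (cmod (f i))\<^sup>2) summable_on UNIV}"
  morphisms ell2_apply Abs_ell2
  by (rule exI[of _ "\<lambda>_. 0"]) simp

setup_lifting type_definition_ell2

lemma sq_summable_add: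
  assumes "(\<lambda>i. (cmod (f i))\<^sup>2) summable_on A" "(\<lambda>i. (cmod (g i))\<^sup>2) summable_on A"
  shows "(\<lambda>i. (cmod (f i + g i))\<^sup>2) summable_on A"
proof (rule summable_on_comparison_test)
  show "(\<lambda>i. 2 * (cmod (f i))\<^sup>2 + 2 * (cmod (g i))\<^sup>2) summable_on A"
    by (intro summable_on_add summable_on_cmult_right assms)
  fix i
  have "(cmod (f i + g i))\<^sup>2 \<le> (cmod (f i) + cmod (g i))\<^sup>2"
    by (simp add: norm_triangle_ineq power_mono)
  also have "\<dots> \<le> 2 * (cmod (f i))\<^sup>2 + 2 * (cmod (g i))\<^sup>2"
    using zero_le_power2[of "cmod (f i) - cmod (g i)"] by (simp add: power2_eq_square algebra_simps)
  finally show "(cmod (f i + g i))\<^sup>2 \<le> 2 * (cmod (f i))\<^sup>2 + 2 * (cmod (g i))\<^sup>2" .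
qed simp

lemma sq_summable_cmult:
  assumes "(\<lambda>i. (cmod (f i))\<^sup>2) summable_on A"
  shows "(\<lambda>i. (cmod (c * f i))\<^sup>2) summable_on A"
  using summable_on_cmult_right[OF assms, of "(cmod c)\<^sup>2"] by (simp add: norm_mult power_mult_distrib)

lemma prod_summable:
  assumes "(\<lambda>i. (cmod (f i))\<^sup>2) summable_on A" "(\<lambda>i. (cmod (g i))\<^sup>2) summable_on A"
  shows "(\<lambda>i. f i * cnj (g i)) summable_on A"
proof (rule abs_summable_summable, rule summable_on_comparison_test)
  show "(\<lambda>i. (cmod (f i))\<^sup>2 + (cmod (g i))\<^sup>2) summable_on A"
    by (intro summable_on_add assms)
  fix i
  have "0 \<le> (cmod (f i) - cmod (g i))\<^sup>2" "0 \<le> cmod (f i) * cmod (g i)"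
    by simp_all
  then show "cmod (f i * cnj (g i)) \<le> (cmod (f i))\<^sup>2 + (cmod (g i))\<^sup>2"
    unfolding power2_diff norm_mult complex_mod_cnj by linarith
qed simp

lift_definition cinner :: "'i ell2 \<Rightarrow> 'i ell2 \<Rightarrow> complex"
  is "\<lambda>f g. \<Sum>\<^sub>\<infinity>i. f i * cnj (g i)" .

lift_definition scaleC_ell2 :: "complex \<Rightarrow> 'i ell2 \<Rightarrow> 'i ell2"
  is "\<lambda>c f i. c * f i"
  using sq_summable_cmult by auto

instantiation ell2 :: (type) real_inner
begin

lift_definition zero_ell2 :: "'a ell2" is "\<lambda>_. 0" by simp
lift_definition plus_ell2 :: "'a ell2 \<Rightarrow> 'a ell2 \<Rightarrow> 'a ell2" is "\<lambda>f g i. f i + g i"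
  using sq_summable_add by auto
lift_definition uminus_ell2 :: "'a ell2 \<Rightarrow> 'a ell2" is "\<lambda>f i. - f i" by simp
lift_definition minus_ell2 :: "'a ell2 \<Rightarrow> 'a ell2 \<Rightarrow> 'a ell2" is "\<lambda>f g i. f i - g i"
  using sq_summable_add[where g = "\<lambda>i. - g i" for g] by auto
lift_definition scaleR_ell2 :: "real \<Rightarrow> 'a ell2 \<Rightarrow> 'a ell2" is "\<lambda>r f i. complex_of_real r * f i"
  using sq_summable_cmult by auto
definition inner_ell2 :: "'a ell2 \<Rightarrow> 'a ell2 \<Rightarrow> real" where "inner_ell2 x y = Re (cinner x y)"
definition norm_ell2 :: "'a ell2 \<Rightarrow> real" where "norm_ell2 x = sqrt (inner x x)"
definition sgn_ell2 :: "'a ell2 \<Rightarrow> 'a ell2" where "sgn_ell2 x = inverse (norm x) *\<^sub>R x"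
definition dist_ell2 :: "'a ell2 \<Rightarrow> 'a ell2 \<Rightarrow> real" where "dist_ell2 x y = norm (x - y)"
definition uniformity_ell2 :: "('a ell2 \<times> 'a ell2) filter"
  where "uniformity_ell2 = (INF e\<in>{0<..}. principal {(x, y). dist x y < e})"
definition open_ell2 :: "'a ell2 set \<Rightarrow> bool"
  where "open_ell2 U \<longleftrightarrow> (\<forall>x\<in>U. \<forall>\<^sub>F (x', y) in uniformity. x' = x \<longrightarrow> y \<in> U)"

instance
proof
  fix x y z :: "'a ell2" and r s :: real
  show "x + y + z = x + (y + z)" by transfer (simp add: add.assoc)
  show "x + y = y + x" by transfer (simp add: add.commute)
  show "0 + x = x" by transfer simp
  show "- x + x = 0" by transfer simp
  show "x - y = x + - y" by transfer simp
  show "r *\<^sub>R (x + y) = r *\<^sub>R x + r *\<^sub>R y" by transfer (simp add: algebra_simps)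
  show "(r + s) *\<^sub>R x = r *\<^sub>R x + s *\<^sub>R x" by transfer (simp add: algebra_simps)
  show "r *\<^sub>R s *\<^sub>R x = (r * s) *\<^sub>R x" by transfer (simp add: algebra_simps)
  show "1 *\<^sub>R x = x" by transfer simp
  have self: "inner x x = (\<Sum>\<^sub>\<infinity>i. (cmod (ell2_apply x i))\<^sup>2)"
    and sm: "(\<lambda>i. (cmod (ell2_apply x i))\<^sup>2) summable_on UNIV" for x :: "'a ell2"
  proof -
    show sm: "(\<lambda>i. (cmod (ell2_apply x i))\<^sup>2) summable_on UNIV"
      using ell2_apply[of x] by simp
    have "Re (\<Sum>\<^sub>\<infinity>i. ell2_apply x i * cnj (ell2_apply x i))
        = (\<Sum>\<^sub>\<infinity>i. Re (ell2_apply x i * cnj (ell2_apply x i)))"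
      by (rule infsum_Re[symmetric], rule prod_summable[OF sm sm])
    then show "inner x x = (\<Sum>\<^sub>\<infinity>i. (cmod (ell2_apply x i))\<^sup>2)"
      unfolding inner_ell2_def cinner.rep_eq
      by (simp only: complex_mult_cnj Re_complex_of_real cmod_power2)
  qed
  have cc: "cinner y x = cnj (cinner x y)"
    by transfer (simp flip: infsum_cnj add: mult.commute)
  show "inner x y = inner y x" unfolding inner_ell2_def cc by simp
  have "cinner (x + y) z = cinner x z + cinner y z"
    by transfer (simp add: infsum_add prod_summable distrib_right)
  then show "inner (x + y) z = inner x z + inner y z" unfolding inner_ell2_def by simp
  have "cinner (r *\<^sub>R x) y = complex_of_real r * cinner x y"
    by transfer (simp add: infsum_cmult_right' mult.assoc)
  then show "inner (r *\<^sub>R x) y = r * inner x y" unfolding inner_ell2_def by simp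
  show "0 \<le> inner x x" unfolding self by (rule infsum_nonneg) simp
  show "inner x x = 0 \<longleftrightarrow> x = 0"
  proof
    assume "inner x x = 0"
    then have "(cmod (ell2_apply x i))\<^sup>2 = 0" for i
      using nonneg_infsum_le_0D[where f = "\<lambda>i. (cmod (ell2_apply x i))\<^sup>2" and A = UNIV and x = i, OF _ sm]
      unfolding self by simp
    then show "x = 0" by (intro ell2_apply_inject[THEN iffD1] ext) (simp add: zero_ell2.rep_eq)
  qed (simp add: self zero_ell2.rep_eq)
qed (rule norm_ell2_def sgn_ell2_def dist_ell2_def uniformity_ell2_def open_ell2_def)+

end

lemma norm_ell2_eq: "norm x = sqrt (\<Sum>\<^sub>\<infinity>i. (cmod (ell2_apply x i))\<^sup>2)"
proof -
  have sm: "(\<lambda>i. (cmod (ell2_apply x i))\<^sup>2) summable_on UNIV"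
    using ell2_apply[of x] by simp
  have "Re (\<Sum>\<^sub>\<infinity>i. ell2_apply x i * cnj (ell2_apply x i))
      = (\<Sum>\<^sub>\<infinity>i. Re (ell2_apply x i * cnj (ell2_apply x i)))"
    by (rule infsum_Re[symmetric], rule prod_summable[OF sm sm])
  then show ?thesis
    unfolding norm_ell2_def inner_ell2_def cinner.rep_eq
    by (simp only: complex_mult_cnj Re_complex_of_real cmod_power2)
qed

lift_definition scaleC_op :: "complex \<Rightarrow> 'i ell2 \<Rightarrow>\<^sub>L 'i ell2" is scaleC_ell2
proof
  fix c :: complex and x y :: "'i ell2" and r :: real
  show "scaleC_ell2 c (x + y) = scaleC_ell2 c x + scaleC_ell2 c y"
    by transfer (simp add: algebra_simps)
  show "scaleC_ell2 c (r *\<^sub>R x) = r *\<^sub>R scaleC_ell2 c x"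
    by transfer (simp add: algebra_simps)
  show "\<exists>K. \<forall>x :: 'i ell2. norm (scaleC_ell2 c x) \<le> norm x * K"
  proof (intro exI allI)
    fix x :: "'i ell2"
    have "norm (scaleC_ell2 c x) = cmod c * norm x"
      unfolding norm_ell2_eq scaleC_ell2.rep_eq
      by (simp add: norm_mult power_mult_distrib infsum_cmult_right' real_sqrt_mult)
    then show "norm (scaleC_ell2 c x) \<le> norm x * cmod c" by (simp add: mult.commute)
  qed
qed

definition delta :: "'i \<Rightarrow> 'i ell2" where
  "delta s = Abs_ell2 (\<lambda>i. if i = s then 1 else 0)"

definition adjoint_pair :: "('i ell2 \<Rightarrow>\<^sub>L 'i ell2) \<Rightarrow> ('i ell2 \<Rightarrow>\<^sub>L 'i ell2) \<Rightarrow> bool" where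
  "adjoint_pair T T' \<longleftrightarrow> (\<forall>x y. cinner (blinfun_apply T x) y = cinner x (blinfun_apply T' y))"

text \<open>For a permutation \<open>\<sigma>\<close> of \<open>S\<close>; see \<open>perm_op_delta\<close> below for its effect on the standard basis.\<close>
definition perm_op :: "'i set \<Rightarrow> ('i \<Rightarrow> 'i) \<Rightarrow> 'i ell2 \<Rightarrow>\<^sub>L 'i ell2" where
  "perm_op S \<sigma> = Blinfun (\<lambda>x. Abs_ell2 (\<lambda>i. if i \<in> S then ell2_apply x (inv_into S \<sigma> i) else 0))"

lemma perm_op_apply:
  assumes \<sigma>: "bij_betw \<sigma> S S"
  shows "ell2_apply (blinfun_apply (perm_op S \<sigma>) x) i
    = (if i \<in> S then ell2_apply x (inv_into S \<sigma> i) else 0)"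
proof -
  let ?f = "\<lambda>x i. if i \<in> S then ell2_apply x (inv_into S \<sigma> i) else 0"
  have bij: "bij_betw (inv_into S \<sigma>) S S" by (rule bij_betw_inv_into[OF \<sigma>])
  have sm: "(\<lambda>i. (cmod (ell2_apply x i))\<^sup>2) summable_on A" for x :: "'a ell2" and A
    using ell2_apply[of x] by (auto intro: summable_on_subset_banach)
  have sm1: "(\<lambda>i. (cmod (ell2_apply x (inv_into S \<sigma> i)))\<^sup>2) summable_on S" for x
    using summable_on_reindex_bij_betw[OF bij, of "\<lambda>i. (cmod (ell2_apply x i))\<^sup>2"] sm by auto
  have sm2: "(\<lambda>i. (cmod (?f x i))\<^sup>2) summable_on UNIV" for x
    using sm1[of x] by (rule summable_on_cong_neutral[THEN iffD1, rotated -1]) auto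
  have rep: "ell2_apply (Abs_ell2 (?f x)) = ?f x" for x
    by (rule Abs_ell2_inverse) (use sm2 in simp)
  have "bounded_linear (\<lambda>x. Abs_ell2 (?f x))"
  proof
    show "Abs_ell2 (?f (x + y)) = Abs_ell2 (?f x) + Abs_ell2 (?f y)" for x y
      by (rule ell2_apply_inject[THEN iffD1]) (auto simp: rep plus_ell2.rep_eq)
    show "Abs_ell2 (?f (r *\<^sub>R x)) = r *\<^sub>R Abs_ell2 (?f x)" for x and r
      by (rule ell2_apply_inject[THEN iffD1]) (auto simp: rep scaleR_ell2.rep_eq)
    have "norm (Abs_ell2 (?f x)) \<le> norm x * 1" for x
    proof -
      have "(\<Sum>\<^sub>\<infinity>i. (cmod (?f x i))\<^sup>2) = (\<Sum>\<^sub>\<infinity>i\<in>S. (cmod (ell2_apply x (inv_into S \<sigma> i)))\<^sup>2)"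
        by (rule infsum_cong_neutral) auto
      also have "\<dots> = (\<Sum>\<^sub>\<infinity>i\<in>S. (cmod (ell2_apply x i))\<^sup>2)"
        by (rule infsum_reindex_bij_betw[OF bij])
      also have "\<dots> \<le> (\<Sum>\<^sub>\<infinity>i. (cmod (ell2_apply x i))\<^sup>2)"
        by (rule infsum_mono_neutral) (use sm in auto)
      finally show ?thesis by (simp add: norm_ell2_eq rep)
    qed
    then show "\<exists>K. \<forall>x. norm (Abs_ell2 (?f x)) \<le> norm x * K" by blast
  qed
  then show ?thesis by (simp add: perm_op_def bounded_linear_Blinfun_apply rep)
qed

lemma perm_op_delta:
  assumes "bij_betw \<sigma> S S"
  shows "blinfun_apply (perm_op S \<sigma>) (delta s) = (if s \<in> S then delta (\<sigma> s) else 0)"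
proof -
  have d: "ell2_apply (delta s) i = (if i = s then 1 else 0)" for s i :: 'a
  proof -
    have "(\<lambda>i. (cmod (if i = s then 1 else 0))\<^sup>2) summable_on {s}" by simp
    then have "(\<lambda>i. (cmod (if i = s then 1 else 0))\<^sup>2) summable_on UNIV"
      by (rule summable_on_cong_neutral[THEN iffD1, rotated -1]) auto
    then show ?thesis by (simp add: delta_def Abs_ell2_inverse)
  qed
  have "inv_into S \<sigma> i = s \<longleftrightarrow> s \<in> S \<and> i = \<sigma> s" if "i \<in> S" for i
    using assms that by (metis bij_betw_imp_surj_on bij_betw_inv_into_left f_inv_into_f inv_into_into)
  moreover have "\<sigma> s \<in> S" if "s \<in> S" using assms that by (auto simp: bij_betw_def)
  ultimately show ?thesis
    by (intro ell2_apply_inject[THEN iffD1] ext)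
      (auto simp: perm_op_apply[OF assms] d zero_ell2.rep_eq)
qed


section \<open>Amenability and spaces of subgroups\<close>

text \<open>
  Existence of a left-invariant mean on the bounded real-valued functions on the group. Positivity
  and linearity force \<open>m f\<close> to depend on the restriction of \<open>f\<close> to the carrier only.
\<close>
definition amenable :: "('a, 'b) monoid_scheme \<Rightarrow> bool" where
  "amenable G \<longleftrightarrow> (\<exists>m :: ('a \<Rightarrow> real) \<Rightarrow> real.
     (\<forall>f h. bounded (f ` carrier G) \<longrightarrow> bounded (h ` carrier G) \<longrightarrow>
        m (\<lambda>x. f x + h x) = m f + m h) \<and>
     (\<forall>r f. bounded (f ` carrier G) \<longrightarrow> m (\<lambda>x. r * f x) = r * m f) \<and>
     (\<forall>f. bounded (f ` carrier G) \<longrightarrow> (\<forall>x\<in>carrier G. 0 \<le> f x) \<longrightarrow> 0 \<le> m f) \<and>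
     m (\<lambda>_. 1) = 1 \<and>
     (\<forall>g\<in>carrier G. \<forall>f. bounded (f ` carrier G) \<longrightarrow> m (\<lambda>x. f (g \<otimes>\<^bsub>G\<^esub> x)) = m f))"

definition Sub :: "('a, 'b) monoid_scheme \<Rightarrow> 'a set set" where
  "Sub G = {X. subgroup X G}"

definition chabauty :: "('a, 'b) monoid_scheme \<Rightarrow> 'a set topology" where
  "chabauty G = pullback_topology (Sub G) (\<lambda>X. \<lambda>g\<in>carrier G. g \<in> X)
     (product_topology (\<lambda>_. discrete_topology (UNIV :: bool set)) (carrier G))"

definition conj_invariant :: "('a, 'b) monoid_scheme \<Rightarrow> 'a set set \<Rightarrow> bool" where
  "conj_invariant G \<X> \<longleftrightarrow> (\<forall>X\<in>\<X>. \<forall>g\<in>carrier G. g <#\<^bsub>G\<^esub> X #>\<^bsub>G\<^esub> inv\<^bsub>G\<^esub> g \<in> \<X>)"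

definition quot_map :: "('a, 'b) monoid_scheme \<Rightarrow> 'a set \<Rightarrow> 'a \<Rightarrow> 'a set" where
  "quot_map G N g = N #>\<^bsub>G\<^esub> g"

definition quot_pull :: "('a, 'b) monoid_scheme \<Rightarrow> 'a set \<Rightarrow> 'a set set \<Rightarrow> 'a set" where
  "quot_pull G N Y = {g \<in> carrier G. quot_map G N g \<in> Y}"


section \<open>The reduced group C*-algebra and its quasi-regular representations\<close>

definition left_reg :: "('a, 'b) monoid_scheme \<Rightarrow> 'a \<Rightarrow> 'a ell2 \<Rightarrow>\<^sub>L 'a ell2" where
  "left_reg G g = perm_op (carrier G) (\<lambda>h. g \<otimes>\<^bsub>G\<^esub> h)"

definition quasi_reg ::
    "('a, 'b) monoid_scheme \<Rightarrow> 'a set \<Rightarrow> 'a \<Rightarrow> 'a set ell2 \<Rightarrow>\<^sub>L 'a set ell2" where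
  "quasi_reg G X g = perm_op (lcosets\<^bsub>G\<^esub> X) (\<lambda>C. g <#\<^bsub>G\<^esub> C)"

text \<open>The group algebra is identified with its image under the left regular representation.\<close>
definition group_alg :: "('a, 'b) monoid_scheme \<Rightarrow> ('a ell2 \<Rightarrow>\<^sub>L 'a ell2) set" where
  "group_alg G = {\<Sum>g\<in>F. scaleC_op (c g) o\<^sub>L left_reg G g | F c. finite F \<and> F \<subseteq> carrier G}"

definition Cr :: "('a, 'b) monoid_scheme \<Rightarrow> ('a ell2 \<Rightarrow>\<^sub>L 'a ell2) set" where
  "Cr G = closure (group_alg G)"

definition star_hom_on ::
    "('i ell2 \<Rightarrow>\<^sub>L 'i ell2) set \<Rightarrow> (('i ell2 \<Rightarrow>\<^sub>L 'i ell2) \<Rightarrow> ('j ell2 \<Rightarrow>\<^sub>L 'j ell2)) \<Rightarrow> bool" where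
  "star_hom_on A \<Phi> \<longleftrightarrow>
     (\<forall>a\<in>A. \<forall>b\<in>A. \<Phi> (a + b) = \<Phi> a + \<Phi> b) \<and>
     (\<forall>c. \<forall>a\<in>A. \<Phi> (scaleC_op c o\<^sub>L a) = scaleC_op c o\<^sub>L \<Phi> a) \<and>
     (\<forall>a\<in>A. \<forall>b\<in>A. \<Phi> (a o\<^sub>L b) = \<Phi> a o\<^sub>L \<Phi> b) \<and>
     (\<forall>a\<in>A. \<forall>b\<in>A. adjoint_pair a b \<longrightarrow> adjoint_pair (\<Phi> a) (\<Phi> b))"

text \<open>
  The extension of a unitary representation \<open>u\<close> of \<open>G\<close> to the reduced group C*-algebra: the unique
  continuous *-homomorphism sending \<open>\<lambda>(g)\<close> to \<open>u(g)\<close>. Its existence for quasi-regular \<open>u\<close> is guaranteed when \<open>G\<close> is amenable.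
\<close>
definition Cr_extension ::
    "('a, 'b) monoid_scheme \<Rightarrow> ('a \<Rightarrow> 'i ell2 \<Rightarrow>\<^sub>L 'i ell2) \<Rightarrow>
     ('a ell2 \<Rightarrow>\<^sub>L 'a ell2) \<Rightarrow> ('i ell2 \<Rightarrow>\<^sub>L 'i ell2)" where
  "Cr_extension G u = (THE \<Phi>. \<Phi> \<in> extensional (Cr G) \<and> star_hom_on (Cr G) \<Phi> \<and>
     continuous_on (Cr G) \<Phi> \<and> (\<forall>g\<in>carrier G. \<Phi> (left_reg G g) = u g))"

definition quasi_reg_Cr ::
    "('a, 'b) monoid_scheme \<Rightarrow> 'a set \<Rightarrow> ('a ell2 \<Rightarrow>\<^sub>L 'a ell2) \<Rightarrow> ('a set ell2 \<Rightarrow>\<^sub>L 'a set ell2)" where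
  "quasi_reg_Cr G X = Cr_extension G (quasi_reg G X)"

definition quot_Cr ::
    "('a, 'b) monoid_scheme \<Rightarrow> 'a set \<Rightarrow> ('a ell2 \<Rightarrow>\<^sub>L 'a ell2) \<Rightarrow> ('a set ell2 \<Rightarrow>\<^sub>L 'a set ell2)" where
  "quot_Cr G N = Cr_extension G (\<lambda>g. left_reg (G Mod N) (quot_map G N g))"

text \<open>For empty \<open>\<X>\<close> the intersection is taken inside the C*-algebra, so it is the whole algebra.\<close>
definition J_ideal :: "('a, 'b) monoid_scheme \<Rightarrow> 'a set set \<Rightarrow> ('a ell2 \<Rightarrow>\<^sub>L 'a ell2) set" where
  "J_ideal G \<X> = {a \<in> Cr G. \<forall>X\<in>\<X>. quasi_reg_Cr G X a = 0}"

definition density_sets :: "('a, 'b) monoid_scheme \<Rightarrow> 'a set set set" where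
  "density_sets G = {\<X>. closedin (chabauty G) \<X> \<and> conj_invariant G \<X> \<and>
     J_ideal G \<X> \<subseteq> closure (J_ideal G \<X> \<inter> group_alg G)}"

definition density_property :: "('a, 'b) monoid_scheme \<Rightarrow> bool" where
  "density_property G \<longleftrightarrow>
     (\<forall>\<X>. closedin (chabauty G) \<X> \<and> conj_invariant G \<X> \<longrightarrow> \<X> \<in> density_sets G)"

end

theory Submission
  imports Defs
begin

text \<open>
  Everything rests on one estimate. An amenable group has finitely supported unit vectors \<open>f\<close> that
  are almost invariant; compressing \<open>\<lambda>(c) \<otimes> 1\<close> by \<open>\<xi> \<mapsto> \<Sum>\<^sub>h f(h) \<delta>\<^sub>h \<otimes> V\<^sub>h\<^sup>* \<xi>\<close> does not
  increase the norm and multiplies the coefficient \<open>c(g)\<close> by a number close to \<open>1\<close>.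
  For a representation \<open>V\<close> of the group this yields the weak containment of \<open>V\<close> in \<open>\<lambda>\<close>, hence the
  extensions to the reduced C*-algebra. For \<open>V\<^sub>h = \<lambda>(s(h))\<close>, where \<open>s\<close> is a section of the quotient
  map \<open>q : \<Gamma> \<rightarrow> \<Gamma>/N\<close>, it lifts every \<open>b \<in> \<complex>[\<Gamma>/N]\<close> to some \<open>a \<in> \<complex>[\<Gamma>]\<close> with \<open>Q(a) = b\<close> and
  \<open>\<parallel>a\<parallel> \<le> \<parallel>b\<parallel> + \<epsilon>\<close>. Such lifts make \<open>Q\<close> surjective and carry density of the group algebra part of an
  ideal from one side of \<open>Q\<close> to the other. The formula for the ideals holds because the
  quasi-regular representation on the cosets of \<open>q\<^sup>-\<^sup>1(Y)\<close> is unitarily equivalent to the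
  composition of \<open>Q\<close> with the quasi-regular representation of \<open>\<Gamma>/N\<close> on the cosets of \<open>Y\<close>.
\<close>

section \<open>The Hilbert space and its operators\<close>

text \<open>Two obstacles shape the development. First, \<open>Cr_extension\<close> is a definite
  description, so neither Q nor the kernel of a quasi-regular representation can be handled before
  existence and uniqueness are proved. Second, amenability is given as an invariant mean, whereas
  the estimate needs vectors. The bridge is spectral: a symmetric Markov operator has norm at least
  1, and a unit vector that nearly attains this norm is nearly fixed by each generator. The lifts
  have to stay in \<complex>[\<Gamma>]. A lift with the right quotient norm that is known to lie
  only in the C*-algebra could not be subtracted from an element of \<complex>[\<Gamma>] without
  leaving \<complex>[\<Gamma>], and such a subtraction is what moves an approximant into the ideal.
  Finite support of f makes the compression a finite combination, and its defect a finite l1 sum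
  that can be bounded and lifted term by term.\<close>

lemma ell2_eqI: "(\<And>i. ell2_apply x i = ell2_apply y i) \<Longrightarrow> x = y"
  by (metis ell2_apply_inject ext)

lemma ell2_sq_summable: "(\<lambda>i. (cmod (ell2_apply x i))\<^sup>2) summable_on A"
  using ell2_apply[of x] by (auto intro: summable_on_subset_banach)

lemma norm_ell2_sq: "(norm x)\<^sup>2 = (\<Sum>\<^sub>\<infinity>i. (cmod (ell2_apply x i))\<^sup>2)"
  by (simp add: norm_ell2_eq infsum_nonneg)

lemma has_sum_cinner: "((\<lambda>i. ell2_apply x i * cnj (ell2_apply y i)) has_sum cinner x y) UNIV"
  unfolding cinner.rep_eq by (intro has_sum_infsum prod_summable ell2_sq_summable)

lemma cinner_commute: "cinner y x = cnj (cinner x y)"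
  unfolding cinner.rep_eq by (simp flip: infsum_cnj add: mult.commute)

lemma cinner_add_left: "cinner (x + y) z = cinner x z + cinner y z"
  unfolding cinner.rep_eq plus_ell2.rep_eq
  by (simp add: infsum_add prod_summable distrib_right ell2_sq_summable)

lemma cinner_scaleC_left: "cinner (scaleC_ell2 c x) y = c * cinner x y"
  unfolding cinner.rep_eq scaleC_ell2.rep_eq by (simp add: infsum_cmult_right' mult.assoc)

lemma cinner_zero_left [simp]: "cinner 0 y = 0"
  unfolding cinner.rep_eq zero_ell2.rep_eq by simp

lemma cinner_zero_right [simp]: "cinner y 0 = 0"
  by (subst cinner_commute) simp

lemma cinner_add_right: "cinner x (y + z) = cinner x y + cinner x z"
  by (metis cinner_add_left cinner_commute complex_cnj_add)

lemma cinner_scaleC_right: "cinner x (scaleC_ell2 c y) = cnj c * cinner x y"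
  by (metis cinner_scaleC_left cinner_commute complex_cnj_mult)

lemma cinner_sum_left: "cinner (sum f A) y = (\<Sum>a\<in>A. cinner (f a) y)"
  by (induction A rule: infinite_finite_induct) (auto simp: cinner_add_left)

lemma cinner_sum_right: "cinner y (sum f A) = (\<Sum>a\<in>A. cinner y (f a))"
  by (induction A rule: infinite_finite_induct) (auto simp: cinner_add_right)

lemma scaleC_ell2_uminus: "- x = scaleC_ell2 (-1) x"
  by (rule ell2_eqI) (simp add: uminus_ell2.rep_eq scaleC_ell2.rep_eq)

lemma cinner_diff_left: "cinner (x - y) z = cinner x z - cinner y z"
  by (metis cinner_add_left add_diff_cancel diff_add_cancel)

lemma cinner_diff_right: "cinner z (x - y) = cinner z x - cinner z y"
  by (metis cinner_add_right add_diff_cancel diff_add_cancel)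

lemma cinner_self: "cinner x x = complex_of_real ((norm x)\<^sup>2)"
proof (rule complex_eqI)
  show "Re (cinner x x) = Re (complex_of_real ((norm x)\<^sup>2))"
    by (simp add: power2_norm_eq_inner inner_ell2_def)
  have "Im (cinner x x) = Im (cnj (cinner x x))" by (metis cinner_commute)
  then show "Im (cinner x x) = Im (complex_of_real ((norm x)\<^sup>2))" by simp
qed

lemma norm_scaleC_ell2: "norm (scaleC_ell2 c x) = cmod c * norm x"
  unfolding norm_ell2_eq scaleC_ell2.rep_eq
  by (simp add: norm_mult power_mult_distrib infsum_cmult_right' real_sqrt_mult)

text \<open>The inherited Cauchy-Schwarz inequality concerns \<open>inner\<close>, the real part of
  \<open>cinner\<close>; multiplying x by the conjugate phase of \<open>cinner x y\<close> turns the
  modulus into such a real part.\<close>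

lemma cmod_cinner_le: "cmod (cinner x y) \<le> norm x * norm y"
proof (cases "cinner x y = 0")
  case False
  define c where "c = cnj (sgn (cinner x y))"
  have c: "cmod c = 1" using False by (simp add: c_def norm_sgn)
  have "c * cinner x y = cmod (cinner x y)"
    using False by (simp add: c_def sgn_div_norm scaleR_conv_of_real complex_norm_square[symmetric]
        mult.commute[of "cnj _"] power2_eq_square field_simps)
  then have "cmod (cinner x y) = inner (scaleC_ell2 c x) y"
    by (simp add: inner_ell2_def cinner_scaleC_left)
  also have "\<dots> \<le> norm (scaleC_ell2 c x) * norm y" by (rule norm_cauchy_schwarz)
  finally show ?thesis by (simp add: norm_scaleC_ell2 c)
qed simp

lemma ell2_apply_delta: "ell2_apply (delta s) i = (if i = s then 1 else 0)"
proof -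
  have "(\<lambda>i. (cmod (if i = s then 1 else 0))\<^sup>2) summable_on {s}" by simp
  then have "(\<lambda>i. (cmod (if i = s then 1 else 0))\<^sup>2) summable_on UNIV"
    by (rule summable_on_cong_neutral[THEN iffD1, rotated -1]) auto
  then show ?thesis by (simp add: delta_def Abs_ell2_inverse)
qed

lemma ell2_apply_sum: "ell2_apply (sum f A) i = (\<Sum>a\<in>A. ell2_apply (f a) i)"
  by (induction A rule: infinite_finite_induct) (auto simp: zero_ell2.rep_eq plus_ell2.rep_eq)

lemma cinner_delta: "cinner x (delta i) = ell2_apply x i"
proof -
  have "cinner x (delta i) = (\<Sum>\<^sub>\<infinity>j\<in>{i}. ell2_apply x j)"
    unfolding cinner.rep_eq by (rule infsum_cong_neutral) (auto simp: ell2_apply_delta)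
  then show ?thesis by simp
qed

lemma norm_delta [simp]: "norm (delta i) = 1"
proof -
  have "complex_of_real ((norm (delta i))\<^sup>2) = 1"
    by (metis cinner_delta cinner_self ell2_apply_delta)
  then show ?thesis
    by (metis norm_ge_zero of_real_eq_1_iff power2_eq_1_iff not_one_le_zero neg_0_le_iff_le le_minus_one_simps(3))
qed

lemma cmod_ell2_apply_le: "cmod (ell2_apply x i) \<le> norm x"
  using cmod_cinner_le[of x "delta i"] by (simp add: cinner_delta)

lemma sum_sq_ell2_le: "finite F \<Longrightarrow> (\<Sum>i\<in>F. (cmod (ell2_apply x i))\<^sup>2) \<le> (norm x)\<^sup>2"
  unfolding norm_ell2_sq by (rule finite_sum_le_infsum) (auto simp: ell2_sq_summable)

lemma Abs_ell2_bounded: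
  assumes "\<And>F. finite F \<Longrightarrow> (\<Sum>i\<in>F. (cmod (f i))\<^sup>2) \<le> B\<^sup>2" "0 \<le> B"
  shows "ell2_apply (Abs_ell2 f) = f" "norm (Abs_ell2 f) \<le> B"
proof -
  have sm: "(\<lambda>i. (cmod (f i))\<^sup>2) summable_on UNIV"
    by (rule nonneg_bdd_above_summable_on) (use assms in \<open>auto simp: bdd_above_def\<close>)
  then show *: "ell2_apply (Abs_ell2 f) = f" by (simp add: Abs_ell2_inverse)
  have "(norm (Abs_ell2 f))\<^sup>2 \<le> B\<^sup>2"
    unfolding norm_ell2_sq * by (rule infsum_le_finite_sums) (use sm assms in auto)
  then show "norm (Abs_ell2 f) \<le> B" using assms(2) by (rule power2_le_imp_le)
qed

text \<open>Completeness passes to the operator spaces, where extension by uniform continuity and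
  the convergent series in \<open>Q_surj\<close> rely on it.\<close>

instance ell2 :: (type) banach
proof
  fix X :: "nat \<Rightarrow> 'a ell2" assume X: "Cauchy X"
  have "Cauchy (\<lambda>n. ell2_apply (X n) i)" for i
  proof (rule metric_CauchyI)
    fix e :: real assume "0 < e"
    then obtain M where M: "\<And>m n. m \<ge> M \<Longrightarrow> n \<ge> M \<Longrightarrow> dist (X m) (X n) < e"
      using X by (meson metric_CauchyD)
    have "dist (ell2_apply (X m) i) (ell2_apply (X n) i) \<le> dist (X m) (X n)" for m n
      using cmod_ell2_apply_le[of "X m - X n" i] by (simp add: dist_norm minus_ell2.rep_eq)
    then show "\<exists>M. \<forall>m\<ge>M. \<forall>n\<ge>M. dist (ell2_apply (X m) i) (ell2_apply (X n) i) < e"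
      using M by (meson le_less_trans)
  qed
  then have "\<exists>f. \<forall>i. (\<lambda>n. ell2_apply (X n) i) \<longlonglongrightarrow> f i"
    by (meson Cauchy_convergent convergent_def)
  then obtain f where f: "\<And>i. (\<lambda>n. ell2_apply (X n) i) \<longlonglongrightarrow> f i" by blast
  \<comment> \<open>Fixing m and a finite F while n tends to infinity turns the Cauchy condition
    into a bound on the pointwise limit that is uniform in F.\<close>
  have est: "(\<Sum>i\<in>F. (cmod (f i - ell2_apply (X m) i))\<^sup>2) \<le> e\<^sup>2"
    if M: "\<And>n. n \<ge> m \<Longrightarrow> dist (X n) (X m) \<le> e" and F: "finite F" for m e F
  proof -
    have lim: "(\<lambda>n. \<Sum>i\<in>F. (cmod (ell2_apply (X n) i - ell2_apply (X m) i))\<^sup>2)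
        \<longlonglongrightarrow> (\<Sum>i\<in>F. (cmod (f i - ell2_apply (X m) i))\<^sup>2)"
      by (intro tendsto_intros f)
    have "(\<Sum>i\<in>F. (cmod (ell2_apply (X n) i - ell2_apply (X m) i))\<^sup>2) \<le> e\<^sup>2" if "n \<ge> m" for n
    proof -
      have "(\<Sum>i\<in>F. (cmod (ell2_apply (X n - X m) i))\<^sup>2) \<le> (norm (X n - X m))\<^sup>2"
        by (rule sum_sq_ell2_le[OF F])
      also have "\<dots> \<le> e\<^sup>2" using M[OF that] by (simp add: dist_norm power_mono)
      finally show ?thesis by (simp add: minus_ell2.rep_eq)
    qed
    then show ?thesis
      using lim by (intro LIMSEQ_le_const2[OF lim]) blast
  qed
  obtain M0 where M0: "\<And>n. n \<ge> M0 \<Longrightarrow> dist (X n) (X M0) \<le> 1"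
    by (metis metric_CauchyD[OF X zero_less_one] less_imp_le order_refl)
  define d where "d m i = f i - ell2_apply (X m) i" for m i
  have d0: "ell2_apply (Abs_ell2 (d M0)) = d M0"
    by (rule Abs_ell2_bounded[of _ 1]) (use est[OF M0] in \<open>auto simp: d_def\<close>)
  \<comment> \<open>Square summability of f is not known in advance; the difference of f and
    \<open>X M0\<close> has it by \<open>est\<close>, and adding \<open>X M0\<close> back gives it
    for f.\<close>
  define x where "x = X M0 + Abs_ell2 (d M0)"
  have x: "ell2_apply x = f" by (auto simp: x_def plus_ell2.rep_eq d0 d_def)
  have "X \<longlonglongrightarrow> x"
  proof (rule metric_LIMSEQ_I)
    fix r :: real assume r: "0 < r"
    then obtain M where M: "\<And>m n. m \<ge> M \<Longrightarrow> n \<ge> M \<Longrightarrow> dist (X n) (X m) \<le> r/2"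
      by (metis metric_CauchyD[OF X half_gt_zero] less_imp_le)
    have "dist (X m) x < r" if "m \<ge> M" for m
    proof -
      have e: "(\<Sum>i\<in>F. (cmod (d m i))\<^sup>2) \<le> (r/2)\<^sup>2" if "finite F" for F
        unfolding d_def by (rule est) (use M \<open>m \<ge> M\<close> that in auto)
      have "norm (Abs_ell2 (d m)) \<le> r/2" "ell2_apply (Abs_ell2 (d m)) = d m"
        using Abs_ell2_bounded[of "d m" "r/2"] e r by auto
      moreover have "x - X m = Abs_ell2 (d m)"
        by (rule ell2_eqI) (simp add: minus_ell2.rep_eq x calculation d_def)
      ultimately show ?thesis using r by (simp add: dist_norm norm_minus_commute)
    qed
    then show "\<exists>M. \<forall>m\<ge>M. dist (X m) x < r" by blast
  qed
  then show "convergent X" by (auto simp: convergent_def)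
qed

section \<open>Finitely supported vectors\<close>

lemma ell2_apply_fin:
  assumes "finite F"
  shows "ell2_apply (\<Sum>i\<in>F. scaleC_ell2 (f i) (delta i)) j = (if j \<in> F then f j else 0)"
  using assms by (simp add: ell2_apply_sum scaleC_ell2.rep_eq ell2_apply_delta if_distrib cong: if_cong)

lemma norm_ell2_fin:
  assumes "finite F" "inj_on s F"
  shows "(norm (\<Sum>i\<in>F. scaleC_ell2 (f i) (delta (s i))))\<^sup>2 = (\<Sum>i\<in>F. (cmod (f i))\<^sup>2)"
proof -
  have "complex_of_real ((norm (\<Sum>i\<in>F. scaleC_ell2 (f i) (delta (s i))))\<^sup>2)
      = (\<Sum>i\<in>F. \<Sum>j\<in>F. cnj (f i) * (f j * (if s i = s j then 1 else 0)))"
    unfolding cinner_self[symmetric]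
    by (simp add: cinner_sum_left cinner_sum_right cinner_scaleC_left cinner_scaleC_right
        cinner_delta ell2_apply_delta ell2_apply_sum scaleC_ell2.rep_eq sum_distrib_left)
  also have "\<dots> = (\<Sum>i\<in>F. \<Sum>j\<in>F. if i = j then cnj (f i) * f j else 0)"
    using assms(2) by (intro sum.cong refl) (auto simp: inj_on_def)
  also have "\<dots> = complex_of_real (\<Sum>i\<in>F. (cmod (f i))\<^sup>2)"
    using assms(1) by (simp add: complex_norm_square mult.commute del: of_real_power)
  finally show ?thesis using of_real_eq_iff by blast
qed

lemma ell2_approx_finite:
  fixes x :: "'i ell2"
  assumes "0 < e"
  obtains F where "finite F" "norm (x - (\<Sum>i\<in>F. scaleC_ell2 (ell2_apply x i) (delta i))) < e"
proof -
  let ?s = "\<lambda>i. (cmod (ell2_apply x i))\<^sup>2"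
  have "(?s has_sum (norm x)\<^sup>2) UNIV"
    unfolding norm_ell2_sq by (intro has_sum_infsum ell2_sq_summable)
  then obtain F where F: "finite F" "dist (sum ?s F) ((norm x)\<^sup>2) < e\<^sup>2"
    using tendstoD[of "sum ?s" _ "finite_subsets_at_top UNIV" "e\<^sup>2"] assms
    unfolding has_sum_def eventually_finite_subsets_at_top by (metis subset_UNIV order_refl zero_less_power)
  let ?y = "\<Sum>i\<in>F. scaleC_ell2 (ell2_apply x i) (delta i)"
  have "(norm (x - ?y))\<^sup>2 = (\<Sum>\<^sub>\<infinity>i\<in>UNIV - F. ?s i)"
    unfolding norm_ell2_sq
    by (rule infsum_cong_neutral) (auto simp: minus_ell2.rep_eq ell2_apply_fin[OF F(1)])
  also have "\<dots> = (norm x)\<^sup>2 - sum ?s F"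
    unfolding norm_ell2_sq using F(1)
    by (subst infsum_Diff) (auto simp: ell2_sq_summable)
  finally have "(norm (x - ?y))\<^sup>2 < e\<^sup>2" using F(2) by (simp add: dist_real_def)
  then have "norm (x - ?y) < e" using assms by (simp add: power2_less_imp_less)
  with F(1) show ?thesis by (rule that)
qed

lemma scaleC_op_apply [simp]: "blinfun_apply (scaleC_op c) x = scaleC_ell2 c x"
  by (simp add: scaleC_op.rep_eq)

lemma norm_scaleC_op_le: "norm (scaleC_op c) \<le> cmod c"
  by (rule norm_blinfun_bound) (simp_all add: norm_scaleC_ell2)

lemma scaleC_ell2_sum: "scaleC_ell2 c (sum f A) = (\<Sum>a\<in>A. scaleC_ell2 c (f a))"
  by (rule ell2_eqI) (simp add: ell2_apply_sum scaleC_ell2.rep_eq sum_distrib_left)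

lemma scaleC_scaleC_ell2 [simp]: "scaleC_ell2 c (scaleC_ell2 d x) = scaleC_ell2 (c * d) x"
  by (rule ell2_eqI) (simp add: scaleC_ell2.rep_eq)

lemma scaleC_one_ell2 [simp]: "scaleC_ell2 1 x = x"
  by (rule ell2_eqI) (simp add: scaleC_ell2.rep_eq)

lemma scaleC_zero_ell2 [simp]: "scaleC_ell2 0 x = 0"
  by (rule ell2_eqI) (simp add: scaleC_ell2.rep_eq zero_ell2.rep_eq)

lemma scaleC_ell2_zero_right [simp]: "scaleC_ell2 c 0 = 0"
  by (rule ell2_eqI) (simp add: scaleC_ell2.rep_eq zero_ell2.rep_eq)

lemma norm_ell2_cinner_bound:
  fixes T :: "'i ell2 \<Rightarrow>\<^sub>L 'j ell2"
  assumes "\<And>x y. norm x = 1 \<Longrightarrow> norm y = 1 \<Longrightarrow> cmod (cinner (blinfun_apply T x) y) \<le> M" "0 \<le> M"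
  shows "norm T \<le> M"
proof (rule norm_blinfun_bound[OF assms(2)])
  fix x
  show "norm (blinfun_apply T x) \<le> M * norm x"
  proof (cases "x = 0 \<or> blinfun_apply T x = 0")
    case False
    let ?y = "blinfun_apply T x"
    let ?x1 = "(1 / norm x) *\<^sub>R x" and ?y1 = "scaleC_ell2 (1 / norm ?y) ?y"
    have "cinner (blinfun_apply T ?x1) ?y1 = (1 / norm x) * (1 / norm ?y) * cinner ?y ?y"
    proof -
      have "(1 / norm x) *\<^sub>R ?y = scaleC_ell2 (1 / norm x) ?y"
        by (rule ell2_eqI) (simp add: scaleR_ell2.rep_eq scaleC_ell2.rep_eq)
      then show ?thesis
        by (simp add: blinfun.scaleR_right cinner_scaleC_left cinner_scaleC_right)
    qed
    also have "\<dots> = complex_of_real (norm ?y / norm x)"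
      using False by (simp add: cinner_self power2_eq_square field_simps)
    finally have "norm ?y / norm x \<le> M"
      using assms(1)[of ?x1 ?y1] False by (auto simp: norm_scaleC_ell2 norm_divide)
    then show ?thesis using False by (simp add: field_simps)
  qed (use assms(2) in auto)
qed

section \<open>Amplification of an operator by a second tensor factor\<close>

lemma has_sum_sum:
  fixes f :: "'a \<Rightarrow> 'b \<Rightarrow> 'c::topological_comm_monoid_add"
  assumes "\<And>i. i \<in> I \<Longrightarrow> (f i has_sum s i) A"
  shows "((\<lambda>x. \<Sum>i\<in>I. f i x) has_sum (\<Sum>i\<in>I. s i)) A"
  using assms by (induction I rule: infinite_finite_induct) (auto intro!: has_sum_add)

text \<open>Slicing along the standard basis of the second tensor factor reduces the bound for
  \<open>A \<otimes> 1\<close> to the one for \<open>A\<close>. The inequality between the arithmetic and the geometric mean replaces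
  the Cauchy--Schwarz inequality, since the vectors will be normalised.\<close>

lemma amplification_bound:
  fixes A :: "'i ell2 \<Rightarrow>\<^sub>L 'i ell2" and x y :: "'h \<Rightarrow> 'j ell2"
  assumes H: "finite H" "inj_on s H"
    and A: "\<And>c z. blinfun_apply A (scaleC_ell2 c z) = scaleC_ell2 c (blinfun_apply A z)"
  shows "cmod (\<Sum>h\<in>H. \<Sum>k\<in>H. ell2_apply (blinfun_apply A (delta (s h))) (s k) * cinner (x h) (y k))
    \<le> norm A * ((\<Sum>h\<in>H. (norm (x h))\<^sup>2) + (\<Sum>h\<in>H. (norm (y h))\<^sup>2)) / 2"
proof -
  define slice :: "('h \<Rightarrow> 'j ell2) \<Rightarrow> 'j \<Rightarrow> 'i ell2"
    where "slice z i = (\<Sum>h\<in>H. scaleC_ell2 (ell2_apply (z h) i) (delta (s h)))" for z i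
  have slice: "(norm (slice z i))\<^sup>2 = (\<Sum>h\<in>H. (cmod (ell2_apply (z h) i))\<^sup>2)" for z i
    unfolding slice_def by (rule norm_ell2_fin[OF H])
  let ?b = "\<lambda>i. norm A * ((\<Sum>h\<in>H. (cmod (ell2_apply (x h) i))\<^sup>2) + (\<Sum>h\<in>H. (cmod (ell2_apply (y h) i))\<^sup>2)) / 2"
  have eq: "cinner (blinfun_apply A (slice x i)) (slice y i) =
      (\<Sum>h\<in>H. \<Sum>k\<in>H. ell2_apply (blinfun_apply A (delta (s h))) (s k)
          * (ell2_apply (x h) i * cnj (ell2_apply (y k) i)))" for i
    unfolding slice_def
    by (simp add: blinfun.sum_right A cinner_sum_left cinner_sum_right cinner_scaleC_left
        cinner_scaleC_right cinner_delta ell2_apply_sum scaleC_ell2.rep_eq sum_distrib_left mult_ac)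
      (rule sum.swap)
  have bound: "cmod (cinner (blinfun_apply A (slice x i)) (slice y i)) \<le> ?b i" for i
  proof -
    let ?a = "norm (slice x i)" and ?c = "norm (slice y i)"
    have "cmod (cinner (blinfun_apply A (slice x i)) (slice y i)) \<le> norm A * ?a * ?c"
      by (rule order_trans[OF cmod_cinner_le]) (simp add: mult_right_mono norm_blinfun)
    also have "\<dots> = norm A * (?a * ?c)" by simp
    also have "\<dots> \<le> norm A * ((?a\<^sup>2 + ?c\<^sup>2) / 2)"
      using zero_le_power2[of "?a - ?c"] by (intro mult_left_mono) (auto simp: power2_diff)
    finally show ?thesis by (simp add: slice)
  qed
  \<comment> \<open>Summed over the basis index i, the slice forms reassemble the inner products
    \<open>cinner (x h) (y k)\<close>, and the bounds \<open>?b i\<close> reassemble the squared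
    norms.\<close>
  have "((\<lambda>i. cinner (blinfun_apply A (slice x i)) (slice y i)) has_sum
    (\<Sum>h\<in>H. \<Sum>k\<in>H. ell2_apply (blinfun_apply A (delta (s h))) (s k) * cinner (x h) (y k))) UNIV"
    unfolding eq by (intro has_sum_sum has_sum_cmult_right has_sum_cinner)
  moreover have "((\<lambda>i. (norm A / 2) *
      ((\<Sum>h\<in>H. (cmod (ell2_apply (x h) i))\<^sup>2) + (\<Sum>h\<in>H. (cmod (ell2_apply (y h) i))\<^sup>2))) has_sum
      (norm A / 2) * ((\<Sum>h\<in>H. (norm (x h))\<^sup>2) + (\<Sum>h\<in>H. (norm (y h))\<^sup>2))) UNIV"
    unfolding norm_ell2_sq
    by (intro has_sum_cmult_right has_sum_add; intro has_sum_sum; intro has_sum_infsum; rule ell2_sq_summable)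
  ultimately have "cmod (\<Sum>h\<in>H. \<Sum>k\<in>H. ell2_apply (blinfun_apply A (delta (s h))) (s k) * cinner (x h) (y k))
    \<le> (norm A / 2) * ((\<Sum>h\<in>H. (norm (x h))\<^sup>2) + (\<Sum>h\<in>H. (norm (y h))\<^sup>2))"
    by (rule norm_infsum_le) (use bound in simp)
  then show ?thesis by simp
qed

section \<open>Unitary and permutation representations\<close>

text \<open>The type of bounded linear maps is only real linear; complex linearity is extracted from
  the existence of an adjoint for the complex inner product.\<close>

lemma adjoint_pair_scaleC:
  assumes "adjoint_pair T T'"
  shows "blinfun_apply T (scaleC_ell2 c x) = scaleC_ell2 c (blinfun_apply T x)"
proof (rule ell2_eqI)
  fix i
  have "cinner (blinfun_apply T (scaleC_ell2 c x)) (delta i) = c * cinner (blinfun_apply T x) (delta i)"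
    using assms by (simp add: adjoint_pair_def cinner_scaleC_left)
  then show "ell2_apply (blinfun_apply T (scaleC_ell2 c x)) i = ell2_apply (scaleC_ell2 c (blinfun_apply T x)) i"
    by (simp add: cinner_delta scaleC_ell2.rep_eq)
qed

text \<open>In the corner convention of \<open>perm_op\<close> the unit acts as the projection onto
  the functions supported on S and not as the identity of the whole space. Contractions with
  matching adjoints therefore take the place of unitaries.\<close>

definition star_rep :: "('a, 'b) monoid_scheme \<Rightarrow> ('a \<Rightarrow> 'i ell2 \<Rightarrow>\<^sub>L 'i ell2) \<Rightarrow> bool" where
  "star_rep G u \<longleftrightarrow> (\<forall>g\<in>carrier G. norm (u g) \<le> 1 \<and> adjoint_pair (u g) (u (inv\<^bsub>G\<^esub> g))) \<and>
     (\<forall>g\<in>carrier G. \<forall>h\<in>carrier G. u (g \<otimes>\<^bsub>G\<^esub> h) = u g o\<^sub>L u h)"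

definition set_action :: "('a, 'b) monoid_scheme \<Rightarrow> 'i set \<Rightarrow> ('a \<Rightarrow> 'i \<Rightarrow> 'i) \<Rightarrow> bool" where
  "set_action G S \<sigma> \<longleftrightarrow> (\<forall>g\<in>carrier G. \<sigma> g ` S \<subseteq> S) \<and> (\<forall>i\<in>S. \<sigma> \<one>\<^bsub>G\<^esub> i = i) \<and>
     (\<forall>g\<in>carrier G. \<forall>h\<in>carrier G. \<forall>i\<in>S. \<sigma> (g \<otimes>\<^bsub>G\<^esub> h) i = \<sigma> g (\<sigma> h i))"

lemma set_action_inverse:
  assumes "group G" "set_action G S \<sigma>" "g \<in> carrier G" "i \<in> S"
  shows "\<sigma> g i \<in> S" "\<sigma> g (\<sigma> (inv\<^bsub>G\<^esub> g) i) = i" "\<sigma> (inv\<^bsub>G\<^esub> g) (\<sigma> g i) = i"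
proof -
  interpret group G by fact
  show "\<sigma> g i \<in> S" using assms by (auto simp: set_action_def)
  have "\<sigma> (g \<otimes>\<^bsub>G\<^esub> inv\<^bsub>G\<^esub> g) i = \<sigma> g (\<sigma> (inv\<^bsub>G\<^esub> g) i)"
    "\<sigma> (inv\<^bsub>G\<^esub> g \<otimes>\<^bsub>G\<^esub> g) i = \<sigma> (inv\<^bsub>G\<^esub> g) (\<sigma> g i)"
    using assms(2-4) inv_closed[OF assms(3)] unfolding set_action_def by blast+
  moreover have "\<sigma> \<one>\<^bsub>G\<^esub> i = i" using assms(2,4) by (simp add: set_action_def)
  ultimately show "\<sigma> g (\<sigma> (inv\<^bsub>G\<^esub> g) i) = i" "\<sigma> (inv\<^bsub>G\<^esub> g) (\<sigma> g i) = i"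
    using assms(3) by simp_all
qed

lemma set_action_bij:
  assumes "group G" "set_action G S \<sigma>" "g \<in> carrier G"
  shows "bij_betw (\<sigma> g) S S"
  using assms
  by (intro bij_betwI[where g = "\<sigma> (inv\<^bsub>G\<^esub> g)"])
    (auto simp: set_action_inverse group.inv_closed)

lemma perm_op_action_apply:
  assumes "group G" "set_action G S \<sigma>" "g \<in> carrier G"
  shows "ell2_apply (blinfun_apply (perm_op S (\<sigma> g)) x) i
    = (if i \<in> S then ell2_apply x (\<sigma> (inv\<^bsub>G\<^esub> g) i) else 0)"
proof -
  have "inv_into S (\<sigma> g) i = \<sigma> (inv\<^bsub>G\<^esub> g) i" if "i \<in> S"
    using assms that
    by (intro inv_into_f_eq) (auto simp: set_action_inverse group.inv_closed bij_betw_imp_inj_on[OF set_action_bij])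
  then show ?thesis using assms by (simp add: perm_op_apply set_action_bij)
qed

lemma perm_op_star_rep:
  assumes G: "group G" and \<sigma>: "set_action G S \<sigma>"
  shows "star_rep G (\<lambda>g. perm_op S (\<sigma> g))"
  unfolding star_rep_def
proof (intro conjI ballI)
  interpret group G by fact
  fix g assume g: "g \<in> carrier G"
  note app = perm_op_action_apply[OF G \<sigma>]
  note bij = set_action_bij[OF G \<sigma>]
  show "norm (perm_op S (\<sigma> g)) \<le> 1"
  proof (rule norm_blinfun_bound)
    fix x :: "'c ell2"
    have "(norm (blinfun_apply (perm_op S (\<sigma> g)) x))\<^sup>2 = (\<Sum>\<^sub>\<infinity>i\<in>S. (cmod (ell2_apply x (\<sigma> (inv\<^bsub>G\<^esub> g) i)))\<^sup>2)"
      unfolding norm_ell2_sq app[OF g] by (rule infsum_cong_neutral) auto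
    also have "\<dots> = (\<Sum>\<^sub>\<infinity>i\<in>S. (cmod (ell2_apply x i))\<^sup>2)"
      by (rule infsum_reindex_bij_betw[OF bij]) (simp add: g)
    also have "\<dots> \<le> (norm x)\<^sup>2"
      unfolding norm_ell2_sq by (rule infsum_mono_neutral) (auto simp: ell2_sq_summable)
    finally show "norm (blinfun_apply (perm_op S (\<sigma> g)) x) \<le> 1 * norm x"
      using power2_le_imp_le by fastforce
  qed simp
  show "adjoint_pair (perm_op S (\<sigma> g)) (perm_op S (\<sigma> (inv\<^bsub>G\<^esub> g)))"
    unfolding adjoint_pair_def
  proof (intro allI)
    fix x y :: "'c ell2"
    have "cinner (blinfun_apply (perm_op S (\<sigma> g)) x) y
        = (\<Sum>\<^sub>\<infinity>i\<in>S. ell2_apply x (\<sigma> (inv\<^bsub>G\<^esub> g) i) * cnj (ell2_apply y i))"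
      unfolding cinner.rep_eq app[OF g] by (rule infsum_cong_neutral) auto
    also have "\<dots> = (\<Sum>\<^sub>\<infinity>i\<in>S. ell2_apply x (\<sigma> (inv\<^bsub>G\<^esub> g) (\<sigma> g i)) * cnj (ell2_apply y (\<sigma> g i)))"
      by (rule infsum_reindex_bij_betw[OF bij[OF g], symmetric])
    also have "\<dots> = (\<Sum>\<^sub>\<infinity>i\<in>S. ell2_apply x i * cnj (ell2_apply y (\<sigma> g i)))"
      by (rule infsum_cong) (simp add: set_action_inverse[OF G \<sigma> g])
    also have "\<dots> = cinner x (blinfun_apply (perm_op S (\<sigma> (inv\<^bsub>G\<^esub> g))) y)"
      unfolding cinner.rep_eq using g by (intro infsum_cong_neutral) (auto simp: app)
    finally show "cinner (blinfun_apply (perm_op S (\<sigma> g)) x) y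
      = cinner x (blinfun_apply (perm_op S (\<sigma> (inv\<^bsub>G\<^esub> g))) y)" .
  qed
  fix h assume h: "h \<in> carrier G"
  show "perm_op S (\<sigma> (g \<otimes>\<^bsub>G\<^esub> h)) = perm_op S (\<sigma> g) o\<^sub>L perm_op S (\<sigma> h)"
  proof (intro blinfun_eqI ell2_eqI)
    fix x i
    have "\<sigma> (inv\<^bsub>G\<^esub> h \<otimes>\<^bsub>G\<^esub> inv\<^bsub>G\<^esub> g) i = \<sigma> (inv\<^bsub>G\<^esub> h) (\<sigma> (inv\<^bsub>G\<^esub> g) i)" if "i \<in> S"
      using \<sigma> g h that by (simp add: set_action_def)
    then show "ell2_apply (blinfun_apply (perm_op S (\<sigma> (g \<otimes>\<^bsub>G\<^esub> h))) x) i
      = ell2_apply (blinfun_apply (perm_op S (\<sigma> g) o\<^sub>L perm_op S (\<sigma> h)) x) i"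
      using g h by (simp add: app inv_mult_group set_action_inverse(1)[OF G \<sigma>])
  qed
qed

lemma set_action_left_mult: "group G \<Longrightarrow> set_action G (carrier G) (\<lambda>g h. g \<otimes>\<^bsub>G\<^esub> h)"
proof -
  assume "group G"
  then interpret group G .
  show ?thesis by (auto simp: set_action_def m_assoc)
qed

lemma left_reg_apply:
  assumes "group G" "g \<in> carrier G"
  shows "ell2_apply (blinfun_apply (left_reg G g) x) i
    = (if i \<in> carrier G then ell2_apply x (inv\<^bsub>G\<^esub> g \<otimes>\<^bsub>G\<^esub> i) else 0)"
  unfolding left_reg_def
  using perm_op_action_apply[OF assms(1) set_action_left_mult[OF assms(1)] assms(2)] .

lemma left_reg_delta:
  assumes "group G" "g \<in> carrier G"
  shows "blinfun_apply (left_reg G g) (delta h) = (if h \<in> carrier G then delta (g \<otimes>\<^bsub>G\<^esub> h) else 0)"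
  unfolding left_reg_def
  by (rule perm_op_delta) (rule set_action_bij[OF assms(1) set_action_left_mult[OF assms(1)] assms(2)])

lemma left_reg_star_rep: "group G \<Longrightarrow> star_rep G (left_reg G)"
  using perm_op_star_rep[OF _ set_action_left_mult, of G] by (simp add: left_reg_def[abs_def])

lemma set_action_lcosets:
  assumes "group G" "subgroup X G"
  shows "set_action G (lcosets\<^bsub>G\<^esub> X) (\<lambda>g C. g <#\<^bsub>G\<^esub> C)"
proof -
  interpret group G by fact
  have X: "X \<subseteq> carrier G" using assms(2) by (rule subgroup.subset)
  then have sub: "C \<subseteq> carrier G" if "C \<in> lcosets\<^bsub>G\<^esub> X" for C
    using that by (auto simp: LCOSETS_def l_coset_def)
  have "g <#\<^bsub>G\<^esub> C \<in> lcosets\<^bsub>G\<^esub> X" if "g \<in> carrier G" "C \<in> lcosets\<^bsub>G\<^esub> X" for g C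
    using that X by (auto simp: LCOSETS_def lcos_m_assoc)
  then show ?thesis
    using sub by (auto simp: set_action_def lcos_mult_one lcos_m_assoc)
qed

lemma quasi_reg_star_rep:
  assumes "group G" "subgroup X G"
  shows "star_rep G (quasi_reg G X)"
  using perm_op_star_rep[OF assms(1) set_action_lcosets[OF assms]] by (simp add: quasi_reg_def[abs_def])

lemma star_rep_hom:
  assumes "group_hom G K q" "star_rep K u"
  shows "star_rep G (\<lambda>g. u (q g))"
proof -
  interpret group_hom G K q by fact
  show ?thesis using assms(2) by (auto simp: star_rep_def)
qed

text \<open>Kept apart from \<open>group_alg\<close> so that one coefficient family can be evaluated
  on different operator families; in the lifting argument the index set even consists of
  pairs.\<close>

definition lin_comb :: "('a \<Rightarrow> 'i ell2 \<Rightarrow>\<^sub>L 'i ell2) \<Rightarrow> ('a \<Rightarrow> complex) \<Rightarrow> 'a set \<Rightarrow> 'i ell2 \<Rightarrow>\<^sub>L 'i ell2" where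
  "lin_comb u c F = (\<Sum>g\<in>F. scaleC_op (c g) o\<^sub>L u g)"

lemma lin_comb_apply: "blinfun_apply (lin_comb u c F) x = (\<Sum>g\<in>F. scaleC_ell2 (c g) (blinfun_apply (u g) x))"
  by (simp add: lin_comb_def blinfun.sum_left)

lemma norm_lin_comb_le:
  assumes "\<And>g. g \<in> F \<Longrightarrow> norm (u g) \<le> 1"
  shows "norm (lin_comb u c F) \<le> (\<Sum>g\<in>F. cmod (c g))"
  unfolding lin_comb_def
proof (rule order_trans[OF norm_sum sum_mono])
  fix g assume "g \<in> F"
  then have "norm (scaleC_op (c g) o\<^sub>L u g) \<le> cmod (c g) * 1"
    using assms by (intro order_trans[OF norm_blinfun_compose mult_mono] norm_scaleC_op_le) auto
  then show "norm (scaleC_op (c g) o\<^sub>L u g) \<le> cmod (c g)" by simp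
qed

lemma star_rep_scaleC:
  assumes "star_rep G u" "g \<in> carrier G"
  shows "blinfun_apply (u g) (scaleC_ell2 c x) = scaleC_ell2 c (blinfun_apply (u g) x)"
  using assms adjoint_pair_scaleC[of "u g" "u (inv\<^bsub>G\<^esub> g)"] by (auto simp: star_rep_def)

lemma lin_comb_scaleC:
  assumes "star_rep G u" "F \<subseteq> carrier G"
  shows "blinfun_apply (lin_comb u c F) (scaleC_ell2 d x) = scaleC_ell2 d (blinfun_apply (lin_comb u c F) x)"
  using assms by (simp add: lin_comb_apply scaleC_ell2_sum star_rep_scaleC subset_eq mult.commute)

text \<open>The matrix of a left convolution depends on k h^-1 only, which is what the entrywise
  multiplication below exploits. With h the unit it recovers the coefficients from the
  operator.\<close>

lemma lin_comb_left_reg_delta: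
  assumes "group G" "finite F" "F \<subseteq> carrier G" "h \<in> carrier G" "k \<in> carrier G"
  shows "ell2_apply (blinfun_apply (lin_comb (left_reg G) c F) (delta h)) k
    = (if k \<otimes>\<^bsub>G\<^esub> inv\<^bsub>G\<^esub> h \<in> F then c (k \<otimes>\<^bsub>G\<^esub> inv\<^bsub>G\<^esub> h) else 0)"
proof -
  interpret group G by fact
  have "(k = g \<otimes>\<^bsub>G\<^esub> h) = (g = k \<otimes>\<^bsub>G\<^esub> inv\<^bsub>G\<^esub> h)" if "g \<in> carrier G" for g
    using that assms(4,5) inv_solve_right'[of g k h] by auto
  then have "ell2_apply (blinfun_apply (lin_comb (left_reg G) c F) (delta h)) k
    = (\<Sum>g\<in>F. if g = k \<otimes>\<^bsub>G\<^esub> inv\<^bsub>G\<^esub> h then c g else 0)"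
    using assms(3,4) unfolding lin_comb_apply ell2_apply_sum
    by (intro sum.cong) (auto simp: scaleC_ell2.rep_eq left_reg_delta[OF assms(1)] ell2_apply_delta)
  then show ?thesis using assms(2) by simp
qed

text \<open>For \<open>V = W\<^sup>*\<close> this is the contractivity of compressing \<open>\<lambda>(c) \<otimes> 1\<close> by the map
  \<open>\<xi> \<mapsto> \<Sum>\<^sub>h f(h) \<delta>\<^sub>h \<otimes> W\<^sub>h \<xi>\<close>.\<close>

lemma schur_transfer_bound:
  fixes V W V' :: "'k \<Rightarrow> 'j ell2 \<Rightarrow>\<^sub>L 'j ell2"
  assumes K: "group K" and H: "finite H" "H \<subseteq> carrier K" and F: "finite F" "F \<subseteq> carrier K"
    and f: "(\<Sum>h\<in>H. (cmod (f h))\<^sup>2) = 1"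
    and V: "\<And>h. h \<in> H \<Longrightarrow> adjoint_pair (V h) (V' h)" "\<And>h. h \<in> H \<Longrightarrow> norm (V' h) \<le> 1"
      "\<And>h. h \<in> H \<Longrightarrow> norm (W h) \<le> 1"
  shows "norm (\<Sum>h\<in>H. \<Sum>k\<in>H. scaleC_op ((if k \<otimes>\<^bsub>K\<^esub> inv\<^bsub>K\<^esub> h \<in> F then c (k \<otimes>\<^bsub>K\<^esub> inv\<^bsub>K\<^esub> h) else 0) * (f h * cnj (f k))) o\<^sub>L (V k o\<^sub>L W h))
    \<le> norm (lin_comb (left_reg K) c F)" (is "norm ?B \<le> norm ?A")
proof (rule norm_ell2_cinner_bound)
  fix x y :: "'j ell2" assume xy: "norm x = 1" "norm y = 1"
  let ?x = "\<lambda>h. scaleC_ell2 (f h) (blinfun_apply (W h) x)"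
    and ?y = "\<lambda>h. scaleC_ell2 (f h) (blinfun_apply (V' h) y)"
  have "cinner (blinfun_apply ?B x) y =
    (\<Sum>h\<in>H. \<Sum>k\<in>H. ell2_apply (blinfun_apply ?A (delta h)) k * cinner (?x h) (?y k))"
    unfolding blinfun.sum_left cinner_sum_left
  proof (intro sum.cong refl)
    fix h k assume hk: "h \<in> H" "k \<in> H"
    have "cinner (blinfun_apply (V k) (blinfun_apply (W h) x)) y = cinner (blinfun_apply (W h) x) (blinfun_apply (V' k) y)"
      using V(1)[OF hk(2)] by (simp add: adjoint_pair_def)
    then show "cinner (blinfun_apply (scaleC_op ((if k \<otimes>\<^bsub>K\<^esub> inv\<^bsub>K\<^esub> h \<in> F then c (k \<otimes>\<^bsub>K\<^esub> inv\<^bsub>K\<^esub> h) else 0) * (f h * cnj (f k))) o\<^sub>L (V k o\<^sub>L W h)) x) y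
      = ell2_apply (blinfun_apply ?A (delta h)) k * cinner (?x h) (?y k)"
      using hk H(2) by (simp add: lin_comb_left_reg_delta[OF K F] subset_eq cinner_scaleC_left cinner_scaleC_right)
  qed
  also have "cmod \<dots> \<le> norm ?A * ((\<Sum>h\<in>H. (norm (?x h))\<^sup>2) + (\<Sum>h\<in>H. (norm (?y h))\<^sup>2)) / 2"
    by (rule amplification_bound[where s = "\<lambda>h. h"])
      (auto simp: H lin_comb_scaleC[OF left_reg_star_rep[OF K] F(2)])
  also have "\<dots> \<le> norm ?A * ((\<Sum>h\<in>H. (cmod (f h))\<^sup>2) + (\<Sum>h\<in>H. (cmod (f h))\<^sup>2)) / 2"
  proof (intro divide_right_mono mult_left_mono add_mono sum_mono)
    fix h assume h: "h \<in> H"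
    have "norm (blinfun_apply T z) \<le> 1" if "norm T \<le> 1" "norm z = 1" for T :: "'j ell2 \<Rightarrow>\<^sub>L 'j ell2" and z
      using norm_blinfun[of T z] that by simp
    then show "(norm (?x h))\<^sup>2 \<le> (cmod (f h))\<^sup>2" "(norm (?y h))\<^sup>2 \<le> (cmod (f h))\<^sup>2"
      using V(2,3)[OF h] xy by (auto simp: norm_scaleC_ell2 intro!: power_mono mult_left_le)
  qed auto
  finally show "cmod (cinner (blinfun_apply ?B x) y) \<le> norm ?A" by (simp add: f)
qed simp

section \<open>Amenability and almost invariant vectors\<close>

definition invariant_mean :: "('a, 'b) monoid_scheme \<Rightarrow> (('a \<Rightarrow> real) \<Rightarrow> real) \<Rightarrow> bool" where
  "invariant_mean G m \<longleftrightarrow>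
     (\<forall>f h. bounded (f ` carrier G) \<longrightarrow> bounded (h ` carrier G) \<longrightarrow>
        m (\<lambda>x. f x + h x) = m f + m h) \<and>
     (\<forall>r f. bounded (f ` carrier G) \<longrightarrow> m (\<lambda>x. r * f x) = r * m f) \<and>
     (\<forall>f. bounded (f ` carrier G) \<longrightarrow> (\<forall>x\<in>carrier G. 0 \<le> f x) \<longrightarrow> 0 \<le> m f) \<and>
     m (\<lambda>_. 1) = 1 \<and>
     (\<forall>g\<in>carrier G. \<forall>f. bounded (f ` carrier G) \<longrightarrow> m (\<lambda>x. f (g \<otimes>\<^bsub>G\<^esub> x)) = m f)"

lemma amenable_iff_invariant_mean: "amenable G \<longleftrightarrow> (\<exists>m. invariant_mean G m)"
  unfolding amenable_def invariant_mean_def ..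

lemma invariant_meanD:
  assumes "invariant_mean G m"
  shows "\<And>f h. bounded (f ` carrier G) \<Longrightarrow> bounded (h ` carrier G) \<Longrightarrow> m (\<lambda>x. f x + h x) = m f + m h"
    and "\<And>r f. bounded (f ` carrier G) \<Longrightarrow> m (\<lambda>x. r * f x) = r * m f"
    and "\<And>f. bounded (f ` carrier G) \<Longrightarrow> (\<And>x. x \<in> carrier G \<Longrightarrow> 0 \<le> f x) \<Longrightarrow> 0 \<le> m f"
    and "m (\<lambda>_. 1) = 1"
    and "\<And>g f. g \<in> carrier G \<Longrightarrow> bounded (f ` carrier G) \<Longrightarrow> m (\<lambda>x. f (g \<otimes>\<^bsub>G\<^esub> x)) = m f"
  using assms unfolding invariant_mean_def by auto

lemma invariant_mean_mono:
  assumes m: "invariant_mean G m" and bd: "bounded (f ` carrier G)" "bounded (h ` carrier G)"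
    and le: "\<And>x. x \<in> carrier G \<Longrightarrow> f x \<le> h x"
  shows "m f \<le> m h"
proof -
  have bd': "bounded ((\<lambda>x. (-1) * f x) ` carrier G)"
    using bd(1) by (simp add: bounded_iff)
  have "0 \<le> m (\<lambda>x. h x + (-1) * f x)"
    using le by (intro invariant_meanD(3)[OF m] bounded_plus_comp bd bd') auto
  also have "\<dots> = m h + (-1) * m f"
    by (simp only: invariant_meanD(1)[OF m bd(2) bd'] invariant_meanD(2)[OF m bd(1)])
  finally show ?thesis by simp
qed

text \<open>The push-forward of an invariant mean along q is invariant because every translation of
  K lifts to a translation of G.\<close>

lemma amenable_surj_hom:
  assumes hom: "group_hom G K q" and surj: "q ` carrier G = carrier K" and "amenable G"
  shows "amenable K"
proof -
  interpret group_hom G K q by (rule hom)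
  obtain m where m: "invariant_mean G m"
    using \<open>amenable G\<close> amenable_iff_invariant_mean by blast
  note add = invariant_meanD(1)[OF m] and scale = invariant_meanD(2)[OF m] and one = invariant_meanD(4)[OF m]
    and inv = invariant_meanD(5)[OF m] and mono = invariant_mean_mono[OF m]
  have bd: "bounded ((\<lambda>x. f (q x)) ` carrier G)" if "bounded (f ` carrier K)" for f :: "_ \<Rightarrow> real"
    using that surj by (metis image_image)
  have zero: "m (\<lambda>_. 0) = 0" using scale[of "\<lambda>_. 0" 0] by (simp add: image_constant_conv)
  show ?thesis
    unfolding amenable_def
  proof (intro exI[of _ "\<lambda>f. m (\<lambda>x. f (q x))"] conjI allI impI ballI)
    fix f :: "_ \<Rightarrow> real" assume f: "bounded (f ` carrier K)"
    show "m (\<lambda>x. r * f (q x)) = r * m (\<lambda>x. f (q x))" for r by (rule scale[OF bd[OF f]])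
    show "m (\<lambda>x. f (q x) + h (q x)) = m (\<lambda>x. f (q x)) + m (\<lambda>x. h (q x))"
      if "bounded (h ` carrier K)" for h
      by (rule add[OF bd[OF f] bd[OF that]])
    show "0 \<le> m (\<lambda>x. f (q x))" if "\<forall>x\<in>carrier K. 0 \<le> f x"
      using mono[of "\<lambda>_. 0" "\<lambda>x. f (q x)"] bd[OF f] that zero by (auto simp: bounded_iff)
    fix k assume "k \<in> carrier K"
    then obtain g where g: "g \<in> carrier G" "k = q g" using surj by blast
    have bd': "bounded ((\<lambda>x. f (k \<otimes>\<^bsub>K\<^esub> q x)) ` carrier G)"
      using bd[OF f] g by (force simp: bounded_iff simp flip: hom_mult)
    have bd'': "bounded ((\<lambda>x. f (q (g \<otimes>\<^bsub>G\<^esub> x))) ` carrier G)"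
      using bd' g by (simp add: bounded_iff)
    \<comment> \<open>The two functions agree only on the carrier, so they need not be equal;
      monotonicity in both directions still gives equal means.\<close>
    have "m (\<lambda>x. f (k \<otimes>\<^bsub>K\<^esub> q x)) = m (\<lambda>x. f (q (g \<otimes>\<^bsub>G\<^esub> x)))"
      using g by (intro antisym mono bd' bd'') simp_all
    also have "\<dots> = m (\<lambda>x. f (q x))" by (rule inv[OF g(1) bd[OF f]])
    finally show "m (\<lambda>x. f (k \<otimes>\<^bsub>K\<^esub> q x)) = m (\<lambda>x. f (q x))" .
  qed (rule one)
qed

text \<open>The entries of the powers of the Markov operator of the random walk driven by the uniform
  measure on \<open>F\<close>.\<close>

primrec walk :: "('a, 'b) monoid_scheme \<Rightarrow> 'a set \<Rightarrow> 'a \<Rightarrow> nat \<Rightarrow> 'a \<Rightarrow> real" where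
  "walk G F y 0 x = (if x = y then 1 else 0)"
| "walk G F y (Suc n) x = (\<Sum>g\<in>F. walk G F y n (inv\<^bsub>G\<^esub> g \<otimes>\<^bsub>G\<^esub> x)) / card F"

lemma walk_nonneg: "0 \<le> walk G F y n x"
  by (induction n arbitrary: x) (auto intro!: sum_nonneg divide_nonneg_nonneg)

abbreviation markov :: "('a, 'b) monoid_scheme \<Rightarrow> 'a set \<Rightarrow> 'a ell2 \<Rightarrow>\<^sub>L 'a ell2" where
  "markov G F \<equiv> lin_comb (left_reg G) (\<lambda>_. of_real (1 / card F)) F"

text \<open>On the carrier, \<open>walk G F y n\<close> is the n-th power of the Markov operator
  applied to \<open>delta y\<close>, and an entry of a vector is at most its norm.\<close>

lemma walk_le_norm:
  assumes "group G" "F \<subseteq> carrier G" "x \<in> carrier G" "y \<in> carrier G"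
  shows "walk G F y n x \<le> norm (markov G F) ^ n"
proof -
  interpret group G by fact
  have "\<exists>v. norm v \<le> norm (markov G F) ^ n \<and> (\<forall>x\<in>carrier G. ell2_apply v x = of_real (walk G F y n x))"
  proof (induction n)
    case 0
    show ?case by (rule exI[of _ "delta y"]) (simp add: ell2_apply_delta)
  next
    case (Suc n)
    then obtain v where v: "norm v \<le> norm (markov G F) ^ n"
      "\<And>x. x \<in> carrier G \<Longrightarrow> ell2_apply v x = of_real (walk G F y n x)" by blast
    have "norm (blinfun_apply (markov G F) v) \<le> norm (markov G F) * norm (markov G F) ^ n"
      by (rule order_trans[OF norm_blinfun mult_left_mono[OF v(1)]]) simp
    moreover have "ell2_apply (blinfun_apply (markov G F) v) x = of_real (walk G F y (Suc n) x)"
      if x: "x \<in> carrier G" for x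
    proof -
      have "ell2_apply (blinfun_apply (markov G F) v) x
        = (\<Sum>g\<in>F. of_real (1 / card F) * of_real (walk G F y n (inv\<^bsub>G\<^esub> g \<otimes>\<^bsub>G\<^esub> x)))"
        unfolding lin_comb_apply ell2_apply_sum scaleC_ell2.rep_eq
      proof (intro sum.cong refl)
        fix g assume "g \<in> F"
        then show "of_real (1 / card F) * ell2_apply (blinfun_apply (left_reg G g) v) x
          = of_real (1 / card F) * of_real (walk G F y n (inv\<^bsub>G\<^esub> g \<otimes>\<^bsub>G\<^esub> x))"
          using assms(2) x by (simp add: left_reg_apply[OF assms(1)] subset_eq v(2))
      qed
      then show ?thesis by (simp add: sum_distrib_left sum_divide_distrib)
    qed
    ultimately show ?case by (intro exI[of _ "blinfun_apply (markov G F) v"]) simp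
  qed
  then obtain v where "norm v \<le> norm (markov G F) ^ n" "ell2_apply v x = of_real (walk G F y n x)"
    using assms(3) by blast
  then show ?thesis using cmod_ell2_apply_le[of v x] walk_nonneg[of G F y n x] by simp
qed

text \<open>The easy half of Kesten's theorem, without Folner sets. If the norm were less than \<open>t < 1\<close>,
  then \<open>u = \<Sum>\<^sub>n t\<^sup>-\<^sup>n P\<^sup>n \<delta>\<^sub>y\<close> (with one base point \<open>y\<close> in each orbit of the subgroup generated by
  \<open>F\<close>) satisfies \<open>P u \<le> t u\<close>. By concavity of the logarithm the bounded functions
  \<open>D\<^sub>g(x) = ln u(x) - ln u(g\<^sup>-\<^sup>1 x)\<close> have average at least \<open>ln (1/t) > 0\<close> over \<open>g \<in> F\<close>, although
  \<open>D\<^sub>g\<close> and \<open>D\<^sub>h\<close> have opposite means when \<open>h = g\<^sup>-\<^sup>1\<close>.\<close>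

lemma kesten_amenable:
  assumes G: "group G" and amen: "amenable G" and F: "finite F" "F \<subseteq> carrier G" "F \<noteq> {}"
    and sym: "\<And>g. g \<in> F \<Longrightarrow> inv\<^bsub>G\<^esub> g \<in> F"
  shows "1 \<le> norm (markov G F)"
proof (rule ccontr)
  interpret group G by fact
  let ?N = "real (card F)" and ?r = "norm (markov G F)"
  have N: "?N \<ge> 1" using F by (simp add: Suc_leI card_gt_0_iff)
  assume "\<not> 1 \<le> ?r"
  \<comment> \<open>The gap below t makes the series for u converge geometrically; the gap above it
    gives ln (1/t) > 0, which produces the contradiction.\<close>
  then obtain t where t: "?r < t" "t < 1" using dense[of ?r 1] by auto
  have t0: "0 < t" using t(1) norm_ge_zero[of "markov G F"] by linarith
  define u where "u y x = (\<Sum>n. walk G F y n x / t ^ n)" for y x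
  have sm: "summable (\<lambda>n. walk G F y n x / t ^ n)" if "x \<in> carrier G" "y \<in> carrier G" for x y
  proof (rule summable_comparison_test')
    show "summable (\<lambda>n. (?r / t) ^ n)" using t t0 by (intro summable_geometric) simp
    show "norm (walk G F y n x / t ^ n) \<le> (?r / t) ^ n" for n
      using walk_le_norm[OF G F(2) that, of n] walk_nonneg[of G F y n x] t0
      by (simp add: power_divide divide_right_mono)
  qed
  have inv_mult: "inv\<^bsub>G\<^esub> g \<otimes>\<^bsub>G\<^esub> x \<in> carrier G" if "g \<in> F" "x \<in> carrier G" for g x
    using that F(2) by auto
  have super: "(\<Sum>g\<in>F. u y (inv\<^bsub>G\<^esub> g \<otimes>\<^bsub>G\<^esub> x)) \<le> ?N * t * u y x"
    if x: "x \<in> carrier G" and y: "y \<in> carrier G" for x y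
  proof -
    have "(\<Sum>g\<in>F. u y (inv\<^bsub>G\<^esub> g \<otimes>\<^bsub>G\<^esub> x)) = (\<Sum>n. \<Sum>g\<in>F. walk G F y n (inv\<^bsub>G\<^esub> g \<otimes>\<^bsub>G\<^esub> x) / t ^ n)"
      unfolding u_def by (rule suminf_sum[symmetric]) (use sm inv_mult x y in auto)
    \<comment> \<open>One averaging step raises n by one, and renormalising t^n to t^(n+1) costs the
      factor t. The shifted series lacks the nonnegative term n = 0, whence only an
      inequality.\<close>
    also have "\<dots> = (\<Sum>n. ?N * t * (walk G F y (Suc n) x / t ^ Suc n))"
      using N t0 by (intro suminf_cong) (simp add: sum_divide_distrib[symmetric])
    also have "\<dots> = ?N * t * (\<Sum>n. walk G F y (Suc n) x / t ^ Suc n)"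
      by (rule suminf_mult) (rule summable_Suc_iff[THEN iffD2, OF sm[OF x y]])
    also have "(\<Sum>n. walk G F y (Suc n) x / t ^ Suc n) = u y x - walk G F y 0 x"
      unfolding u_def suminf_split_head[OF sm[OF x y]] by (simp del: walk.simps)
    also have "?N * t * (u y x - walk G F y 0 x) \<le> ?N * t * u y x"
      using t0 N walk_nonneg[of G F y 0 x] by (intro mult_left_mono) auto
    finally show ?thesis .
  qed
  define R where "R = {(x, g \<otimes>\<^bsub>G\<^esub> x) | x g. x \<in> carrier G \<and> g \<in> F}"
  have symR: "sym (R\<^sup>*)"
  proof (rule sym_rtrancl, rule symI)
    fix a b assume "(a, b) \<in> R"
    then obtain g where g: "a \<in> carrier G" "g \<in> F" "b = g \<otimes>\<^bsub>G\<^esub> a" by (auto simp: R_def)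
    then have "a = inv\<^bsub>G\<^esub> g \<otimes>\<^bsub>G\<^esub> b" "b \<in> carrier G"
      using F(2) by (auto simp: m_assoc[symmetric])
    then show "(b, a) \<in> R" using sym[OF g(2)] by (auto simp: R_def)
  qed
  have step: "(x, inv\<^bsub>G\<^esub> g \<otimes>\<^bsub>G\<^esub> x) \<in> R" if "x \<in> carrier G" "g \<in> F" for x g
    using that sym by (auto simp: R_def)
  have walk_pos: "\<exists>n. 0 < walk G F y n x" if "(y, x) \<in> R\<^sup>*" for x y
    using that
  proof (induction rule: rtrancl_induct)
    case base
    show ?case by (rule exI[of _ 0]) simp
  next
    case (step a b)
    then obtain n g where n: "0 < walk G F y n a" and g: "a \<in> carrier G" "g \<in> F" "b = g \<otimes>\<^bsub>G\<^esub> a"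
      by (auto simp: R_def)
    have "inv\<^bsub>G\<^esub> g \<otimes>\<^bsub>G\<^esub> b = a" using g F(2) by (auto simp: m_assoc[symmetric])
    then have "walk G F y n a \<le> (\<Sum>g\<in>F. walk G F y n (inv\<^bsub>G\<^esub> g \<otimes>\<^bsub>G\<^esub> b))"
      using F(1) g(2) walk_nonneg
      by (metis (no_types, lifting) member_le_sum)
    then have "0 < walk G F y (Suc n) b" using n N by simp
    then show ?case by blast
  qed
  \<comment> \<open>\<open>u y x\<close> vanishes when x cannot be reached from y, which would ruin
    the logarithm. The choice depends only on the set of points that reach x; since R is symmetric,
    this set is the same for neighbours, so one base point serves a whole component.\<close>
  define s where "s x = (SOME y. (y, x) \<in> R\<^sup>*)" for x
  have s: "(s x, x) \<in> R\<^sup>*" for x unfolding s_def by (rule someI[of _ x]) simp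
  have s_carrier: "s x \<in> carrier G" if "x \<in> carrier G" for x
    using s[of x] that by (cases rule: converse_rtranclE) (auto simp: R_def)
  have s_step: "s (inv\<^bsub>G\<^esub> g \<otimes>\<^bsub>G\<^esub> x) = s x" if "x \<in> carrier G" "g \<in> F" for x g
  proof -
    have "(y, x) \<in> R\<^sup>* \<longleftrightarrow> (y, inv\<^bsub>G\<^esub> g \<otimes>\<^bsub>G\<^esub> x) \<in> R\<^sup>*" for y
      using r_into_rtrancl[OF step[OF that]] symR by (meson rtrancl_trans symD)
    then show ?thesis unfolding s_def by simp
  qed
  define w where "w x = u (s x) x" for x
  have w_pos: "0 < w x" if "x \<in> carrier G" for x
  proof -
    obtain n where "0 < walk G F (s x) n x" using walk_pos[OF s] by blast
    then show ?thesis
      unfolding w_def u_def using t0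
      by (intro suminf_pos2[where i = n] sm that s_carrier) (auto intro!: divide_nonneg_pos walk_nonneg)
  qed
  have w_super: "(\<Sum>g\<in>F. w (inv\<^bsub>G\<^esub> g \<otimes>\<^bsub>G\<^esub> x)) \<le> ?N * t * w x" if "x \<in> carrier G" for x
  proof -
    have "(\<Sum>g\<in>F. w (inv\<^bsub>G\<^esub> g \<otimes>\<^bsub>G\<^esub> x)) = (\<Sum>g\<in>F. u (s x) (inv\<^bsub>G\<^esub> g \<otimes>\<^bsub>G\<^esub> x))"
      using s_step[OF that] by (intro sum.cong) (auto simp: w_def)
    then show ?thesis using super[OF that s_carrier[OF that]] by (simp add: w_def)
  qed
  define D where "D g x = ln (w x) - ln (w (inv\<^bsub>G\<^esub> g \<otimes>\<^bsub>G\<^esub> x))" for g x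
  have D_inv: "D (inv\<^bsub>G\<^esub> g) (inv\<^bsub>G\<^esub> g \<otimes>\<^bsub>G\<^esub> x) = - D g x" if "x \<in> carrier G" "g \<in> F" for x g
  proof -
    have "g \<in> carrier G" using that F(2) by blast
    then show ?thesis using that(1) by (simp add: D_def m_assoc[symmetric])
  qed
  \<comment> \<open>A Harnack type estimate: a single summand is at most the whole sum in
    \<open>w_super\<close>. The opposite bound comes from the inverse generator through
    \<open>D_inv\<close>.\<close>
  have D_ge: "- ln ?N \<le> D g x" if x: "x \<in> carrier G" and g: "g \<in> F" for x g
  proof -
    have "w (inv\<^bsub>G\<^esub> g \<otimes>\<^bsub>G\<^esub> x) \<le> (\<Sum>g\<in>F. w (inv\<^bsub>G\<^esub> g \<otimes>\<^bsub>G\<^esub> x))"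
      using F(1) g w_pos inv_mult x by (intro member_le_sum) (auto intro: less_imp_le)
    also have "\<dots> \<le> ?N * t * w x" by (rule w_super[OF x])
    also have "\<dots> \<le> ?N * w x" using t t0 N w_pos[OF x] by (simp add: mult_left_le_one_le mult_le_cancel_right1)
    finally have "ln (w (inv\<^bsub>G\<^esub> g \<otimes>\<^bsub>G\<^esub> x)) \<le> ln (?N * w x)"
      using w_pos[OF inv_mult[OF g x]] by (intro ln_mono) auto
    then show ?thesis using N w_pos[OF x] by (simp add: D_def ln_mult)
  qed
  have D_le: "D g x \<le> ln ?N" if "x \<in> carrier G" "g \<in> F" for x g
    using D_ge[OF inv_mult[OF that(2,1)] sym[OF that(2)]] D_inv[OF that] by simp
  have D_bd: "bounded (D g ` carrier G)" if "g \<in> F" for g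
    unfolding bounded_iff using D_ge[OF _ that] D_le[OF _ that]
    by (intro exI[of _ "ln ?N"]) (auto simp: abs_le_iff minus_le_iff)
  have D_sum: "?N * ln (1 / t) \<le> (\<Sum>g\<in>F. D g x)" if x: "x \<in> carrier G" for x
  proof -
    have "1 + ln (1 / t) - w (inv\<^bsub>G\<^esub> g \<otimes>\<^bsub>G\<^esub> x) / w x / t \<le> D g x" if "g \<in> F" for g
    proof -
      \<comment> \<open>Dividing by t as well makes the average of \<open>?z\<close> over F at most
        1, so in ln z \<le> z - 1 the constants cancel and ln (1/t) survives.\<close>
      let ?z = "w (inv\<^bsub>G\<^esub> g \<otimes>\<^bsub>G\<^esub> x) / w x / t"
      have p: "0 < w (inv\<^bsub>G\<^esub> g \<otimes>\<^bsub>G\<^esub> x)" "0 < w x" using w_pos x inv_mult that by auto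
      have "ln ?z \<le> ?z - 1" using p t0 by (intro ln_le_minus_one) simp
      moreover have "ln ?z = - D g x + ln (1 / t)"
        using p t0 by (simp add: D_def ln_div ln_mult)
      ultimately show ?thesis by simp
    qed
    then have "(\<Sum>g\<in>F. 1 + ln (1 / t) - w (inv\<^bsub>G\<^esub> g \<otimes>\<^bsub>G\<^esub> x) / w x / t) \<le> (\<Sum>g\<in>F. D g x)"
      by (rule sum_mono)
    moreover have "(\<Sum>g\<in>F. w (inv\<^bsub>G\<^esub> g \<otimes>\<^bsub>G\<^esub> x)) / w x / t \<le> ?N"
      using w_super[OF x] w_pos[OF x] t0 by (simp add: field_simps)
    ultimately show ?thesis
      by (simp add: sum_subtractf sum_divide_distrib[symmetric] algebra_simps)
  qed
  obtain m where m: "invariant_mean G m"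
    using amen amenable_iff_invariant_mean by blast
  note add = invariant_meanD(1)[OF m] and scale = invariant_meanD(2)[OF m] and one = invariant_meanD(4)[OF m]
    and inv = invariant_meanD(5)[OF m] and mono = invariant_mean_mono[OF m]
  have const: "m (\<lambda>_. c) = c" for c using scale[of "\<lambda>_. 1" c] one by (simp add: image_constant_conv)
  have m_sum: "bounded ((\<lambda>x. \<Sum>g\<in>E. D g x) ` carrier G) \<and> m (\<lambda>x. \<Sum>g\<in>E. D g x) = (\<Sum>g\<in>E. m (D g))"
    if "finite E" "E \<subseteq> F" for E
    using that
  proof (induction E)
    case empty
    show ?case by (simp add: const image_constant_conv)
  next
    case (insert g E)
    then show ?case using D_bd[of g] add[of "D g" "\<lambda>x. \<Sum>g\<in>E. D g x"]
      by (auto intro: bounded_plus_comp)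
  qed
  have m_inv: "m (D (inv\<^bsub>G\<^esub> g)) = - m (D g)" if g: "g \<in> F" for g
  proof -
    have gc: "inv\<^bsub>G\<^esub> g \<in> carrier G" using g F(2) by auto
    have bd: "bounded ((\<lambda>x. (-1) * D g x) ` carrier G)"
      using D_bd[OF g] by (simp add: bounded_iff)
    have bd': "bounded ((\<lambda>x. D (inv\<^bsub>G\<^esub> g) (inv\<^bsub>G\<^esub> g \<otimes>\<^bsub>G\<^esub> x)) ` carrier G)"
      using bd D_inv[OF _ g] by (simp add: bounded_iff)
    have "m (D (inv\<^bsub>G\<^esub> g)) = m (\<lambda>x. D (inv\<^bsub>G\<^esub> g) (inv\<^bsub>G\<^esub> g \<otimes>\<^bsub>G\<^esub> x))"
      by (rule inv[OF gc D_bd[OF sym[OF g]], symmetric])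
    also have "\<dots> = m (\<lambda>x. (-1) * D g x)"
      by (intro antisym mono bd bd') (simp_all add: D_inv[OF _ g])
    also have "\<dots> = - m (D g)" by (simp only: scale[OF D_bd[OF g]])
    finally show ?thesis .
  qed
  have "?N * ln (1 / t) = m (\<lambda>_. ?N * ln (1 / t))" by (simp add: const)
  also have "\<dots> \<le> m (\<lambda>x. \<Sum>g\<in>F. D g x)"
    using m_sum[OF F(1)] D_sum by (intro mono) (auto simp: bounded_iff)
  also have "\<dots> = (\<Sum>g\<in>F. m (D g))" using m_sum[OF F(1)] by simp
  also have "\<dots> = 0"
  proof -
    have inv_inv: "inv\<^bsub>G\<^esub> (inv\<^bsub>G\<^esub> g) = g" if "g \<in> F" for g using that F(2) by auto
    have "(\<Sum>g\<in>F. m (D g)) = (\<Sum>g\<in>F. m (D (inv\<^bsub>G\<^esub> g)))"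
      by (rule sum.reindex_bij_witness[where i = "m_inv G" and j = "m_inv G"]) (auto simp: sym inv_inv)
    also have "\<dots> = - (\<Sum>g\<in>F. m (D g))" by (simp add: m_inv sum_negf)
    finally show ?thesis by simp
  qed
  finally have "?N * ln (1 / t) \<le> 0" .
  moreover have "0 < ln (1 / t)" using t t0 by (simp add: ln_div)
  ultimately show False using N by (simp add: mult_le_0_iff)
qed

lemma norm_one_minus_sq_le:
  assumes "cmod z \<le> 1"
  shows "(cmod (1 - z))\<^sup>2 \<le> 2 * (1 - Re z)"
proof -
  have "(cmod z)\<^sup>2 \<le> 1" using assms by (simp add: power_le_one)
  moreover have "(cmod (1 - z))\<^sup>2 = 1 - 2 * Re z + (cmod z)\<^sup>2"
    unfolding cmod_power2 by (simp add: power2_eq_square algebra_simps)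
  ultimately show ?thesis by simp
qed

text \<open>The squared norm of the sum of N translates of a unit vector v is a sum of N^2 inner
  products, none with real part above 1; if the total is nearly N^2, no single one can be far from
  1. The double sum in the conclusion is the inner product of the g-translate of v with v, where v
  has coefficients f.\<close>

lemma almost_invariant_vector:
  assumes G: "group G" and amen: "amenable G" and F: "finite F" "F \<subseteq> carrier G" and e: "0 < e"
  obtains H f where "finite H" "H \<subseteq> carrier G" "(\<Sum>h\<in>H. (cmod (f h))\<^sup>2) = 1"
    "\<forall>g\<in>F. cmod (1 - (\<Sum>h\<in>H. \<Sum>k\<in>H. if k = g \<otimes>\<^bsub>G\<^esub> h then f h * cnj (f k) else 0)) < e"
proof -
  interpret group G by fact
  \<comment> \<open>Symmetric, as \<open>kesten_amenable\<close> demands, and containing the unit so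
    that v itself is among the translates.\<close>
  define E where "E = insert \<one>\<^bsub>G\<^esub> (F \<union> m_inv G ` F)"
  have E: "finite E" "E \<subseteq> carrier G" "E \<noteq> {}" "\<one>\<^bsub>G\<^esub> \<in> E" "F \<subseteq> E"
    "\<And>g. g \<in> E \<Longrightarrow> inv\<^bsub>G\<^esub> g \<in> E"
    using F by (auto simp: E_def subset_eq)
  define N where "N = real (card E)"
  have N: "1 \<le> N" using E by (simp add: N_def Suc_leI card_gt_0_iff)
  let ?P = "markov G E"
  \<comment> \<open>Chosen so that \<open>4 * N\<^sup>2 * d\<close> is the square of
    \<open>min e 1 / 2\<close> in the final estimate; the minimum with 1 guarantees d \<le>
    1.\<close>
  define d where "d = (min e 1 / (4 * N))\<^sup>2"
  have d0: "0 < d" using e N by (simp add: d_def)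
  have "min e 1 / (4 * N) \<le> 1" using N by (auto simp: divide_le_eq)
  then have d1: "d \<le> 1" using e N by (simp add: d_def power_le_one)
  have "\<exists>x. (1 - d) * norm x < norm (blinfun_apply ?P x)"
  proof (rule ccontr)
    assume "\<nexists>x. (1 - d) * norm x < norm (blinfun_apply ?P x)"
    then have "norm ?P \<le> 1 - d" using d1 by (intro norm_blinfun_bound) (auto simp: not_less)
    then show False using kesten_amenable[OF G amen E(1,2,3,6)] d0 by linarith
  qed
  then obtain x where x: "(1 - d) * norm x < norm (blinfun_apply ?P x)" by blast
  \<comment> \<open>The strict inequality is an open condition, so it survives the passage to a
    finitely supported vector. Entries off the carrier are then discarded: the operator kills them
    and the norm can only drop.\<close>
  have "open {x. (1 - d) * norm x < norm (blinfun_apply ?P x)}"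
    by (intro open_Collect_less continuous_intros)
  then obtain r where r: "0 < r" "\<And>y. dist y x < r \<Longrightarrow> (1 - d) * norm y < norm (blinfun_apply ?P y)"
    using x unfolding open_dist by blast
  obtain S where S: "finite S" "norm (x - (\<Sum>i\<in>S. scaleC_ell2 (ell2_apply x i) (delta i))) < r"
    using ell2_approx_finite[OF r(1)] by blast
  define H where "H = S \<inter> carrier G"
  have H: "finite H" "H \<subseteq> carrier G" using S by (auto simp: H_def)
  let ?y = "\<Sum>i\<in>S. scaleC_ell2 (ell2_apply x i) (delta i)"
  let ?z = "\<Sum>i\<in>H. scaleC_ell2 (ell2_apply x i) (delta i)"
  have P_delta: "blinfun_apply ?P (delta i) = 0" if "i \<notin> carrier G" for i
    unfolding lin_comb_apply using E(2) that
    by (intro sum.neutral) (auto simp: left_reg_delta[OF G] ell2_eqI scaleC_ell2.rep_eq zero_ell2.rep_eq subset_eq)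
  have "blinfun_apply ?P ?y = blinfun_apply ?P ?z"
    unfolding blinfun.sum_right lin_comb_scaleC[OF left_reg_star_rep[OF G] E(2)]
  proof (rule sum.mono_neutral_right)
    have "scaleC_ell2 c (blinfun_apply ?P (delta i)) = 0" if "i \<notin> carrier G" for c i
      unfolding P_delta[OF that] by simp
    then show "\<forall>i\<in>S - H. scaleC_ell2 (ell2_apply x i) (blinfun_apply ?P (delta i)) = 0"
      using S(1) by (auto simp: H_def)
  qed (use S(1) in \<open>auto simp: H_def\<close>)
  moreover have "norm ?z \<le> norm ?y"
  proof (rule power2_le_imp_le)
    show "(norm ?z)\<^sup>2 \<le> (norm ?y)\<^sup>2"
      unfolding norm_ell2_fin[OF S(1) inj_on_id2] norm_ell2_fin[OF H(1) inj_on_id2]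
      using S(1) by (intro sum_mono2) (auto simp: H_def)
  qed simp
  moreover have "(1 - d) * norm ?y < norm (blinfun_apply ?P ?y)"
    using S(2) by (intro r(2)) (simp add: dist_norm norm_minus_commute)
  ultimately have z: "(1 - d) * norm ?z < norm (blinfun_apply ?P ?z)"
    using d1 by (smt (verit) mult_left_mono)
  then have z0: "0 < norm ?z" by (cases "?z = 0") auto
  define f where "f i = ell2_apply x i / norm ?z" for i
  define v where "v = (\<Sum>i\<in>H. scaleC_ell2 (f i) (delta i))"
  have v_z: "v = scaleC_ell2 (1 / norm ?z) ?z"
    unfolding v_def scaleC_ell2_sum by (simp add: f_def)
  then have v1: "norm v = 1" using z0 by (simp add: norm_scaleC_ell2 norm_divide)
  have "norm (blinfun_apply ?P v) = norm (blinfun_apply ?P ?z) / norm ?z"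
    unfolding v_z lin_comb_scaleC[OF left_reg_star_rep[OF G] E(2)] norm_scaleC_ell2 by (simp add: norm_divide)
  then have Pv: "1 - d < norm (blinfun_apply ?P v)"
    using z z0 by (simp only: pos_less_divide_eq)
  have f1: "(\<Sum>h\<in>H. (cmod (f h))\<^sup>2) = 1"
    using norm_ell2_fin[OF H(1) inj_on_id2, of f] v1 by (simp add: v_def)
  let ?L = "\<lambda>g. blinfun_apply (left_reg G g) v"
  have L1: "norm (?L g) \<le> 1" if "g \<in> carrier G" for g
    using left_reg_star_rep[OF G] that norm_blinfun[of "left_reg G g" v] v1
    by (auto simp: star_rep_def)
  have in1: "inner (?L g) (?L k) \<le> 1" if "g \<in> carrier G" "k \<in> carrier G" for g k
    using norm_cauchy_schwarz[of "?L g" "?L k"] L1[OF that(1)] L1[OF that(2)]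
    by (meson mult_le_one norm_ge_zero order_trans)
  have L_one: "?L \<one>\<^bsub>G\<^esub> = v"
  proof (rule ell2_eqI)
    fix i
    show "ell2_apply (?L \<one>\<^bsub>G\<^esub>) i = ell2_apply v i"
      using H by (auto simp: left_reg_apply[OF G] v_def ell2_apply_fin)
  qed
  have Re_ge: "1 - 2 * N\<^sup>2 * d \<le> inner (?L g) v" if g: "g \<in> F" for g
  proof -
    have "N\<^sup>2 * (1 - d)\<^sup>2 \<le> N\<^sup>2 * (norm (blinfun_apply ?P v))\<^sup>2"
      using Pv d1 by (intro mult_left_mono power_mono) auto
    also have "\<dots> = (norm (N *\<^sub>R blinfun_apply ?P v))\<^sup>2"
      by (simp add: power_mult_distrib)
    also have "N *\<^sub>R blinfun_apply ?P v = (\<Sum>g\<in>E. ?L g)"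
    proof -
      have "N *\<^sub>R scaleC_ell2 (of_real (1 / card E)) z = z" for z :: "'a ell2"
        by (rule ell2_eqI) (use N in \<open>simp add: N_def scaleR_ell2.rep_eq scaleC_ell2.rep_eq\<close>)
      then show ?thesis by (simp only: lin_comb_apply scaleR_sum_right)
    qed
    also have "(norm (\<Sum>g\<in>E. ?L g))\<^sup>2 = (\<Sum>(g, k)\<in>E \<times> E. inner (?L g) (?L k))"
      by (simp add: power2_norm_eq_inner inner_sum_left inner_sum_right sum.cartesian_product inner_commute)
    \<comment> \<open>The pair of g and the unit is split off; each of the other N^2 - 1 terms is at
      most 1, so the separated one has to make up the rest.\<close>
    also have "\<dots> = inner (?L g) v + (\<Sum>(g, k)\<in>E \<times> E - {(g, \<one>\<^bsub>G\<^esub>)}. inner (?L g) (?L k))"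
      using g E L_one by (subst sum.remove[where x = "(g, \<one>\<^bsub>G\<^esub>)"]) auto
    also have "(\<Sum>(g, k)\<in>E \<times> E - {(g, \<one>\<^bsub>G\<^esub>)}. inner (?L g) (?L k)) \<le> (\<Sum>_\<in>E \<times> E - {(g, \<one>\<^bsub>G\<^esub>)}. 1)"
      by (rule sum_mono) (use E(2) in1 in auto)
    also have "\<dots> = N\<^sup>2 - 1"
    proof -
      have "card (E \<times> E - {(g, \<one>\<^bsub>G\<^esub>)}) = card E * card E - 1"
        using g E by (subst card_Diff_singleton) (auto simp: card_cartesian_product)
      moreover have "1 \<le> card E * card E" using N by (simp add: N_def)
      ultimately show ?thesis by (simp add: N_def power2_eq_square of_nat_diff)
    qed
    finally have "N\<^sup>2 * (1 - d)\<^sup>2 - N\<^sup>2 + 1 \<le> inner (?L g) v" by simp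
    moreover have "N\<^sup>2 * (1 - d)\<^sup>2 - N\<^sup>2 = N\<^sup>2 * d\<^sup>2 - 2 * N\<^sup>2 * d"
      by (simp add: power2_eq_square algebra_simps)
    moreover have "0 \<le> N\<^sup>2 * d\<^sup>2" by simp
    ultimately show ?thesis by linarith
  qed
  have cinner_eq: "(\<Sum>h\<in>H. \<Sum>k\<in>H. if k = g \<otimes>\<^bsub>G\<^esub> h then f h * cnj (f k) else 0) = cinner (?L g) v"
    if "g \<in> carrier G" for g
    unfolding v_def blinfun.sum_right cinner_sum_left cinner_sum_right
    using that H(2)
    by (subst sum.swap, intro sum.cong refl)
      (auto simp: star_rep_scaleC[OF left_reg_star_rep[OF G]] left_reg_delta[OF G] cinner_scaleC_left
        cinner_scaleC_right cinner_delta scaleC_ell2.rep_eq ell2_apply_delta)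
  show ?thesis
  proof (rule that[OF H f1], rule ballI)
    fix g assume g: "g \<in> F"
    then have gc: "g \<in> carrier G" using F by blast
    have "cmod (cinner (?L g) v) \<le> 1"
      using cmod_cinner_le[of "?L g" v] L1[OF gc] v1 by simp
    then have "(cmod (1 - cinner (?L g) v))\<^sup>2 \<le> 2 * (1 - inner (?L g) v)"
      unfolding inner_ell2_def by (rule norm_one_minus_sq_le)
    also have "\<dots> \<le> 4 * N\<^sup>2 * d" using Re_ge[OF g] by simp
    also have "\<dots> = (min e 1 / 2)\<^sup>2"
    proof -
      have a: "min e 1 / 2 = 2 * N * (min e 1 / (4 * N))" using N by simp
      show ?thesis unfolding d_def a power_mult_distrib by simp
    qed
    finally have "cmod (1 - cinner (?L g) v) \<le> min e 1 / 2"
      by (rule power2_le_imp_le) (use e in simp)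
    then show "cmod (1 - (\<Sum>h\<in>H. \<Sum>k\<in>H. if k = g \<otimes>\<^bsub>G\<^esub> h then f h * cnj (f k) else 0)) < e"
      unfolding cinner_eq[OF gc] using e by linarith
  qed
qed

section \<open>Schur multipliers and weak containment in the regular representation\<close>

lemma scaleC_op_compose [simp]: "scaleC_op c o\<^sub>L (scaleC_op d o\<^sub>L T) = scaleC_op (c * d) o\<^sub>L T"
  by (rule blinfun_eqI) simp

lemma compose_op_assoc: "(R o\<^sub>L S) o\<^sub>L T = R o\<^sub>L (S o\<^sub>L T)"
  by (rule blinfun_eqI) simp

lemma scaleC_op_zero_compose [simp]: "scaleC_op 0 o\<^sub>L T = 0"
  by (rule blinfun_eqI) simp

lemma scaleC_op_one_compose [simp]: "scaleC_op 1 o\<^sub>L T = T"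
  by (rule blinfun_eqI) simp

lemma scaleC_op_add_compose: "scaleC_op (c + d) o\<^sub>L T = (scaleC_op c o\<^sub>L T) + (scaleC_op d o\<^sub>L T)"
  by (intro blinfun_eqI ell2_eqI)
    (simp add: blinfun.add_left plus_ell2.rep_eq scaleC_ell2.rep_eq distrib_right)

lemma scaleC_op_sum_compose: "scaleC_op (sum c A) o\<^sub>L T = (\<Sum>a\<in>A. scaleC_op (c a) o\<^sub>L T)"
  by (induction A rule: infinite_finite_induct) (auto simp: scaleC_op_add_compose)

lemma lin_comb_add: "lin_comb u c F + lin_comb u d F = lin_comb u (\<lambda>g. c g + d g) F"
  by (simp add: lin_comb_def scaleC_op_add_compose sum.distrib)

lemma lin_comb_scale: "scaleC_op d o\<^sub>L lin_comb u c F = lin_comb u (\<lambda>g. d * c g) F"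
  by (simp add: lin_comb_def bounded_bilinear.sum_right[OF bounded_bilinear_blinfun_compose])

lemma lin_comb_extend:
  assumes "finite F'" "F \<subseteq> F'"
  shows "lin_comb u c F = lin_comb u (\<lambda>g. if g \<in> F then c g else 0) F'"
  unfolding lin_comb_def using assms by (intro sum.mono_neutral_cong_left) auto

lemma lin_comb_cong: "(\<And>g. g \<in> F \<Longrightarrow> c g = d g \<and> u g = v g) \<Longrightarrow> lin_comb u c F = lin_comb v d F"
  unfolding lin_comb_def by (rule sum.cong) auto

text \<open>For H inside the carrier, the positive definite function that maps g to the inner
  product of \<lambda>(g) f with f, written in the shape in which the compression of
  \<open>schur_transfer_bound\<close> produces it.\<close>

definition schur_coeff :: "('k, 'b) monoid_scheme \<Rightarrow> ('k \<Rightarrow> complex) \<Rightarrow> 'k set \<Rightarrow> 'k \<Rightarrow> complex" where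
  "schur_coeff K f H g = (\<Sum>h\<in>H. \<Sum>k\<in>H. if k = g \<otimes>\<^bsub>K\<^esub> h then f h * cnj (f k) else 0)"

text \<open>The pairs (h, k) are sorted by g = k h^-1: all pairs over one g carry the same operator,
  and their weights add up to the multiplier value at g.\<close>

lemma schur_sum_eq_lin_comb:
  assumes "group K" and H: "finite H" "H \<subseteq> carrier K" and F: "finite F" "F \<subseteq> carrier K"
  shows "(\<Sum>h\<in>H. \<Sum>k\<in>H. scaleC_op ((if k \<otimes>\<^bsub>K\<^esub> inv\<^bsub>K\<^esub> h \<in> F then c (k \<otimes>\<^bsub>K\<^esub> inv\<^bsub>K\<^esub> h) else 0) * (f h * cnj (f k)))
      o\<^sub>L u (k \<otimes>\<^bsub>K\<^esub> inv\<^bsub>K\<^esub> h)) = lin_comb u (\<lambda>g. c g * schur_coeff K f H g) F"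
proof -
  interpret group K by fact
  have "(\<Sum>h\<in>H. \<Sum>k\<in>H. scaleC_op ((if k \<otimes>\<^bsub>K\<^esub> inv\<^bsub>K\<^esub> h \<in> F then c (k \<otimes>\<^bsub>K\<^esub> inv\<^bsub>K\<^esub> h) else 0) * (f h * cnj (f k)))
      o\<^sub>L u (k \<otimes>\<^bsub>K\<^esub> inv\<^bsub>K\<^esub> h))
    = (\<Sum>h\<in>H. \<Sum>k\<in>H. \<Sum>g\<in>F. scaleC_op (c g * (if k = g \<otimes>\<^bsub>K\<^esub> h then f h * cnj (f k) else 0)) o\<^sub>L u g)"
  proof (intro sum.cong refl)
    fix h k assume hk: "h \<in> H" "k \<in> H"
    have "(k = g \<otimes>\<^bsub>K\<^esub> h) = (g = k \<otimes>\<^bsub>K\<^esub> inv\<^bsub>K\<^esub> h)" if "g \<in> F" for g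
    proof -
      have "g \<in> carrier K" "h \<in> carrier K" "k \<in> carrier K" using that hk H F by auto
      then show ?thesis using inv_solve_right'[of g k h] by auto
    qed
    then have "(\<Sum>g\<in>F. scaleC_op (c g * (if k = g \<otimes>\<^bsub>K\<^esub> h then f h * cnj (f k) else 0)) o\<^sub>L u g)
      = (\<Sum>g\<in>F. if g = k \<otimes>\<^bsub>K\<^esub> inv\<^bsub>K\<^esub> h then scaleC_op (c g * (f h * cnj (f k))) o\<^sub>L u g else 0)"
      by (intro sum.cong) auto
    then show "scaleC_op ((if k \<otimes>\<^bsub>K\<^esub> inv\<^bsub>K\<^esub> h \<in> F then c (k \<otimes>\<^bsub>K\<^esub> inv\<^bsub>K\<^esub> h) else 0) * (f h * cnj (f k)))
        o\<^sub>L u (k \<otimes>\<^bsub>K\<^esub> inv\<^bsub>K\<^esub> h) =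
      (\<Sum>g\<in>F. scaleC_op (c g * (if k = g \<otimes>\<^bsub>K\<^esub> h then f h * cnj (f k) else 0)) o\<^sub>L u g)"
      using F(1) by simp
  qed
  also have "\<dots> = (\<Sum>h\<in>H. \<Sum>g\<in>F. \<Sum>k\<in>H. scaleC_op (c g * (if k = g \<otimes>\<^bsub>K\<^esub> h then f h * cnj (f k) else 0)) o\<^sub>L u g)"
    by (intro sum.cong refl sum.swap)
  also have "\<dots> = (\<Sum>g\<in>F. \<Sum>h\<in>H. \<Sum>k\<in>H. scaleC_op (c g * (if k = g \<otimes>\<^bsub>K\<^esub> h then f h * cnj (f k) else 0)) o\<^sub>L u g)"
    by (rule sum.swap)
  also have "\<dots> = lin_comb u (\<lambda>g. c g * schur_coeff K f H g) F"
    unfolding lin_comb_def schur_coeff_def sum_distrib_left scaleC_op_sum_compose ..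
  finally show ?thesis .
qed

text \<open>The error is measured as a finite l1 sum because \<open>norm_lin_comb_le\<close> turns
  this into an operator bound for every family of contractions, be it a representation or a family
  of lifts.\<close>

lemma almost_invariant_schur_coeff:
  assumes "group K" "amenable K" "finite F" "F \<subseteq> carrier K" "0 < e"
  obtains H f where "finite H" "H \<subseteq> carrier K" "(\<Sum>h\<in>H. (cmod (f h))\<^sup>2) = 1"
    "(\<Sum>g\<in>F. cmod (c g * (1 - schur_coeff K f H g))) \<le> e"
proof -
  \<comment> \<open>The added 1 keeps the denominator positive when all coefficients on F
    vanish.\<close>
  define d where "d = e / (1 + (\<Sum>g\<in>F. cmod (c g)))"
  have pos: "0 < 1 + (\<Sum>g\<in>F. cmod (c g))" by (rule add_pos_nonneg) (auto intro: sum_nonneg)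
  then have "0 < d" using assms(5) by (simp add: d_def)
  then obtain H f where *: "finite H" "H \<subseteq> carrier K" "(\<Sum>h\<in>H. (cmod (f h))\<^sup>2) = 1"
    "\<forall>g\<in>F. cmod (1 - schur_coeff K f H g) < d"
    unfolding schur_coeff_def by (rule almost_invariant_vector[OF assms(1-4)])
  have "(\<Sum>g\<in>F. cmod (c g * (1 - schur_coeff K f H g))) \<le> (\<Sum>g\<in>F. cmod (c g) * d)"
    using *(4) by (intro sum_mono) (simp add: norm_mult mult_left_mono less_imp_le)
  also have "\<dots> = (\<Sum>g\<in>F. cmod (c g)) * d" by (simp add: sum_distrib_right)
  also have "\<dots> \<le> (1 + (\<Sum>g\<in>F. cmod (c g))) * d"
    using \<open>0 < d\<close> by (intro mult_right_mono) auto
  also have "\<dots> = e" using pos by (simp add: d_def)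
  finally show ?thesis using *(1-3) that by blast
qed

text \<open>In \<open>schur_transfer_bound\<close> take V k = u(k) and W h = u(h^-1): their products
  recombine to u(k h^-1). This is a finite form of Fell absorption, by which tensoring u with
  \<lambda> gives a multiple of \<lambda>.\<close>

lemma star_rep_weakly_contained:
  assumes G: "group G" and amen: "amenable G" and u: "star_rep G u" and F: "finite F" "F \<subseteq> carrier G"
  shows "norm (lin_comb u c F) \<le> norm (lin_comb (left_reg G) c F)"
proof (rule field_le_epsilon)
  interpret group G by fact
  fix e :: real assume "0 < e"
  then obtain H f where H: "finite H" "H \<subseteq> carrier G" and f: "(\<Sum>h\<in>H. (cmod (f h))\<^sup>2) = 1"
    and small: "(\<Sum>g\<in>F. cmod (c g * (1 - schur_coeff G f H g))) \<le> e"
    using almost_invariant_schur_coeff[OF G amen F, where c = c] by metis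
  let ?d = "\<lambda>g. c g * schur_coeff G f H g"
  have "(\<Sum>h\<in>H. \<Sum>k\<in>H. scaleC_op ((if k \<otimes>\<^bsub>G\<^esub> inv\<^bsub>G\<^esub> h \<in> F then c (k \<otimes>\<^bsub>G\<^esub> inv\<^bsub>G\<^esub> h) else 0) * (f h * cnj (f k)))
      o\<^sub>L (u k o\<^sub>L u (inv\<^bsub>G\<^esub> h))) = lin_comb u ?d F"
    unfolding schur_sum_eq_lin_comb[OF G H F, symmetric]
    using u H(2) by (intro sum.cong refl) (simp add: star_rep_def subset_eq)
  moreover have "norm (\<Sum>h\<in>H. \<Sum>k\<in>H. scaleC_op ((if k \<otimes>\<^bsub>G\<^esub> inv\<^bsub>G\<^esub> h \<in> F then c (k \<otimes>\<^bsub>G\<^esub> inv\<^bsub>G\<^esub> h) else 0) * (f h * cnj (f k)))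
      o\<^sub>L (u k o\<^sub>L u (inv\<^bsub>G\<^esub> h))) \<le> norm (lin_comb (left_reg G) c F)"
    using u H(2)
    by (intro schur_transfer_bound[where V' = "\<lambda>h. u (inv\<^bsub>G\<^esub> h)"] G H F f) (auto simp: star_rep_def)
  moreover have "norm (lin_comb u (\<lambda>g. c g * (1 - schur_coeff G f H g)) F) \<le> e"
    using u F(2) by (intro order_trans[OF norm_lin_comb_le small]) (auto simp: star_rep_def)
  moreover have "lin_comb u c F = lin_comb u ?d F + lin_comb u (\<lambda>g. c g * (1 - schur_coeff G f H g)) F"
    unfolding lin_comb_add by (simp add: algebra_simps)
  ultimately show "norm (lin_comb u c F) \<le> norm (lin_comb (left_reg G) c F) + e"
    using norm_triangle_ineq[of "lin_comb u ?d F" "lin_comb u (\<lambda>g. c g * (1 - schur_coeff G f H g)) F"]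
    by simp
qed

section \<open>Extending representations to the reduced group C*-algebra\<close>

lemma group_alg_iff:
  "a \<in> group_alg G \<longleftrightarrow> (\<exists>c F. finite F \<and> F \<subseteq> carrier G \<and> a = lin_comb (left_reg G) c F)"
  unfolding group_alg_def lin_comb_def by auto

lemma lin_comb_in_group_alg: "finite F \<Longrightarrow> F \<subseteq> carrier G \<Longrightarrow> lin_comb (left_reg G) c F \<in> group_alg G"
  unfolding group_alg_iff by blast

lemma group_alg_two:
  assumes "a \<in> group_alg G" "b \<in> group_alg G"
  obtains c d F where "finite F" "F \<subseteq> carrier G" "a = lin_comb (left_reg G) c F" "b = lin_comb (left_reg G) d F"
proof -
  obtain c F d E where cF: "finite F" "F \<subseteq> carrier G" "a = lin_comb (left_reg G) c F"
    and dE: "finite E" "E \<subseteq> carrier G" "b = lin_comb (left_reg G) d E"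
    using assms unfolding group_alg_iff by blast
  show ?thesis
    by (rule that[of "F \<union> E" "\<lambda>g. if g \<in> F then c g else 0" "\<lambda>g. if g \<in> E then d g else 0"])
      (use cF dE in \<open>auto intro!: lin_comb_extend\<close>)
qed

lemma group_alg_add: "a \<in> group_alg G \<Longrightarrow> b \<in> group_alg G \<Longrightarrow> a + b \<in> group_alg G"
  by (erule (1) group_alg_two) (auto simp: lin_comb_add lin_comb_in_group_alg)

lemma group_alg_scale: "a \<in> group_alg G \<Longrightarrow> scaleC_op c o\<^sub>L a \<in> group_alg G"
proof -
  assume "a \<in> group_alg G"
  then obtain d F where "finite F" "F \<subseteq> carrier G" "a = lin_comb (left_reg G) d F"
    unfolding group_alg_iff by blast
  then show ?thesis by (simp add: lin_comb_scale lin_comb_in_group_alg)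
qed

lemma group_alg_zero: "0 \<in> group_alg G"
  unfolding group_alg_iff by (rule exI[of _ "\<lambda>_. 0"], rule exI[of _ "{}"]) (simp add: lin_comb_def)

lemma group_alg_gen: "g \<in> carrier G \<Longrightarrow> left_reg G g \<in> group_alg G"
  unfolding group_alg_iff by (rule exI[of _ "\<lambda>_. 1"], rule exI[of _ "{g}"]) (simp add: lin_comb_def)

lemma minus_eq_scaleC_op: "- T = scaleC_op (-1) o\<^sub>L T"
  by (rule blinfun_eqI) (simp add: blinfun.minus_left scaleC_ell2_uminus)

lemma group_alg_diff: "a \<in> group_alg G \<Longrightarrow> b \<in> group_alg G \<Longrightarrow> a - b \<in> group_alg G"
  by (simp add: group_alg_add group_alg_scale minus_eq_scaleC_op diff_conv_add_uminus del: add_uminus_conv_diff)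

lemma group_alg_sum: "(\<And>i. i \<in> I \<Longrightarrow> a i \<in> group_alg G) \<Longrightarrow> sum a I \<in> group_alg G"
  by (induction I rule: infinite_finite_induct) (auto simp: group_alg_zero group_alg_add)

lemma group_alg_induct [consumes 1, case_names zero add]:
  assumes "a \<in> group_alg G" "P 0"
    and "\<And>c g b. g \<in> carrier G \<Longrightarrow> b \<in> group_alg G \<Longrightarrow> P b \<Longrightarrow> P ((scaleC_op c o\<^sub>L left_reg G g) + b)"
  shows "P a"
proof -
  obtain c F where F: "finite F" "F \<subseteq> carrier G" and a: "a = lin_comb (left_reg G) c F"
    using assms(1) unfolding group_alg_iff by blast
  from F have "P (lin_comb (left_reg G) c F)"
  proof (induction F)
    case empty
    then show ?case using assms(2) by (simp add: lin_comb_def)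
  next
    case (insert g F)
    have "lin_comb (left_reg G) c (insert g F) = (scaleC_op (c g) o\<^sub>L left_reg G g) + lin_comb (left_reg G) c F"
      using insert.hyps by (simp add: lin_comb_def)
    moreover have "lin_comb (left_reg G) c F \<in> group_alg G"
      using insert by (intro lin_comb_in_group_alg) auto
    ultimately show ?case using insert assms(3) by simp
  qed
  then show ?thesis by (simp add: a)
qed

lemma left_reg_mult:
  "group G \<Longrightarrow> g \<in> carrier G \<Longrightarrow> h \<in> carrier G \<Longrightarrow> left_reg G (g \<otimes>\<^bsub>G\<^esub> h) = left_reg G g o\<^sub>L left_reg G h"
  using left_reg_star_rep[of G] by (auto simp: star_rep_def)

lemmas compose_add_left = bounded_bilinear.add_left[OF bounded_bilinear_blinfun_compose]
lemmas compose_add_right = bounded_bilinear.add_right[OF bounded_bilinear_blinfun_compose]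
lemmas tendsto_compose_op = bounded_bilinear.tendsto[OF bounded_bilinear_blinfun_compose]

lemma star_rep_compose_scaleC:
  assumes "star_rep G u" "g \<in> carrier G"
  shows "u g o\<^sub>L (scaleC_op c o\<^sub>L T) = scaleC_op c o\<^sub>L (u g o\<^sub>L T)"
  by (rule blinfun_eqI) (simp add: star_rep_scaleC[OF assms])

lemma group_alg_mult_gen:
  assumes G: "group G" and g: "g \<in> carrier G" and b: "b \<in> group_alg G"
  shows "left_reg G g o\<^sub>L b \<in> group_alg G"
  using b
proof (induction rule: group_alg_induct)
  case zero
  then show ?case by (simp add: group_alg_zero)
next
  case (add c h b)
  interpret group G by fact
  show ?case
    unfolding compose_add_right star_rep_compose_scaleC[OF left_reg_star_rep[OF G] g]
      left_reg_mult[OF G g add(1), symmetric]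
    using add g by (intro group_alg_add group_alg_scale group_alg_gen) auto
qed

lemma group_alg_mult:
  assumes G: "group G" and a: "a \<in> group_alg G" and b: "b \<in> group_alg G"
  shows "a o\<^sub>L b \<in> group_alg G"
  using a
proof (induction rule: group_alg_induct)
  case zero
  then show ?case
    by (simp add: bounded_bilinear.zero_left[OF bounded_bilinear_blinfun_compose] group_alg_zero)
next
  case (add c g a)
  then show ?case
    unfolding compose_add_left compose_op_assoc
    using b by (intro group_alg_add group_alg_scale group_alg_mult_gen[OF G])
qed

lemma group_alg_subset_Cr: "group_alg G \<subseteq> Cr G"
  unfolding Cr_def by (rule closure_subset)

lemma Cr_seq:
  assumes "a \<in> Cr G"
  obtains x where "\<And>n. x n \<in> group_alg G" "x \<longlonglongrightarrow> a"
  using assms unfolding Cr_def closure_sequential by blast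

lemma Cr_closed_seq: "(\<And>n. x n \<in> Cr G) \<Longrightarrow> x \<longlonglongrightarrow> a \<Longrightarrow> a \<in> Cr G"
  unfolding Cr_def by (meson closed_closure closed_sequentially)

lemma Cr_add: "a \<in> Cr G \<Longrightarrow> b \<in> Cr G \<Longrightarrow> a + b \<in> Cr G"
proof -
  assume "a \<in> Cr G" "b \<in> Cr G"
  then obtain x y where x: "\<And>n. x n \<in> group_alg G" "x \<longlonglongrightarrow> a" and y: "\<And>n. y n \<in> group_alg G" "y \<longlonglongrightarrow> b"
    by (metis Cr_seq)
  show ?thesis
  proof (rule Cr_closed_seq)
    show "x n + y n \<in> Cr G" for n using x(1) y(1) group_alg_add group_alg_subset_Cr by blast
    show "(\<lambda>n. x n + y n) \<longlonglongrightarrow> a + b" by (rule tendsto_add[OF x(2) y(2)])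
  qed
qed

lemma Cr_scale: "a \<in> Cr G \<Longrightarrow> scaleC_op c o\<^sub>L a \<in> Cr G"
proof -
  assume "a \<in> Cr G"
  then obtain x where x: "\<And>n. x n \<in> group_alg G" "x \<longlonglongrightarrow> a" by (metis Cr_seq)
  show ?thesis
  proof (rule Cr_closed_seq)
    show "scaleC_op c o\<^sub>L x n \<in> Cr G" for n using x(1) group_alg_scale group_alg_subset_Cr by blast
    show "(\<lambda>n. scaleC_op c o\<^sub>L x n) \<longlonglongrightarrow> (scaleC_op c o\<^sub>L a)" by (rule tendsto_compose_op[OF tendsto_const x(2)])
  qed
qed

lemma Cr_mult:
  assumes "group G" "a \<in> Cr G" "b \<in> Cr G"
  shows "a o\<^sub>L b \<in> Cr G"
proof -
  obtain x y where x: "\<And>n. x n \<in> group_alg G" "x \<longlonglongrightarrow> a" and y: "\<And>n. y n \<in> group_alg G" "y \<longlonglongrightarrow> b"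
    using assms(2,3) by (metis Cr_seq)
  show ?thesis
  proof (rule Cr_closed_seq)
    show "x n o\<^sub>L y n \<in> Cr G" for n using x(1) y(1) group_alg_mult[OF assms(1)] group_alg_subset_Cr by blast
    show "(\<lambda>n. x n o\<^sub>L y n) \<longlonglongrightarrow> (a o\<^sub>L b)" by (rule tendsto_compose_op[OF x(2) y(2)])
  qed
qed

text \<open>The part of \<open>star_hom_on\<close> through which a continuous map is determined by
  its values on the generators, as these span the group algebra. It is also inherited by a
  representation composed on both sides with comparison operators, so intertwined representations
  can be compared directly.\<close>

definition complex_linear_on ::
    "('i ell2 \<Rightarrow>\<^sub>L 'i ell2) set \<Rightarrow> (('i ell2 \<Rightarrow>\<^sub>L 'i ell2) \<Rightarrow> ('j ell2 \<Rightarrow>\<^sub>L 'j ell2)) \<Rightarrow> bool" where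
  "complex_linear_on A \<Phi> \<longleftrightarrow> (\<forall>a\<in>A. \<forall>b\<in>A. \<Phi> (a + b) = \<Phi> a + \<Phi> b) \<and>
     (\<forall>c. \<forall>a\<in>A. \<Phi> (scaleC_op c o\<^sub>L a) = scaleC_op c o\<^sub>L \<Phi> a)"

lemma complex_linear_on_lin_comb:
  assumes "complex_linear_on (Cr G) \<Phi>" "finite F" "v ` F \<subseteq> Cr G"
  shows "lin_comb v c F \<in> Cr G" "\<Phi> (lin_comb v c F) = lin_comb (\<lambda>g. \<Phi> (v g)) c F"
proof -
  have zero: "0 \<in> Cr G" using group_alg_zero group_alg_subset_Cr by blast
  then have "\<Phi> (scaleC_op 0 o\<^sub>L 0) = scaleC_op 0 o\<^sub>L \<Phi> 0"
    using assms(1) unfolding complex_linear_on_def by blast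
  then have \<Phi>0: "\<Phi> 0 = 0" by simp
  have "lin_comb v c F \<in> Cr G \<and> \<Phi> (lin_comb v c F) = lin_comb (\<lambda>g. \<Phi> (v g)) c F"
    using assms(2,3)
  proof (induction F)
    case empty
    show ?case by (simp add: lin_comb_def zero \<Phi>0)
  next
    case (insert g F)
    have "v g \<in> Cr G" using insert.prems by simp
    then have "scaleC_op (c g) o\<^sub>L v g \<in> Cr G" "\<Phi> (scaleC_op (c g) o\<^sub>L v g) = scaleC_op (c g) o\<^sub>L \<Phi> (v g)"
      using assms(1) Cr_scale by (auto simp: complex_linear_on_def)
    then show ?case
      using insert assms(1) by (simp add: lin_comb_def complex_linear_on_def Cr_add)
  qed
  then show "lin_comb v c F \<in> Cr G" "\<Phi> (lin_comb v c F) = lin_comb (\<lambda>g. \<Phi> (v g)) c F" by auto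
qed

lemma complex_linear_on_diff:
  assumes "complex_linear_on (Cr G) \<Phi>" "a \<in> Cr G" "b \<in> Cr G"
  shows "\<Phi> (a - b) = \<Phi> a - \<Phi> b"
proof -
  have "\<Phi> (a + (scaleC_op (-1) o\<^sub>L b)) = \<Phi> a + (scaleC_op (-1) o\<^sub>L \<Phi> b)"
    using assms Cr_scale[OF assms(3), of "-1"] by (simp add: complex_linear_on_def)
  then show ?thesis by (simp flip: minus_eq_scaleC_op)
qed

text \<open>Linearity settles the span of the generators, continuity its closure. Uniqueness of
  extensions, transport along equivariant bijections and factorisation through Q all reduce to this
  comparison.\<close>

lemma Cr_eqI:
  assumes "complex_linear_on (Cr G) \<Phi>" "continuous_on (Cr G) \<Phi>"
    and "complex_linear_on (Cr G) \<Psi>" "continuous_on (Cr G) \<Psi>"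
    and gen: "\<And>g. g \<in> carrier G \<Longrightarrow> \<Phi> (left_reg G g) = \<Psi> (left_reg G g)"
    and a: "a \<in> Cr G"
  shows "\<Phi> a = \<Psi> a"
proof -
  obtain x where x: "\<And>n. x n \<in> group_alg G" "x \<longlonglongrightarrow> a" using Cr_seq[OF a] by blast
  have xC: "x n \<in> Cr G" for n using x(1) group_alg_subset_Cr by blast
  have "\<Phi> b = \<Psi> b" if b: "b \<in> group_alg G" for b
  proof -
    obtain c F where F: "finite F" "F \<subseteq> carrier G" and eq: "b = lin_comb (left_reg G) c F"
      using b unfolding group_alg_iff by blast
    have im: "left_reg G ` F \<subseteq> Cr G" using F(2) by (auto intro!: subsetD[OF group_alg_subset_Cr] group_alg_gen)
    show ?thesis
      unfolding eq complex_linear_on_lin_comb(2)[OF assms(1) F(1) im] complex_linear_on_lin_comb(2)[OF assms(3) F(1) im]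
      using F(2) gen by (intro lin_comb_cong) auto
  qed
  then have "(\<lambda>n. \<Phi> (x n)) = (\<lambda>n. \<Psi> (x n))" using x(1) by blast
  moreover have "(\<lambda>n. \<Phi> (x n)) \<longlonglongrightarrow> \<Phi> a" "(\<lambda>n. \<Psi> (x n)) \<longlonglongrightarrow> \<Psi> a"
    by (rule continuous_on_tendsto_compose[OF assms(2) x(2) a] continuous_on_tendsto_compose[OF assms(4) x(2) a],
        simp add: xC)+
  ultimately show ?thesis using LIMSEQ_unique by metis
qed

section \<open>Adjoints and norm limits\<close>

lemma bounded_bilinear_cinner: "bounded_bilinear cinner"
proof
  fix x y z :: "'a ell2" and r :: real
  have sR: "r *\<^sub>R x = scaleC_ell2 (of_real r) x" for x :: "'a ell2"
    by (rule ell2_eqI) (simp add: scaleR_ell2.rep_eq scaleC_ell2.rep_eq)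
  show "cinner (x + y) z = cinner x z + cinner y z" by (rule cinner_add_left)
  show "cinner x (y + z) = cinner x y + cinner x z" by (rule cinner_add_right)
  show "cinner (r *\<^sub>R x) y = r *\<^sub>R cinner x y" by (simp add: sR cinner_scaleC_left scaleR_conv_of_real)
  show "cinner x (r *\<^sub>R y) = r *\<^sub>R cinner x y" by (simp add: sR cinner_scaleC_right scaleR_conv_of_real)
  show "\<exists>K. \<forall>x y :: 'a ell2. norm (cinner x y) \<le> norm x * norm y * K"
    by (rule exI[of _ 1]) (simp add: cmod_cinner_le)
qed

text \<open>Applied to differences, this makes the adjoints of a convergent sequence converge to the
  adjoint of its limit.\<close>

lemma norm_adjoint_le:
  fixes T T' :: "'i ell2 \<Rightarrow>\<^sub>L 'i ell2"
  assumes "adjoint_pair T T'"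
  shows "norm T' \<le> norm T"
proof (rule norm_ell2_cinner_bound)
  fix x y :: "'i ell2" assume 1: "norm x = 1" "norm y = 1"
  have "cinner (blinfun_apply T' x) y = cnj (cinner (blinfun_apply T y) x)"
    using assms by (metis adjoint_pair_def cinner_commute)
  then have "cmod (cinner (blinfun_apply T' x) y) \<le> norm (blinfun_apply T y) * norm x"
    using cmod_cinner_le by simp
  also have "\<dots> \<le> norm T" using norm_blinfun[of T y] 1 by simp
  finally show "cmod (cinner (blinfun_apply T' x) y) \<le> norm T" .
qed simp

lemma adjoint_pair_diff: "adjoint_pair S S' \<Longrightarrow> adjoint_pair T T' \<Longrightarrow> adjoint_pair (S - T) (S' - T')"
  by (simp add: adjoint_pair_def blinfun.diff_left cinner_diff_left cinner_diff_right)

lemma adjoint_pair_lim: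
  assumes "S \<longlonglongrightarrow> s" "T \<longlonglongrightarrow> t" "\<And>n. adjoint_pair (S n) (T n)"
  shows "adjoint_pair s t"
  unfolding adjoint_pair_def
proof (intro allI)
  fix x y
  note lim = bounded_bilinear.tendsto[OF bounded_bilinear_cinner]
    bounded_bilinear.tendsto[OF bounded_bilinear_blinfun_apply]
  have "(\<lambda>n. cinner (blinfun_apply (S n) x) y) \<longlonglongrightarrow> cinner (blinfun_apply s x) y"
    and "(\<lambda>n. cinner x (blinfun_apply (T n) y)) \<longlonglongrightarrow> cinner x (blinfun_apply t y)"
    by (intro lim tendsto_const assms)+
  then show "cinner (blinfun_apply s x) y = cinner x (blinfun_apply t y)"
    using assms(3) by (simp add: adjoint_pair_def LIMSEQ_unique)
qed

lemma adjoint_pair_lin_comb: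
  assumes "group G" "star_rep G u" "F \<subseteq> carrier G"
  shows "adjoint_pair (lin_comb u c F) (lin_comb u (\<lambda>g. cnj (c (inv\<^bsub>G\<^esub> g))) (m_inv G ` F))"
  unfolding adjoint_pair_def
proof (intro allI)
  interpret group G by fact
  fix x y
  have inj: "inj_on (m_inv G) F" using assms(3) by (intro inj_on_inverseI[where g = "m_inv G"]) auto
  have "cinner (blinfun_apply (u g) x) y = cinner x (blinfun_apply (u (inv\<^bsub>G\<^esub> g)) y)" if "g \<in> F" for g
    using assms(2,3) that by (auto simp: star_rep_def adjoint_pair_def)
  then show "cinner (blinfun_apply (lin_comb u c F) x) y
    = cinner x (blinfun_apply (lin_comb u (\<lambda>g. cnj (c (inv\<^bsub>G\<^esub> g))) (m_inv G ` F)) y)"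
    unfolding lin_comb_apply cinner_sum_left cinner_sum_right sum.reindex[OF inj] o_def
    using assms(3) by (intro sum.cong) (auto simp: cinner_scaleC_left cinner_scaleC_right subset_eq)
qed

text \<open>The predicate under the definite description of \<open>Cr_extension\<close>;
  \<open>extensional\<close> pins down the values off the algebra, so that uniqueness is an equality
  of functions.\<close>

definition is_Cr_extension ::
    "('a, 'b) monoid_scheme \<Rightarrow> ('a \<Rightarrow> 'i ell2 \<Rightarrow>\<^sub>L 'i ell2) \<Rightarrow>
     (('a ell2 \<Rightarrow>\<^sub>L 'a ell2) \<Rightarrow> ('i ell2 \<Rightarrow>\<^sub>L 'i ell2)) \<Rightarrow> bool" where
  "is_Cr_extension G u \<Phi> \<longleftrightarrow> \<Phi> \<in> extensional (Cr G) \<and> star_hom_on (Cr G) \<Phi> \<and>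
     continuous_on (Cr G) \<Phi> \<and> (\<forall>g\<in>carrier G. \<Phi> (left_reg G g) = u g)"

lemma star_hom_on_complex_linear: "star_hom_on A \<Phi> \<Longrightarrow> complex_linear_on A \<Phi>"
  by (simp add: star_hom_on_def complex_linear_on_def)

lemma is_Cr_extension_unique:
  assumes "is_Cr_extension G u \<Phi>" "is_Cr_extension G u \<Psi>"
  shows "\<Phi> = \<Psi>"
proof (rule extensionalityI)
  show "\<Phi> \<in> extensional (Cr G)" "\<Psi> \<in> extensional (Cr G)"
    using assms by (auto simp: is_Cr_extension_def)
  show "\<Phi> a = \<Psi> a" if "a \<in> Cr G" for a
    by (rule Cr_eqI[of G]) (use assms that star_hom_on_complex_linear in \<open>auto simp: is_Cr_extension_def\<close>)
qed

text \<open>Weak containment makes the evident map on the group algebra contractive, so it extends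
  to the closure; each identity required of a *-homomorphism then passes to limits of sequences from
  the group algebra.\<close>

lemma is_Cr_extension_exists:
  assumes G: "group G" and amen: "amenable G" and u: "star_rep G u"
  shows "\<exists>\<Phi>. is_Cr_extension G u \<Phi>"
proof -
  interpret group G by fact
  \<comment> \<open>For a in the group algebra, the coefficient at g is the g entry of the image of
    the basis vector at the unit; \<phi> is therefore well defined without a choice of
    presentation.\<close>
  define coeff where "coeff a g = ell2_apply (blinfun_apply a (delta \<one>\<^bsub>G\<^esub>)) g" for a :: "'a ell2 \<Rightarrow>\<^sub>L 'a ell2" and g
  define \<phi> where "\<phi> a = lin_comb u (coeff a) {g \<in> carrier G. coeff a g \<noteq> 0}" for a
  have \<phi>: "\<phi> (lin_comb (left_reg G) c F) = lin_comb u c F" if F: "finite F" "F \<subseteq> carrier G" for c F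
  proof -
    have co: "coeff (lin_comb (left_reg G) c F) g = (if g \<in> F then c g else 0)" if "g \<in> carrier G" for g
      unfolding coeff_def using that by (simp add: lin_comb_left_reg_delta[OF G F])
    show ?thesis
      unfolding \<phi>_def lin_comb_def[of u] using F co
      by (intro sum.mono_neutral_cong_left) (auto split: if_splits)
  qed
  have \<phi>_gen: "\<phi> (left_reg G g) = u g" if "g \<in> carrier G" for g
    using \<phi>[of "{g}" "\<lambda>_. 1"] that by (simp add: lin_comb_def)
  have \<phi>_add: "\<phi> (a + b) = \<phi> a + \<phi> b" if "a \<in> group_alg G" "b \<in> group_alg G" for a b
    using that by (rule group_alg_two) (simp add: lin_comb_add \<phi>)
  have \<phi>_scale: "\<phi> (scaleC_op c o\<^sub>L a) = scaleC_op c o\<^sub>L \<phi> a" if a: "a \<in> group_alg G" for a c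
    using a unfolding group_alg_iff by (auto simp: lin_comb_scale \<phi>)
  have \<phi>_0: "\<phi> 0 = 0" using \<phi>_scale[OF group_alg_zero, of 0] by simp
  have \<phi>_gen_mult: "\<phi> (left_reg G g o\<^sub>L b) = u g o\<^sub>L \<phi> b" if g: "g \<in> carrier G" and b: "b \<in> group_alg G" for g b
    using b
  proof (induction rule: group_alg_induct)
    case zero
    show ?case by (simp add: \<phi>_0)
  next
    case (add c h b)
    have uh: "u (g \<otimes>\<^bsub>G\<^esub> h) = u g o\<^sub>L u h" using u g add(1) by (simp add: star_rep_def)
    have 1: "left_reg G g o\<^sub>L b \<in> group_alg G" "left_reg G (g \<otimes>\<^bsub>G\<^esub> h) \<in> group_alg G"
      "left_reg G h \<in> group_alg G"
      using add g by (auto intro!: group_alg_mult_gen[OF G] group_alg_gen)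
    have "left_reg G g o\<^sub>L ((scaleC_op c o\<^sub>L left_reg G h) + b)
      = (scaleC_op c o\<^sub>L left_reg G (g \<otimes>\<^bsub>G\<^esub> h)) + (left_reg G g o\<^sub>L b)"
      unfolding compose_add_right star_rep_compose_scaleC[OF left_reg_star_rep[OF G] g] left_reg_mult[OF G g add(1)] ..
    then show ?case
      using 1 add g by (simp add: \<phi>_add \<phi>_scale \<phi>_gen group_alg_scale uh compose_add_right
          star_rep_compose_scaleC[OF u g])
  qed
  have \<phi>_mult: "\<phi> (a o\<^sub>L b) = \<phi> a o\<^sub>L \<phi> b" if a: "a \<in> group_alg G" and b: "b \<in> group_alg G" for a b
    using a
  proof (induction rule: group_alg_induct)
    case zero
    show ?case by (simp add: \<phi>_0 bounded_bilinear.zero_left[OF bounded_bilinear_blinfun_compose])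
  next
    case (add c g a)
    have 1: "left_reg G g o\<^sub>L b \<in> group_alg G" "a o\<^sub>L b \<in> group_alg G" "left_reg G g \<in> group_alg G"
      using add b by (auto intro!: group_alg_mult_gen[OF G] group_alg_mult[OF G] group_alg_gen)
    show ?case
      using 1 add b by (simp add: compose_add_left compose_op_assoc \<phi>_add \<phi>_scale \<phi>_gen group_alg_scale \<phi>_gen_mult)
  qed
  have \<phi>_norm: "norm (\<phi> a - \<phi> b) \<le> norm (a - b)" if ab: "a \<in> group_alg G" "b \<in> group_alg G" for a b
  proof -
    have "\<phi> a = \<phi> ((a - b) + b)" by simp
    also have "\<dots> = \<phi> (a - b) + \<phi> b" by (rule \<phi>_add) (simp_all add: group_alg_diff that)
    finally have "\<phi> a - \<phi> b = \<phi> (a - b)" by simp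
    moreover obtain c F where "finite F" "F \<subseteq> carrier G" "a - b = lin_comb (left_reg G) c F"
      using group_alg_diff[OF ab] unfolding group_alg_iff by blast
    ultimately show ?thesis using star_rep_weakly_contained[OF G amen u] \<phi> by simp
  qed
  have "uniformly_continuous_on (group_alg G) \<phi>"
    unfolding uniformly_continuous_on_def dist_norm using \<phi>_norm by (meson le_less_trans)
  then obtain \<psi> where uc: "uniformly_continuous_on (Cr G) \<psi>" and \<psi>: "\<And>a. a \<in> group_alg G \<Longrightarrow> \<phi> a = \<psi> a"
    unfolding Cr_def by (rule uniformly_continuous_on_extension_on_closure) blast
  define \<Phi> where "\<Phi> = restrict \<psi> (Cr G)"
  have cont: "continuous_on (Cr G) \<Phi>"
    using uniformly_continuous_imp_continuous[OF uc] unfolding \<Phi>_def by (rule continuous_on_cong[THEN iffD1, rotated -1]) auto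
  have \<Phi>: "\<Phi> a = \<phi> a" if "a \<in> group_alg G" for a
    using that \<psi> group_alg_subset_Cr by (auto simp: \<Phi>_def)
  have lim: "(\<lambda>n. \<phi> (x n)) \<longlonglongrightarrow> \<Phi> a" if "\<And>n. x n \<in> group_alg G" "x \<longlonglongrightarrow> a" "a \<in> Cr G" for x a
  proof -
    have "(\<lambda>n. \<Phi> (x n)) \<longlonglongrightarrow> \<Phi> a"
      by (rule continuous_on_tendsto_compose[OF cont that(2,3)])
        (simp add: subsetD[OF group_alg_subset_Cr that(1)])
    then show ?thesis using \<Phi> that(1) by simp
  qed
  have "star_hom_on (Cr G) \<Phi>"
    unfolding star_hom_on_def
  proof (intro conjI ballI allI impI)
    fix a assume a: "a \<in> Cr G"
    obtain x where x: "\<And>n. x n \<in> group_alg G" "x \<longlonglongrightarrow> a" using Cr_seq[OF a] by blast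
    note xa = lim[OF x a]
    show "\<Phi> (scaleC_op c o\<^sub>L a) = scaleC_op c o\<^sub>L \<Phi> a" for c
    proof (rule LIMSEQ_unique)
      show "(\<lambda>n. \<phi> (scaleC_op c o\<^sub>L x n)) \<longlonglongrightarrow> \<Phi> (scaleC_op c o\<^sub>L a)"
        by (intro lim group_alg_scale x Cr_scale a tendsto_compose_op tendsto_const)
      show "(\<lambda>n. \<phi> (scaleC_op c o\<^sub>L x n)) \<longlonglongrightarrow> (scaleC_op c o\<^sub>L \<Phi> a)"
        unfolding \<phi>_scale[OF x(1)] by (intro tendsto_compose_op tendsto_const xa)
    qed
    fix b assume b: "b \<in> Cr G"
    obtain y where y: "\<And>n. y n \<in> group_alg G" "y \<longlonglongrightarrow> b" using Cr_seq[OF b] by blast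
    note yb = lim[OF y b]
    show "\<Phi> (a + b) = \<Phi> a + \<Phi> b"
    proof (rule LIMSEQ_unique)
      show "(\<lambda>n. \<phi> (x n + y n)) \<longlonglongrightarrow> \<Phi> (a + b)"
        by (intro lim group_alg_add x y Cr_add a b tendsto_add)
      show "(\<lambda>n. \<phi> (x n + y n)) \<longlonglongrightarrow> \<Phi> a + \<Phi> b"
        unfolding \<phi>_add[OF x(1) y(1)] by (intro tendsto_add xa yb)
    qed
    show "\<Phi> (a o\<^sub>L b) = \<Phi> a o\<^sub>L \<Phi> b"
    proof (rule LIMSEQ_unique)
      show "(\<lambda>n. \<phi> (x n o\<^sub>L y n)) \<longlonglongrightarrow> \<Phi> (a o\<^sub>L b)"
        by (intro lim group_alg_mult[OF G] x y Cr_mult[OF G] a b tendsto_compose_op)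
      show "(\<lambda>n. \<phi> (x n o\<^sub>L y n)) \<longlonglongrightarrow> (\<Phi> a o\<^sub>L \<Phi> b)"
        unfolding \<phi>_mult[OF x(1) y(1)] by (intro tendsto_compose_op xa yb)
    qed
    assume ab: "adjoint_pair a b"
    \<comment> \<open>Approximants of a are given, and b only as an adjoint of a. The formal
      adjoints of these approximants stay in the group algebra and converge to b by
      \<open>norm_adjoint_le\<close>.\<close>
    have "\<exists>z. z \<in> group_alg G \<and> adjoint_pair (x n) z \<and> adjoint_pair (\<phi> (x n)) (\<phi> z)" for n
    proof -
      obtain c F where F: "finite F" "F \<subseteq> carrier G" "x n = lin_comb (left_reg G) c F"
        using x(1)[of n] unfolding group_alg_iff by blast
      have iF: "finite (m_inv G ` F)" "m_inv G ` F \<subseteq> carrier G" using F by auto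
      show ?thesis
        using adjoint_pair_lin_comb[OF G left_reg_star_rep[OF G] F(2), of c] adjoint_pair_lin_comb[OF G u F(2), of c]
          F iF lin_comb_in_group_alg[OF iF] \<phi> by metis
    qed
    then obtain z where z: "\<And>n. z n \<in> group_alg G" "\<And>n. adjoint_pair (x n) (z n)"
      "\<And>n. adjoint_pair (\<phi> (x n)) (\<phi> (z n))" by metis
    have "norm (z n - b) \<le> norm (x n - a)" for n
      using norm_adjoint_le[OF adjoint_pair_diff[OF z(2) ab]] .
    then have "z \<longlonglongrightarrow> b"
      using x(2) unfolding LIMSEQ_iff by (meson le_less_trans)
    then show "adjoint_pair (\<Phi> a) (\<Phi> b)"
      using adjoint_pair_lim[OF xa lim[OF z(1) _ b] z(3)] by blast
  qed
  then have "is_Cr_extension G u \<Phi>"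
    unfolding is_Cr_extension_def using cont by (simp add: \<Phi> \<phi>_gen group_alg_gen) (simp add: \<Phi>_def)
  then show ?thesis by (intro exI[of _ \<Phi>])
qed

text \<open>Existence and uniqueness make the definite description denote; all later arguments about
  \<open>Cr_extension\<close> go through these three facts.\<close>

lemma Cr_extension_props:
  assumes "group G" "amenable G" "star_rep G u"
  shows "complex_linear_on (Cr G) (Cr_extension G u)" "continuous_on (Cr G) (Cr_extension G u)"
    "\<And>g. g \<in> carrier G \<Longrightarrow> Cr_extension G u (left_reg G g) = u g"
proof -
  have eq: "Cr_extension G u = (THE \<Phi>. is_Cr_extension G u \<Phi>)"
    by (simp add: Cr_extension_def is_Cr_extension_def)
  have "is_Cr_extension G u (Cr_extension G u)"
    unfolding eq using is_Cr_extension_exists[OF assms] is_Cr_extension_unique by (metis theI)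
  then show "complex_linear_on (Cr G) (Cr_extension G u)" "continuous_on (Cr G) (Cr_extension G u)"
    "\<And>g. g \<in> carrier G \<Longrightarrow> Cr_extension G u (left_reg G g) = u g"
    by (auto simp: is_Cr_extension_def star_hom_on_complex_linear)
qed

section \<open>Quotients of amenable groups\<close>

text \<open>\<open>perm_op\<close> stays inside one index type. For a bijection h of A onto B this
  operator identifies the functions supported on B with those supported on A, and so connects coset
  spaces of different types.\<close>

definition pull_op :: "'j set \<Rightarrow> ('j \<Rightarrow> 'i) \<Rightarrow> 'i ell2 \<Rightarrow>\<^sub>L 'j ell2" where
  "pull_op A h = Blinfun (\<lambda>x. Abs_ell2 (\<lambda>j. if j \<in> A then ell2_apply x (h j) else 0))"

lemma pull_op_apply:
  assumes h: "inj_on h A"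
  shows "ell2_apply (blinfun_apply (pull_op A h) x) j = (if j \<in> A then ell2_apply x (h j) else 0)"
proof -
  let ?f = "\<lambda>x j. if j \<in> A then ell2_apply x (h j) else 0"
  have bd: "(\<Sum>j\<in>F. (cmod (?f x j))\<^sup>2) \<le> (norm x)\<^sup>2" if F: "finite F" for F x
  proof -
    have "(\<Sum>j\<in>F. (cmod (?f x j))\<^sup>2) = (\<Sum>j\<in>F \<inter> A. (cmod (ell2_apply x (h j)))\<^sup>2)"
      using F by (intro sum.mono_neutral_cong_right) auto
    also have "\<dots> = (\<Sum>i\<in>h ` (F \<inter> A). (cmod (ell2_apply x i))\<^sup>2)"
      using h by (subst sum.reindex) (auto simp: inj_on_def)
    also have "\<dots> \<le> (norm x)\<^sup>2" using F by (intro sum_sq_ell2_le) simp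
    finally show ?thesis .
  qed
  have rep: "ell2_apply (Abs_ell2 (?f x)) = ?f x" and nrm: "norm (Abs_ell2 (?f x)) \<le> norm x" for x
    using Abs_ell2_bounded[of "?f x" "norm x"] bd[of _ x] by auto
  have "bounded_linear (\<lambda>x. Abs_ell2 (?f x))"
  proof
    show "Abs_ell2 (?f (x + y)) = Abs_ell2 (?f x) + Abs_ell2 (?f y)" for x y
      by (rule ell2_eqI) (auto simp: rep plus_ell2.rep_eq)
    show "Abs_ell2 (?f (r *\<^sub>R x)) = r *\<^sub>R Abs_ell2 (?f x)" for x and r
      by (rule ell2_eqI) (auto simp: rep scaleR_ell2.rep_eq)
    show "\<exists>K. \<forall>x. norm (Abs_ell2 (?f x)) \<le> norm x * K"
      by (rule exI[of _ 1]) (simp add: nrm)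
  qed
  then show ?thesis by (simp add: pull_op_def bounded_linear_Blinfun_apply rep)
qed

lemma pull_op_scaleC:
  assumes "inj_on h A"
  shows "pull_op A h o\<^sub>L (scaleC_op c o\<^sub>L T) = scaleC_op c o\<^sub>L (pull_op A h o\<^sub>L T)"
  by (intro blinfun_eqI ell2_eqI) (simp add: pull_op_apply[OF assms] scaleC_ell2.rep_eq)

text \<open>Isomorphic G-sets give unitarily equivalent permutation representations, hence equal
  kernels. One inclusion of kernels is stated; the inverse bijection yields the other.\<close>

lemma Cr_extension_equivariant:
  assumes G: "group G" "amenable G" and \<sigma>: "set_action G S \<sigma>" and \<tau>: "set_action G T \<tau>"
    and \<beta>: "bij_betw \<beta> S T" and eqv: "\<And>g i. g \<in> carrier G \<Longrightarrow> i \<in> S \<Longrightarrow> \<beta> (\<sigma> g i) = \<tau> g (\<beta> i)"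
    and a: "a \<in> Cr G" and zero: "Cr_extension G (\<lambda>g. perm_op T (\<tau> g)) a = 0"
  shows "Cr_extension G (\<lambda>g. perm_op S (\<sigma> g)) a = 0"
proof -
  interpret group G by fact
  note ps = Cr_extension_props[OF G perm_op_star_rep[OF G(1) \<sigma>]]
    and pt = Cr_extension_props[OF G perm_op_star_rep[OF G(1) \<tau>]]
  let ?\<beta>' = "inv_into S \<beta>"
  have inj: "inj_on \<beta> S" "inj_on ?\<beta>' T"
    using \<beta> bij_betw_inv_into[OF \<beta>] by (auto simp: bij_betw_def)
  let ?\<Psi> = "\<lambda>a. pull_op S \<beta> o\<^sub>L (Cr_extension G (\<lambda>g. perm_op T (\<tau> g)) a o\<^sub>L pull_op T ?\<beta>')"
  have "Cr_extension G (\<lambda>g. perm_op S (\<sigma> g)) a = ?\<Psi> a"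
  proof (rule Cr_eqI[OF ps(1,2) _ _ _ a])
    show "complex_linear_on (Cr G) ?\<Psi>"
      using pt(1) unfolding complex_linear_on_def
      by (auto simp: compose_add_left compose_add_right compose_op_assoc pull_op_scaleC[OF inj(1)])
    show "continuous_on (Cr G) ?\<Psi>"
      by (intro bounded_bilinear.continuous_on[OF bounded_bilinear_blinfun_compose] continuous_on_const pt(2))
    fix g assume g: "g \<in> carrier G"
    show "Cr_extension G (\<lambda>g. perm_op S (\<sigma> g)) (left_reg G g) = ?\<Psi> (left_reg G g)"
      unfolding ps(3)[OF g] pt(3)[OF g]
    proof (intro blinfun_eqI ell2_eqI)
      fix x i
      show "ell2_apply (blinfun_apply (perm_op S (\<sigma> g)) x) i
        = ell2_apply (blinfun_apply (pull_op S \<beta> o\<^sub>L (perm_op T (\<tau> g) o\<^sub>L pull_op T ?\<beta>')) x) i"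
      proof (cases "i \<in> S")
        case True
        have gi: "inv\<^bsub>G\<^esub> g \<in> carrier G" using g by simp
        have s: "\<sigma> (inv\<^bsub>G\<^esub> g) i \<in> S" by (rule set_action_inverse(1)[OF G(1) \<sigma> gi True])
        have "\<beta> i \<in> T" "\<beta> (\<sigma> (inv\<^bsub>G\<^esub> g) i) \<in> T"
          using True s \<beta> by (auto simp: bij_betw_def)
        then show ?thesis
          using True s inj(1)
          by (simp add: perm_op_action_apply[OF G(1) \<sigma> g] perm_op_action_apply[OF G(1) \<tau> g]
              pull_op_apply[OF inj(1)] pull_op_apply[OF inj(2)] eqv[OF gi True, symmetric])
      next
        case False
        then show ?thesis
          by (simp add: perm_op_action_apply[OF G(1) \<sigma> g] pull_op_apply[OF inj(1)])
      qed
    qed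
  qed
  then show ?thesis
    by (simp add: zero bounded_bilinear.zero_left[OF bounded_bilinear_blinfun_compose])
qed

text \<open>The quotient is abstracted to a surjective homomorphism, so the coset group
  \<open>G Mod N\<close> appears only when the locale is instantiated.\<close>

locale amenable_quotient = group_hom G K q for G (structure) and K (structure) and q +
  assumes amenable_G: "amenable G" and surj: "q ` carrier G = carrier K"
begin

lemma amenable_K: "amenable K"
  by (rule amenable_surj_hom[OF group_hom_axioms surj amenable_G])

definition Q where "Q = Cr_extension G (\<lambda>g. left_reg K (q g))"

definition pull where "pull Y = {g \<in> carrier G. q g \<in> Y}"

lemmas Q_props = Cr_extension_props[OF G.group_axioms amenable_G
    star_rep_hom[OF group_hom_axioms left_reg_star_rep[OF H.group_axioms]], folded Q_def]

lemma Q_lin_comb: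
  assumes "finite F" "v ` F \<subseteq> carrier G"
  shows "Q (lin_comb (\<lambda>i. left_reg G (v i)) c F) = lin_comb (\<lambda>i. left_reg K (q (v i))) c F"
proof -
  have "(\<lambda>i. left_reg G (v i)) ` F \<subseteq> Cr G"
    using assms(2) by (auto intro!: subsetD[OF group_alg_subset_Cr] group_alg_gen)
  then have "Q (lin_comb (\<lambda>i. left_reg G (v i)) c F) = lin_comb (\<lambda>i. Q (left_reg G (v i))) c F"
    by (rule complex_linear_on_lin_comb(2)[OF Q_props(1) assms(1)])
  also have "\<dots> = lin_comb (\<lambda>i. left_reg K (q (v i))) c F"
    using assms(2) Q_props(3) by (intro lin_comb_cong) auto
  finally show ?thesis .
qed

lemma Q_group_alg: "a \<in> group_alg G \<Longrightarrow> Q a \<in> group_alg K"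
proof -
  assume "a \<in> group_alg G"
  then obtain c F where F: "finite F" "F \<subseteq> carrier G" and a: "a = lin_comb (left_reg G) c F"
    unfolding group_alg_iff by blast
  have "Q a = lin_comb (\<lambda>g. left_reg K (q g)) c F"
    using Q_lin_comb[of F "\<lambda>g. g"] F by (simp add: a)
  also have "\<dots> \<in> group_alg K"
    unfolding lin_comb_def using F(2) by (intro group_alg_sum group_alg_scale group_alg_gen) auto
  finally show ?thesis .
qed

lemma Q_tendsto: "x \<longlonglongrightarrow> a \<Longrightarrow> (\<And>n. x n \<in> Cr G) \<Longrightarrow> (\<lambda>n. Q (x n)) \<longlonglongrightarrow> Q a"
  by (rule continuous_on_tendsto_compose[OF Q_props(2)]) (auto intro: Cr_closed_seq)

lemma Q_Cr: "a \<in> Cr G \<Longrightarrow> Q a \<in> Cr K"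
proof -
  assume "a \<in> Cr G"
  then obtain x where x: "\<And>n. x n \<in> group_alg G" "x \<longlonglongrightarrow> a" using Cr_seq by blast
  show ?thesis
  proof (rule Cr_closed_seq)
    show "Q (x n) \<in> Cr K" for n by (rule subsetD[OF group_alg_subset_Cr Q_group_alg[OF x(1)]])
    show "(\<lambda>n. Q (x n)) \<longlonglongrightarrow> Q a"
      by (rule Q_tendsto[OF x(2) subsetD[OF group_alg_subset_Cr x(1)]])
  qed
qed

text \<open>Compressing by an almost invariant vector that is supported on a section of \<open>q\<close> lifts
  \<open>b\<close> up to a small error without increasing the norm. The error has finite support, so it can be
  lifted termwise.\<close>

lemma group_alg_lift:
  assumes b: "b \<in> group_alg K" and e: "0 < e"
  obtains a where "a \<in> group_alg G" "Q a = b" "norm a \<le> norm b + e"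
proof -
  obtain c F where F: "finite F" "F \<subseteq> carrier K" and b_eq: "b = lin_comb (left_reg K) c F"
    using b unfolding group_alg_iff by blast
  obtain H f where H: "finite H" "H \<subseteq> carrier K" and f: "(\<Sum>h\<in>H. (cmod (f h))\<^sup>2) = 1"
    and small: "(\<Sum>g\<in>F. cmod (c g * (1 - schur_coeff K f H g))) \<le> e"
    by (rule almost_invariant_schur_coeff[OF H.group_axioms amenable_K F e])
  define s where "s = inv_into (carrier G) q"
  have s: "s k \<in> carrier G" "q (s k) = k" if "k \<in> carrier K" for k
    using that surj by (auto simp: s_def inv_into_into f_inv_into_f)
  have sF: "s ` F \<subseteq> carrier G" using s F(2) by auto
  note rep = left_reg_star_rep[OF G.group_axioms]
  let ?coef = "\<lambda>h k. (if k \<otimes>\<^bsub>K\<^esub> inv\<^bsub>K\<^esub> h \<in> F then c (k \<otimes>\<^bsub>K\<^esub> inv\<^bsub>K\<^esub> h) else 0) * (f h * cnj (f k))"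
  let ?v = "\<lambda>(h, k). s k \<otimes>\<^bsub>G\<^esub> inv\<^bsub>G\<^esub> (s h)"
  \<comment> \<open>The section s is not multiplicative, so s(k) s(h)^-1 depends on the pair and not
    on k h^-1 alone. The norm bound holds for arbitrary contractions and is unaffected, while q maps
    the product to k h^-1, so Q(B) is b with its coefficients multiplied by
    \<open>schur_coeff\<close>.\<close>
  define B where "B = (\<Sum>h\<in>H. \<Sum>k\<in>H. scaleC_op (?coef h k) o\<^sub>L (left_reg G (s k) o\<^sub>L left_reg G (inv\<^bsub>G\<^esub> (s h))))"
  define E where "E = lin_comb (\<lambda>g. left_reg G (s g)) (\<lambda>g. c g * (1 - schur_coeff K f H g)) F"
  have v: "?v ` (H \<times> H) \<subseteq> carrier G" using s H(2) by (auto simp: subset_eq)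
  have B_eq: "B = lin_comb (\<lambda>i. left_reg G (?v i)) (\<lambda>(h, k). ?coef h k) (H \<times> H)"
    unfolding B_def lin_comb_def sum.cartesian_product
    using s H(2) left_reg_mult[OF G.group_axioms] by (intro sum.cong) (auto simp: subset_eq)
  have "norm B \<le> norm b"
    unfolding B_def b_eq
    using s H(2) rep
    by (intro schur_transfer_bound[where V' = "\<lambda>h. left_reg G (inv\<^bsub>G\<^esub> (s h))"] H.group_axioms H F f)
      (auto simp: star_rep_def subset_eq)
  moreover have "norm E \<le> e"
    unfolding E_def using s F(2) rep by (intro order_trans[OF norm_lin_comb_le small]) (auto simp: star_rep_def)
  ultimately have norm: "norm (B + E) \<le> norm b + e" using norm_triangle_ineq[of B E] by linarith
  have B_alg: "B \<in> group_alg G"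
    unfolding B_eq lin_comb_def using v by (intro group_alg_sum group_alg_scale group_alg_gen) auto
  have E_alg: "E \<in> group_alg G"
    unfolding E_def lin_comb_def using s F(2) by (intro group_alg_sum group_alg_scale group_alg_gen) auto
  have "Q B = lin_comb (\<lambda>i. left_reg K (q (?v i))) (\<lambda>(h, k). ?coef h k) (H \<times> H)"
    unfolding B_eq by (rule Q_lin_comb) (use H v in auto)
  also have "\<dots> = (\<Sum>h\<in>H. \<Sum>k\<in>H. scaleC_op (?coef h k) o\<^sub>L left_reg K (k \<otimes>\<^bsub>K\<^esub> inv\<^bsub>K\<^esub> h))"
    unfolding lin_comb_def sum.cartesian_product
    using s H(2) by (intro sum.cong) (auto simp: subset_eq)
  also have "\<dots> = lin_comb (left_reg K) (\<lambda>g. c g * schur_coeff K f H g) F"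
    by (rule schur_sum_eq_lin_comb[OF H.group_axioms H F])
  finally have QB: "Q B = lin_comb (left_reg K) (\<lambda>g. c g * schur_coeff K f H g) F" .
  have "Q E = lin_comb (\<lambda>g. left_reg K (q (s g))) (\<lambda>g. c g * (1 - schur_coeff K f H g)) F"
    unfolding E_def by (rule Q_lin_comb[OF F(1) sF])
  also have "\<dots> = lin_comb (left_reg K) (\<lambda>g. c g * (1 - schur_coeff K f H g)) F"
    using s F(2) by (intro lin_comb_cong) auto
  finally have QE: "Q E = lin_comb (left_reg K) (\<lambda>g. c g * (1 - schur_coeff K f H g)) F" .
  have "Q (B + E) = Q B + Q E"
    using Q_props(1) B_alg E_alg group_alg_subset_Cr[of G] unfolding complex_linear_on_def by blast
  also have "\<dots> = b"
    unfolding QB QE lin_comb_add b_eq by (simp add: algebra_simps)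
  finally show ?thesis using norm group_alg_add[OF B_alg E_alg] that by blast
qed

lemma Q_diff: "a \<in> Cr G \<Longrightarrow> b \<in> Cr G \<Longrightarrow> Q (a - b) = Q a - Q b"
  by (rule complex_linear_on_diff[OF Q_props(1)])

text \<open>Differences of successive approximants of b are lifted with geometrically decaying
  norms; by completeness the lifts sum to a preimage.\<close>

lemma Q_surj:
  assumes b: "b \<in> Cr K"
  obtains a where "a \<in> Cr G" "Q a = b"
proof -
  \<comment> \<open>With radius 2^-n / 4, successive approximants differ by at most 2^-n / 2; this
    leaves 2^-n / 2 as allowance for the lift and 2^-n in total.\<close>
  have "\<exists>y\<in>group_alg K. dist y b < (1/2) ^ n / 4" for n
    using b[unfolded Cr_def closure_approachable, rule_format, of "(1/2) ^ n / 4"] by simp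
  then obtain y where y: "\<And>n. y n \<in> group_alg K" "\<And>n. dist (y n) b < (1/2) ^ n / 4" by metis
  have "\<exists>d\<in>group_alg G. Q d = y (Suc n) - y n \<and> norm d \<le> (1/2) ^ n" for n
  proof -
    have "norm (y (Suc n) - y n) \<le> dist (y (Suc n)) b + dist (y n) b"
      by (metis dist_norm dist_triangle2)
    also have "\<dots> \<le> (1/2) ^ n / 2"
      using y(2)[of n] y(2)[of "Suc n"] zero_less_power[of "1/2 :: real" n] by (simp add: field_simps)
    finally have "norm (y (Suc n) - y n) + (1/2) ^ n / 2 \<le> (1/2) ^ n" by simp
    moreover obtain d where "d \<in> group_alg G" "Q d = y (Suc n) - y n" "norm d \<le> norm (y (Suc n) - y n) + (1/2) ^ n / 2"
      by (rule group_alg_lift[OF group_alg_diff[OF y(1) y(1)], of "(1/2) ^ n / 2"]) auto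
    ultimately show ?thesis by force
  qed
  then obtain d where d: "\<And>n. d n \<in> group_alg G" "\<And>n. Q (d n) = y (Suc n) - y n" "\<And>n. norm (d n) \<le> (1/2) ^ n"
    by metis
  obtain a0 where a0: "a0 \<in> group_alg G" "Q a0 = y 0"
    by (rule group_alg_lift[OF y(1)[of 0], of 1]) auto
  define x where "x n = a0 + (\<Sum>i<n. d i)" for n
  have x_alg: "x n \<in> group_alg G" for n
    unfolding x_def by (intro group_alg_add group_alg_sum a0 d)
  have Qx: "Q (x n) = y n" for n
  proof (induction n)
    case (Suc n)
    have "Q (x n + d n) = Q (x n) + Q (d n)"
      using Q_props(1) x_alg[of n] d(1)[of n] group_alg_subset_Cr[of G] unfolding complex_linear_on_def by blast
    then show ?case using Suc d(2) by (simp add: x_def add.assoc)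
  qed (simp add: x_def a0)
  have "summable (\<lambda>n. norm (d n))"
    by (rule summable_comparison_test'[where g = "\<lambda>n. (1/2) ^ n"]) (auto simp: d(3) intro: summable_geometric)
  then have "(\<lambda>n. \<Sum>i<n. d i) \<longlonglongrightarrow> suminf d"
    by (rule summable_LIMSEQ[OF summable_norm_cancel])
  then have lim: "x \<longlonglongrightarrow> a0 + suminf d" unfolding x_def by (intro tendsto_add tendsto_const)
  have xC: "x n \<in> Cr G" for n by (rule subsetD[OF group_alg_subset_Cr x_alg])
  have half: "(\<lambda>n. (1/2 :: real) ^ n / 4) \<longlonglongrightarrow> 0"
    using tendsto_divide[OF LIMSEQ_power_zero[of "1/2 :: real"] tendsto_const[of 4]] by simp
  have "(\<lambda>n. y n - b) \<longlonglongrightarrow> 0"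
  proof (rule Lim_null_comparison[OF _ half])
    show "\<forall>\<^sub>F n in sequentially. norm (y n - b) \<le> (1/2) ^ n / 4"
      using less_imp_le[OF y(2)] by (simp add: dist_norm)
  qed
  then have "y \<longlonglongrightarrow> b" by (rule LIM_zero_cancel)
  moreover have "y \<longlonglongrightarrow> Q (a0 + suminf d)" using Q_tendsto[OF lim xC] Qx by simp
  ultimately have "Q (a0 + suminf d) = b" by (metis LIMSEQ_unique)
  then show ?thesis using Cr_closed_seq[OF xC lim] that by blast
qed

section \<open>Coset spaces of preimages and kernels of quasi-regular representations\<close>

lemma pull_subgroup:
  assumes "subgroup Y K"
  shows "subgroup (pull Y) G"
  using assms by (intro G.subgroupI) (auto simp: pull_def subgroup_def)

lemma pull_lcoset:
  assumes Y: "subgroup Y K" and g: "g \<in> carrier G"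
  shows "g <#\<^bsub>G\<^esub> pull Y = {x \<in> carrier G. q x \<in> q g <#\<^bsub>K\<^esub> Y}"
    and "q ` (g <#\<^bsub>G\<^esub> pull Y) = q g <#\<^bsub>K\<^esub> Y"
proof -
  have Yc: "Y \<subseteq> carrier K" using Y by (rule subgroup.subset)
  show 1: "g <#\<^bsub>G\<^esub> pull Y = {x \<in> carrier G. q x \<in> q g <#\<^bsub>K\<^esub> Y}"
  proof (intro subset_antisym subsetI)
    fix x assume "x \<in> g <#\<^bsub>G\<^esub> pull Y"
    then show "x \<in> {x \<in> carrier G. q x \<in> q g <#\<^bsub>K\<^esub> Y}"
      using g by (auto simp: l_coset_def pull_def)
  next
    fix x assume "x \<in> {x \<in> carrier G. q x \<in> q g <#\<^bsub>K\<^esub> Y}"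
    then obtain y where x: "x \<in> carrier G" and y: "y \<in> Y" "q x = q g \<otimes>\<^bsub>K\<^esub> y"
      by (auto simp: l_coset_def)
    have yc: "y \<in> carrier K" using y(1) Yc by blast
    have "q (inv\<^bsub>G\<^esub> g \<otimes>\<^bsub>G\<^esub> x) = y"
      using g x y yc by (simp add: H.m_assoc[symmetric])
    then have "inv\<^bsub>G\<^esub> g \<otimes>\<^bsub>G\<^esub> x \<in> pull Y" using g x y(1) by (simp add: pull_def)
    moreover have "x = g \<otimes>\<^bsub>G\<^esub> (inv\<^bsub>G\<^esub> g \<otimes>\<^bsub>G\<^esub> x)" using g x by (simp add: G.m_assoc[symmetric])
    ultimately show "x \<in> g <#\<^bsub>G\<^esub> pull Y" unfolding l_coset_def by blast
  qed
  have "q g <#\<^bsub>K\<^esub> Y \<subseteq> q ` carrier G"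
    unfolding surj using g Yc by (auto simp: l_coset_def)
  then show "q ` (g <#\<^bsub>G\<^esub> pull Y) = q g <#\<^bsub>K\<^esub> Y" unfolding 1 by blast
qed

text \<open>\<open>pull\<close> is defined on arbitrary subsets of K, so it also inverts the image
  map on cosets: each coset of \<open>pull Y\<close> is a full preimage by
  \<open>pull_lcoset\<close>.\<close>

lemma lcosets_pull_bij:
  assumes Y: "subgroup Y K"
  shows "bij_betw (\<lambda>C. q ` C) (lcosets\<^bsub>G\<^esub> (pull Y)) (lcosets\<^bsub>K\<^esub> Y)"
proof (rule bij_betwI[where g = pull])
  show "(`) q \<in> (lcosets\<^bsub>G\<^esub> (pull Y)) \<rightarrow> (lcosets\<^bsub>K\<^esub> Y)"
    using hom_closed by (fastforce simp: LCOSETS_def pull_lcoset(2)[OF Y])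
  show "pull \<in> (lcosets\<^bsub>K\<^esub> Y) \<rightarrow> (lcosets\<^bsub>G\<^esub> (pull Y))"
  proof
    fix D assume "D \<in> lcosets\<^bsub>K\<^esub> Y"
    then obtain k where k: "k \<in> carrier K" "D = k <#\<^bsub>K\<^esub> Y" by (auto simp: LCOSETS_def)
    then obtain g where "g \<in> carrier G" "D = q g <#\<^bsub>K\<^esub> Y" using surj by (metis imageE)
    then show "pull D \<in> lcosets\<^bsub>G\<^esub> (pull Y)"
      using pull_lcoset(1)[OF Y] by (auto simp: LCOSETS_def pull_def)
  qed
  show "pull (q ` C) = C" if C: "C \<in> lcosets\<^bsub>G\<^esub> (pull Y)" for C
  proof -
    obtain g where g: "g \<in> carrier G" "C = g <#\<^bsub>G\<^esub> pull Y" using C by (auto simp: LCOSETS_def)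
    have "pull (q ` C) = {x \<in> carrier G. q x \<in> q g <#\<^bsub>K\<^esub> Y}"
      unfolding g(2) pull_lcoset(2)[OF Y g(1)] by (simp only: pull_def)
    then show ?thesis by (simp only: pull_lcoset(1)[OF Y g(1)] g(2))
  qed
  show "q ` pull D = D" if "D \<in> lcosets\<^bsub>K\<^esub> Y" for D
  proof -
    have "D \<subseteq> carrier K" using that subgroup.lcosets_carrier[OF Y H.group_axioms] by blast
    then show ?thesis unfolding surj[symmetric] pull_def by blast
  qed
qed

lemma set_action_q:
  assumes "set_action K S \<tau>"
  shows "set_action G S (\<lambda>g. \<tau> (q g))"
  using assms by (auto simp: set_action_def)

text \<open>The link is the representation of G on the cosets of Y through q. It has the same kernel
  as the one on the cosets of \<open>pull Y\<close>, the two coset spaces being isomorphic G-sets,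
  and it equals the composition with Q because both agree on the generators.\<close>

lemma quasi_reg_Cr_pull_eq_0_iff:
  assumes Y: "subgroup Y K" and a: "a \<in> Cr G"
  shows "quasi_reg_Cr G (pull Y) a = 0 \<longleftrightarrow> quasi_reg_Cr K Y (Q a) = 0"
proof -
  note pY = pull_subgroup[OF Y]
  let ?S = "lcosets\<^bsub>G\<^esub> (pull Y)" and ?T = "lcosets\<^bsub>K\<^esub> Y"
  note actS = set_action_lcosets[OF G.group_axioms pY]
    and actT = set_action_q[OF set_action_lcosets[OF H.group_axioms Y]]
  let ?\<Phi> = "Cr_extension G (\<lambda>g. quasi_reg K Y (q g))"
  have eqv: "q ` (g <#\<^bsub>G\<^esub> C) = q g <#\<^bsub>K\<^esub> (q ` C)" if g: "g \<in> carrier G" and C: "C \<in> ?S" for g C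
  proof -
    have "C \<subseteq> carrier G" using C subgroup.lcosets_carrier[OF pY G.group_axioms] by blast
    then show ?thesis using g by (force simp: l_coset_def image_iff subset_eq)
  qed
  let ?\<beta>' = "inv_into ?S ((`) q)"
  note bij = lcosets_pull_bij[OF Y]
  have eqv': "?\<beta>' (q g <#\<^bsub>K\<^esub> D) = g <#\<^bsub>G\<^esub> ?\<beta>' D" if g: "g \<in> carrier G" and D: "D \<in> ?T" for g D
  proof -
    have 1: "?\<beta>' D \<in> ?S" "q ` ?\<beta>' D = D"
      using D bij by (auto simp: bij_betw_def inv_into_into f_inv_into_f)
    have 2: "g <#\<^bsub>G\<^esub> ?\<beta>' D \<in> ?S" by (rule set_action_inverse(1)[OF G.group_axioms actS g 1(1)])
    have "q ` (g <#\<^bsub>G\<^esub> ?\<beta>' D) = q g <#\<^bsub>K\<^esub> D" using eqv[OF g 1(1)] 1(2) by simp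
    then show ?thesis using bij_betw_inv_into_left[OF bij 2] by simp
  qed
  have "quasi_reg_Cr G (pull Y) a = 0 \<longleftrightarrow> ?\<Phi> a = 0"
    unfolding quasi_reg_Cr_def quasi_reg_def[abs_def]
  proof
    assume "Cr_extension G (\<lambda>g. perm_op ?S (\<lambda>C. g <#\<^bsub>G\<^esub> C)) a = 0"
    with eqv' show "Cr_extension G (\<lambda>g. perm_op ?T (\<lambda>C. q g <#\<^bsub>K\<^esub> C)) a = 0"
      by (rule Cr_extension_equivariant[where \<sigma> = "\<lambda>g C. q g <#\<^bsub>K\<^esub> C" and \<tau> = "\<lambda>g C. g <#\<^bsub>G\<^esub> C",
            OF G.group_axioms amenable_G actT actS bij_betw_inv_into[OF bij] _ a])
  next
    assume "Cr_extension G (\<lambda>g. perm_op ?T (\<lambda>C. q g <#\<^bsub>K\<^esub> C)) a = 0"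
    with eqv show "Cr_extension G (\<lambda>g. perm_op ?S (\<lambda>C. g <#\<^bsub>G\<^esub> C)) a = 0"
      by (rule Cr_extension_equivariant[where \<tau> = "\<lambda>g C. q g <#\<^bsub>K\<^esub> C" and \<sigma> = "\<lambda>g C. g <#\<^bsub>G\<^esub> C",
            OF G.group_axioms amenable_G actS actT bij _ a])
  qed
  also have "?\<Phi> a = quasi_reg_Cr K Y (Q a)"
    unfolding quasi_reg_Cr_def
  proof (rule Cr_eqI[OF _ _ _ _ _ a])
    note rep = quasi_reg_star_rep[OF H.group_axioms Y]
    note p1 = Cr_extension_props[OF G.group_axioms amenable_G star_rep_hom[OF group_hom_axioms rep]]
      and p2 = Cr_extension_props[OF H.group_axioms amenable_K rep]
    show "complex_linear_on (Cr G) ?\<Phi>" "continuous_on (Cr G) ?\<Phi>" by (rule p1)+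
    show "complex_linear_on (Cr G) (\<lambda>a. Cr_extension K (quasi_reg K Y) (Q a))"
      using Q_props(1) p2(1) Q_Cr by (simp add: complex_linear_on_def)
    show "continuous_on (Cr G) (\<lambda>a. Cr_extension K (quasi_reg K Y) (Q a))"
      by (rule continuous_on_compose2[OF p2(2) Q_props(2)]) (use Q_Cr in auto)
    fix g assume g: "g \<in> carrier G"
    show "?\<Phi> (left_reg G g) = Cr_extension K (quasi_reg K Y) (Q (left_reg G g))"
      using g by (simp add: p1(3) p2(3) Q_props(3))
  qed
  finally show ?thesis .
qed

text \<open>Both ideals are tested one subgroup at a time. For empty \<open>\<Y>\<close> both sides
  are all of \<open>Cr G\<close>, since Q maps into \<open>Cr K\<close>.\<close>

lemma J_ideal_pull:
  assumes "\<Y> \<subseteq> Sub K"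
  shows "J_ideal G (pull ` \<Y>) = {a \<in> Cr G. Q a \<in> J_ideal K \<Y>}"
proof -
  have "quasi_reg_Cr G (pull Y) a = 0 \<longleftrightarrow> quasi_reg_Cr K Y (Q a) = 0" if "Y \<in> \<Y>" "a \<in> Cr G" for Y a
    using assms that by (intro quasi_reg_Cr_pull_eq_0_iff) (auto simp: Sub_def)
  then show ?thesis by (auto simp: J_ideal_def Q_Cr)
qed

text \<open>Every element of the group algebra of K has a lift in that of G, and by
  \<open>J_ideal_pull\<close> any lift of an element of the ideal lies in the ideal upstairs. The
  size of the lift is irrelevant here.\<close>

lemma J_ideal_pull_group_alg:
  assumes "\<Y> \<subseteq> Sub K"
  shows "Q ` (J_ideal G (pull ` \<Y>) \<inter> group_alg G) = J_ideal K \<Y> \<inter> group_alg K"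
proof (intro subset_antisym subsetI)
  fix b assume "b \<in> Q ` (J_ideal G (pull ` \<Y>) \<inter> group_alg G)"
  then show "b \<in> J_ideal K \<Y> \<inter> group_alg K"
    using Q_group_alg by (auto simp: J_ideal_pull[OF assms])
next
  fix b assume b: "b \<in> J_ideal K \<Y> \<inter> group_alg K"
  then obtain a where "a \<in> group_alg G" "Q a = b"
    by (auto intro: group_alg_lift[of b 1])
  then show "b \<in> Q ` (J_ideal G (pull ` \<Y>) \<inter> group_alg G)"
    using b group_alg_subset_Cr[of G] by (auto simp: J_ideal_pull[OF assms] intro!: image_eqI[of _ _ a])
qed

text \<open>From G to K, approximants are pushed along the continuous surjection Q. Conversely, an
  approximant x of a need not lie in the ideal, but Q(x) is close to some b in the ideal and the
  group algebra of K; subtracting from x a small lift of Q(x) - b restores membership.\<close>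

lemma J_dense_iff:
  assumes Y: "\<Y> \<subseteq> Sub K"
  shows "J_ideal G (pull ` \<Y>) \<subseteq> closure (J_ideal G (pull ` \<Y>) \<inter> group_alg G) \<longleftrightarrow>
    J_ideal K \<Y> \<subseteq> closure (J_ideal K \<Y> \<inter> group_alg K)" (is "?JG \<subseteq> closure ?AG \<longleftrightarrow> ?JK \<subseteq> closure ?AK")
proof
  assume dense: "?JG \<subseteq> closure ?AG"
  show "?JK \<subseteq> closure ?AK"
  proof
    fix b assume b: "b \<in> ?JK"
    then have "b \<in> Cr K" by (simp add: J_ideal_def)
    then obtain a where a: "a \<in> Cr G" "Q a = b" by (rule Q_surj)
    then have "a \<in> ?JG" using b by (simp add: J_ideal_pull[OF Y])
    then obtain x where x: "\<And>n. x n \<in> ?AG" "x \<longlonglongrightarrow> a"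
      using subsetD[OF dense] unfolding closure_sequential by blast
    have "x n \<in> Cr G" for n using x(1)[of n] by (simp add: J_ideal_def)
    then have "(\<lambda>n. Q (x n)) \<longlonglongrightarrow> b" using Q_tendsto[OF x(2)] a(2) by simp
    moreover have "Q (x n) \<in> ?AK" for n
      using x(1)[of n] J_ideal_pull_group_alg[OF Y] by blast
    ultimately show "b \<in> closure ?AK"
      unfolding closure_sequential by (intro exI[of _ "\<lambda>n. Q (x n)"]) simp
  qed
next
  assume dense: "?JK \<subseteq> closure ?AK"
  show "?JG \<subseteq> closure ?AG"
  proof
    fix a assume "a \<in> ?JG"
    then have a: "a \<in> Cr G" and Qa: "Q a \<in> ?JK" by (auto simp: J_ideal_pull[OF Y])
    obtain x where x: "\<And>n. x n \<in> group_alg G" "x \<longlonglongrightarrow> a" using Cr_seq[OF a] by blast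
    have xC: "x n \<in> Cr G" for n by (rule subsetD[OF group_alg_subset_Cr x(1)])
    have Qx: "(\<lambda>n. Q (x n)) \<longlonglongrightarrow> Q a" by (rule Q_tendsto[OF x(2) xC])
    show "a \<in> closure ?AG"
      unfolding closure_approachable
    proof (intro allI impI)
      fix e :: real assume e: "0 < e"
      then have e4: "0 < e / 4" by simp
      obtain b where b: "b \<in> ?AK" "dist b (Q a) < e / 4"
        using subsetD[OF dense Qa, unfolded closure_approachable, rule_format, OF e4] by blast
      have "\<forall>\<^sub>F n in sequentially. dist (x n) a < e / 4 \<and> dist (Q (x n)) (Q a) < e / 4"
        by (intro eventually_conj tendstoD x(2) Qx e4)
      then obtain n where n: "dist (x n) a < e / 4" "dist (Q (x n)) (Q a) < e / 4"
        by (auto simp: eventually_sequentially)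
      \<comment> \<open>The lift d has norm below 3/4 of e: one quarter each for the distance of Q(x
        n) to Q(a), for that of Q(a) to b, and for the lifting allowance. The last quarter is the
        distance of x n to a.\<close>
      have "Q (x n) - b \<in> group_alg K" using b(1) by (intro group_alg_diff Q_group_alg x) auto
      then obtain d where d: "d \<in> group_alg G" "Q d = Q (x n) - b" "norm d \<le> norm (Q (x n) - b) + e / 4"
        by (rule group_alg_lift[OF _ e4])
      have dC: "d \<in> Cr G" by (rule subsetD[OF group_alg_subset_Cr d(1)])
      have diff: "x n - d \<in> group_alg G" by (rule group_alg_diff[OF x(1) d(1)])
      have "Q (x n - d) = b" by (simp add: Q_diff[OF xC dC] d(2))
      then have "x n - d \<in> ?AG"
        using b(1) diff subsetD[OF group_alg_subset_Cr diff] by (simp add: J_ideal_pull[OF Y])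
      moreover have "dist (x n - d) a < e"
      proof -
        have "norm (Q (x n) - b) \<le> dist (Q (x n)) (Q a) + dist b (Q a)"
          by (metis dist_norm dist_triangle2)
        then have "norm d < 3 * (e / 4)" using d(3) n(2) b(2) by simp
        moreover have "dist (x n - d) a \<le> dist (x n) a + norm d"
          using norm_triangle_ineq4[of "x n - a" d] by (simp add: dist_norm algebra_simps)
        ultimately show ?thesis using n(1) by simp
      qed
      ultimately show "\<exists>y\<in>?AG. dist y a < e" by blast
    qed
  qed
qed

end

section \<open>The Chabauty topology\<close>

lemma topspace_chabauty: "topspace (chabauty G) = Sub G"
  by (auto simp: chabauty_def topspace_pullback_topology)

lemma continuous_map_chabauty_mem:
  assumes "g \<in> carrier G"
  shows "continuous_map (chabauty G) (discrete_topology UNIV) (\<lambda>X. g \<in> X)"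
proof -
  have "continuous_map (chabauty G) (discrete_topology UNIV) ((\<lambda>x. x g) \<circ> (\<lambda>X. \<lambda>g\<in>carrier G. g \<in> X))"
    unfolding chabauty_def
    by (rule continuous_map_pullback, rule continuous_map_product_projection) (rule assms)
  then show ?thesis using assms by (simp add: o_def)
qed

context amenable_quotient
begin

lemma conj_invariant_pull:
  assumes Y: "\<Y> \<subseteq> Sub K" and inv: "conj_invariant K \<Y>"
  shows "conj_invariant G (pull ` \<Y>)"
  unfolding conj_invariant_def
proof (intro ballI)
  fix X g assume "X \<in> pull ` \<Y>" and g: "g \<in> carrier G"
  then obtain Y where Y': "Y \<in> \<Y>" "X = pull Y" by blast
  then have Yc: "Y \<subseteq> carrier K" using Y by (auto simp: Sub_def dest: subgroup.subset)
  have "g <#\<^bsub>G\<^esub> X #>\<^bsub>G\<^esub> inv\<^bsub>G\<^esub> g = pull (q g <#\<^bsub>K\<^esub> Y #>\<^bsub>K\<^esub> inv\<^bsub>K\<^esub> (q g))"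
  proof (intro subset_antisym subsetI)
    fix z assume "z \<in> g <#\<^bsub>G\<^esub> X #>\<^bsub>G\<^esub> inv\<^bsub>G\<^esub> g"
    then show "z \<in> pull (q g <#\<^bsub>K\<^esub> Y #>\<^bsub>K\<^esub> inv\<^bsub>K\<^esub> (q g))"
      using g Y'(2) by (auto simp: l_coset_def r_coset_def pull_def)
  next
    fix z assume "z \<in> pull (q g <#\<^bsub>K\<^esub> Y #>\<^bsub>K\<^esub> inv\<^bsub>K\<^esub> (q g))"
    then obtain y where z: "z \<in> carrier G" and y: "y \<in> Y" "q z = q g \<otimes>\<^bsub>K\<^esub> y \<otimes>\<^bsub>K\<^esub> inv\<^bsub>K\<^esub> (q g)"
      by (auto simp: l_coset_def r_coset_def pull_def)
    have yc: "y \<in> carrier K" using y(1) Yc by blast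
    define x where "x = inv\<^bsub>G\<^esub> g \<otimes>\<^bsub>G\<^esub> (z \<otimes>\<^bsub>G\<^esub> g)"
    have "q x = inv\<^bsub>K\<^esub> (q g) \<otimes>\<^bsub>K\<^esub> (q g \<otimes>\<^bsub>K\<^esub> y)"
      using g z yc by (simp add: x_def y(2) H.m_assoc)
    then have "q x = y" using g yc by (simp add: H.m_assoc[symmetric])
    then have "x \<in> X" using g z y(1) Y'(2) by (simp add: pull_def x_def)
    moreover have "z = g \<otimes>\<^bsub>G\<^esub> x \<otimes>\<^bsub>G\<^esub> inv\<^bsub>G\<^esub> g"
    proof -
      have "g \<otimes>\<^bsub>G\<^esub> x = z \<otimes>\<^bsub>G\<^esub> g" using g z by (simp add: x_def G.m_assoc[symmetric])
      then show ?thesis using g z by (simp add: G.m_assoc)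
    qed
    ultimately show "z \<in> g <#\<^bsub>G\<^esub> X #>\<^bsub>G\<^esub> inv\<^bsub>G\<^esub> g"
      unfolding l_coset_def r_coset_def by blast
  qed
  moreover have "q g <#\<^bsub>K\<^esub> Y #>\<^bsub>K\<^esub> inv\<^bsub>K\<^esub> (q g) \<in> \<Y>"
    using inv Y'(1) g by (simp add: conj_invariant_def)
  ultimately show "g <#\<^bsub>G\<^esub> X #>\<^bsub>G\<^esub> inv\<^bsub>G\<^esub> g \<in> pull ` \<Y>" by blast
qed

text \<open>The subgroups containing the kernel of q form a closed set S, on which the inverse r of
  \<open>pull\<close> is continuous; the family in question is the preimage of \<open>\<Y>\<close>
  under r.\<close>

lemma closedin_chabauty_pull:
  assumes closed: "closedin (chabauty K) \<Y>"
  shows "closedin (chabauty G) (pull ` \<Y>)"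
proof -
  have Y: "\<Y> \<subseteq> Sub K" using closedin_subset[OF closed] by (simp add: topspace_chabauty)
  define s where "s = inv_into (carrier G) q"
  have s: "s k \<in> carrier G" "q (s k) = k" if "k \<in> carrier K" for k
    using that surj by (auto simp: s_def inv_into_into f_inv_into_f)
  let ?ker = "kernel G K q"
  \<comment> \<open>An intersection of closed membership conditions. The unit lies in the kernel, so
    the index set is nonempty, as \<open>closedin_INT\<close> requires.\<close>
  define S where "S = (\<Inter>n\<in>?ker. {X \<in> topspace (chabauty G). (n \<in> X) \<in> {True}})"
  have one: "\<one>\<^bsub>G\<^esub> \<in> ?ker" by (simp add: kernel_def)
  have S_iff: "X \<in> S \<longleftrightarrow> subgroup X G \<and> ?ker \<subseteq> X" for X
    using one by (auto simp: S_def topspace_chabauty Sub_def)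
  have S_closed: "closedin (chabauty G) S"
    unfolding S_def
  proof (intro closedin_INT)
    show "?ker \<noteq> {}" using one by blast
    fix n assume "n \<in> ?ker"
    then have "n \<in> carrier G" by (simp add: kernel_def)
    then show "closedin (chabauty G) {X \<in> topspace (chabauty G). (n \<in> X) \<in> {True}}"
      by (intro closedin_continuous_map_preimage[OF continuous_map_chabauty_mem]) auto
  qed
  \<comment> \<open>Membership of k in the image of X involves the whole fibre over k. On S the
    single coordinate \<open>s k\<close> decides it, which makes r continuous coordinate by
    coordinate.\<close>
  define r where "r X = {k \<in> carrier K. s k \<in> X}" for X
  have mem: "s (q g) \<in> X \<longleftrightarrow> g \<in> X" if X: "X \<in> S" and g: "g \<in> carrier G" for X g
  proof -
    interpret X: subgroup X G using X by (simp add: S_iff)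
    have sq: "s (q g) \<in> carrier G" "q (s (q g)) = q g" using s g by auto
    have "inv\<^bsub>G\<^esub> g \<otimes>\<^bsub>G\<^esub> s (q g) \<in> ?ker" using g sq by (simp add: kernel_def)
    then have n: "inv\<^bsub>G\<^esub> g \<otimes>\<^bsub>G\<^esub> s (q g) \<in> X" using X by (auto simp: S_iff)
    have e1: "s (q g) = g \<otimes>\<^bsub>G\<^esub> (inv\<^bsub>G\<^esub> g \<otimes>\<^bsub>G\<^esub> s (q g))" using g sq by (simp add: G.m_assoc[symmetric])
    have e2: "g = s (q g) \<otimes>\<^bsub>G\<^esub> inv\<^bsub>G\<^esub> (inv\<^bsub>G\<^esub> g \<otimes>\<^bsub>G\<^esub> s (q g))"
      using g sq by (simp add: G.inv_mult_group G.m_assoc[symmetric])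
    show ?thesis using n e1 e2 X.m_closed X.m_inv_closed by metis
  qed
  have r_img: "r X = q ` X" if X: "X \<in> S" for X
  proof -
    have "X \<subseteq> carrier G" using X by (simp add: S_iff subgroup.subset)
    then show ?thesis using mem[OF X] s by (force simp: r_def)
  qed
  have r_cont: "continuous_map (subtopology (chabauty G) S) (chabauty K) r"
    unfolding chabauty_def[of K]
  proof (rule continuous_map_pullback')
    show "continuous_map (subtopology (chabauty G) S)
      (product_topology (\<lambda>_. discrete_topology UNIV) (carrier K)) ((\<lambda>X. \<lambda>g\<in>carrier K. g \<in> X) \<circ> r)"
      unfolding continuous_map_componentwise
    proof (intro conjI ballI)
      fix k assume k: "k \<in> carrier K"
      then have "(\<lambda>X. ((\<lambda>X. \<lambda>g\<in>carrier K. g \<in> X) \<circ> r) X k) = (\<lambda>X. s k \<in> X)"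
        by (auto simp: r_def)
      then show "continuous_map (subtopology (chabauty G) S) (discrete_topology UNIV)
        (\<lambda>X. ((\<lambda>X. \<lambda>g\<in>carrier K. g \<in> X) \<circ> r) X k)"
        using continuous_map_from_subtopology[OF continuous_map_chabauty_mem[OF s(1)[OF k]]] by simp
    qed auto
    show "topspace (subtopology (chabauty G) S) \<subseteq> r -` Sub K"
      using r_img subgroup_img_is_subgroup by (auto simp: Sub_def S_iff)
  qed
  have "pull ` \<Y> = {X \<in> topspace (subtopology (chabauty G) S). r X \<in> \<Y>}"
  proof (intro subset_antisym subsetI)
    fix X assume "X \<in> pull ` \<Y>"
    then obtain Y' where Y': "Y' \<in> \<Y>" "X = pull Y'" by blast
    then have sg: "subgroup Y' K" using Y by (auto simp: Sub_def)
    have "?ker \<subseteq> X"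
      using subgroup.one_closed[OF sg] by (auto simp: Y'(2) pull_def kernel_def)
    then have "X \<in> S" using pull_subgroup[OF sg] Y'(2) by (simp add: S_iff)
    moreover have "r X = Y'"
      using s subgroup.subset[OF sg] by (auto simp: r_def Y'(2) pull_def)
    ultimately show "X \<in> {X \<in> topspace (subtopology (chabauty G) S). r X \<in> \<Y>}"
      using Y'(1) by (simp add: topspace_chabauty Sub_def S_iff)
  next
    fix X assume "X \<in> {X \<in> topspace (subtopology (chabauty G) S). r X \<in> \<Y>}"
    then have X: "X \<in> S" "r X \<in> \<Y>" by auto
    have "X \<subseteq> carrier G" using X(1) by (simp add: S_iff subgroup.subset)
    then have "X = pull (r X)" using mem[OF X(1)] by (auto simp: pull_def r_def)
    then show "X \<in> pull ` \<Y>" using X(2) by blast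
  qed
  then have "closedin (subtopology (chabauty G) S) (pull ` \<Y>)"
    using closedin_continuous_map_preimage[OF r_cont closed] by simp
  then show ?thesis using S_closed by (rule closedin_trans_full)
qed

lemma density_sets_pull_iff:
  assumes "closedin (chabauty K) \<Y>" "conj_invariant K \<Y>"
  shows "pull ` \<Y> \<in> density_sets G \<longleftrightarrow> \<Y> \<in> density_sets K"
proof -
  have Y: "\<Y> \<subseteq> Sub K" using closedin_subset[OF assms(1)] by (simp add: topspace_chabauty)
  show ?thesis
    using assms closedin_chabauty_pull[OF assms(1)] conj_invariant_pull[OF Y assms(2)] J_dense_iff[OF Y]
    by (simp add: density_sets_def)
qed

end

theorem theorem4p9:
  fixes G :: "('a, 'b) monoid_scheme" and N :: "'a set"
  assumes "group G" and "amenable G" and "N \<lhd> G"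
  shows "(\<forall>\<Y>. closedin (chabauty (G Mod N)) \<Y> \<and> conj_invariant (G Mod N) \<Y> \<longrightarrow>
            J_ideal G (quot_pull G N ` \<Y>) = {a \<in> Cr G. quot_Cr G N a \<in> J_ideal (G Mod N) \<Y>} \<and>
            quot_Cr G N ` (J_ideal G (quot_pull G N ` \<Y>) \<inter> group_alg G)
              = J_ideal (G Mod N) \<Y> \<inter> group_alg (G Mod N) \<and>
            (quot_pull G N ` \<Y> \<in> density_sets G \<longleftrightarrow> \<Y> \<in> density_sets (G Mod N)))
         \<and> (density_property G \<longrightarrow> density_property (G Mod N))"
proof -
  interpret normal N G by (rule assms(3))
  have q: "quot_map G N = (\<lambda>g. N #>\<^bsub>G\<^esub> g)" by (simp add: quot_map_def fun_eq_iff)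
  interpret amenable_quotient G "G Mod N" "quot_map G N"
  proof (intro amenable_quotient.intro amenable_quotient_axioms.intro group_hom.intro group_hom_axioms.intro assms(1,2))
    show "group (G Mod N)" by (rule factorgroup_is_group)
    show "quot_map G N \<in> hom G (G Mod N)" unfolding q by (rule r_coset_hom_Mod)
    show "quot_map G N ` carrier G = carrier (G Mod N)"
      unfolding q by (auto simp: FactGroup_def RCOSETS_def)
  qed
  have pull: "quot_pull G N = pull" by (simp add: fun_eq_iff quot_pull_def pull_def)
  have Q: "quot_Cr G N = Q" by (simp add: quot_Cr_def Q_def)
  have sub: "\<Y> \<subseteq> Sub (G Mod N)" if "closedin (chabauty (G Mod N)) \<Y>" for \<Y>
    using closedin_subset[OF that] by (simp add: topspace_chabauty)
  have dp: "density_property (G Mod N)" if dG: "density_property G"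
    unfolding density_property_def
  proof (intro allI impI)
    fix \<Y> assume Y: "closedin (chabauty (G Mod N)) \<Y> \<and> conj_invariant (G Mod N) \<Y>"
    then have "pull ` \<Y> \<in> density_sets G"
      using dG closedin_chabauty_pull conj_invariant_pull[OF sub] by (simp add: density_property_def)
    then show "\<Y> \<in> density_sets (G Mod N)" using Y density_sets_pull_iff by blast
  qed
  show ?thesis
    unfolding pull Q
    using J_ideal_pull[OF sub] J_ideal_pull_group_alg[OF sub] density_sets_pull_iff dp by simp
qed

end
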